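(* Let $d \ge 2$, let $A \subset \mathbb{R}$ and let $\mu_A$ be a Frostman measure on $A$. Then the following hold. (1) Suppose that $\dim_{\mathcal H}(A) > \frac12 + \epsilon$ for some $0 < \epsilon \leq \frac12$. Then for $\mu_A \times \mu_A \times \dots \times \mu_A$-almost every $(a_1, a_2, \dots, a_d) \in A \times A \times \dots \times A$ ($d$ factors), $$\dim_{\mathcal H}(a_1 A + a_2 A + \dots + a_d A) \geq \min\left\{1, \tfrac12 + \epsilon(2d-1)\right\}.$$ (2) Suppose that $\dim_{\mathcal H}(A) > \frac12 + \frac{1}{2(2d-1)}$. Then for $\mu_A \times \mu_A \times \dots \times \mu_A$-almost every $(a_1, a_2, \dots, a_d) \in A \times A \times \dots \times A$, $$\mathcal{L}^1(a_1 A + a_2 A + \dots + a_d A) > 0.$$ (3) Suppose that $F \subset \mathbb{R}^d$ is star-like and let $\mu_F$ be a Frostman measure on $F$. Assume that $$\dim_{\mathcal H}(A) + \frac{\dim_{\mathcal H}(F)}{d} > 1.$$ Then for $\mu_F$-almost every $x = (x_1,\dots,x_d) \in F$, $$\mathcal{L}^1(x_1 A + x_2 A + \dots + x_d A) > 0.$$ In particular, if $\dim_{\mathcal H}(A) = \frac12 + \epsilon$ for some $\epsilon > 0$ and $\dim_{\mathcal H}(F) > \frac d2 - \epsilon$, then the last displayed inequality holds for $\mu_F$-almost every $x \in F$. (4) Suppose that $F \subset \mathbb{R}^d$ possesses a Borel measure $\mu_F$ such that $|\widehat{\mu}_F(\xi)| \lessapprox |\xi|^{-\gamma_F}$ for $|\xi|$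 sufficiently large, with some $\gamma_F > 1$. Suppose that $\dim_{\mathcal H}(A) > \frac12$. Then for $\mu_F$-almost every $x = (x_1,\dots,x_d)\in F$, $$\mathcal{L}^1(x_1 A + x_2 A + \dots + x_d A) > 0.$$
   Context: $\dim_{\mathcal H}$ is Hausdorff dimension and $\mathcal{L}^1$ is one-dimensional Lebesgue (outer) measure. For real numbers $a_1,\dots,a_d$, $a_1 A + \dots + a_d A = \{a_1 b_1 + \dots + a_d b_d : b_1, \dots, b_d \in A\}$. A Frostman measure on a set $E$ of Hausdorff dimension $s$ is a compactly supported Borel probability measure $\mu$ supported on $E$ such that for every $\eta>0$ there is $C_\eta$ with $\mu(B(x,r)) \le C_\eta r^{s-\eta}$ for all $x$ and all small $r>0$. A set $F\subset\mathbb{R}^d$ is star-like if there is a fixed number $M$ such that for every $\delta>0$ the intersection of $F$ with every tube of width $\delta$ containing the origin is contained in a union of at most $M$ balls of radius $\delta$. $|\widehat{\mu}_F(\xi)| \lessapprox |\xi|^{-\gamma_F}$ means that for every $\eta>0$ there is $C_\eta>0$ with $|\widehat{\mu}_F(\xi)| \le C_\eta |\xi|^{\eta-\gamma_F}$; here $\widehat{\mu}_F$ is the Fourier transform of the (finite, compactly supported) measure $\mu_F$, which is supported on $F$. *)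

theory Defs
  imports "HOL-Probability.Probability"
begin

text \<open>
  Hausdorff measure and dimension.  Three conventions of the library have to be
  worked around: \<^const>\<open>diameter\<close> is only meaningful for bounded sets (hence
  the boundedness condition on covers), \<^prop>\<open>(0::real) powr 0 = 0\<close> whereas
  the zero-dimensional gauge of a nonempty set is 1, and the empty set has gauge 0 for
  every exponent.
\<close>

definition hausdorff_gauge :: "real \<Rightarrow> 'a::metric_space set \<Rightarrow> ennreal" where
  "hausdorff_gauge s U =
     (if U = {} then 0 else if s = 0 then 1 else ennreal (diameter U powr s))"

definition hausdorff_content :: "real \<Rightarrow> real \<Rightarrow> 'a::metric_space set \<Rightarrow> ennreal" where
  "hausdorff_content s \<delta> E =
     (INF U \<in> {U :: nat \<Rightarrow> 'a set. E \<subseteq> (\<Union>i. U i) \<and> (\<forall>i. bounded (U i) \<and> diameter (U i) \<le> \<delta>)}.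
        (\<Sum>i. hausdorff_gauge s (U i)))"

definition hausdorff_measure :: "real \<Rightarrow> 'a::metric_space set \<Rightarrow> ennreal" where
  "hausdorff_measure s E = (SUP \<delta> \<in> {0<..}. hausdorff_content s \<delta> E)"

text \<open>
  The set below is never empty in a Euclidean space, since it contains every
  exponent larger than the dimension of the space, so the real infimum is meaningful.
\<close>

definition hausdorff_dim :: "'a::euclidean_space set \<Rightarrow> real" where
  "hausdorff_dim E = Inf {s. 0 \<le> s \<and> hausdorff_measure s E = 0}"

text \<open>
  Sets are arbitrary (possibly not Borel).  Accordingly, being supported on \<open>E\<close>
  is expressed by \<^term>\<open>AE x in \<mu>. x \<in> E\<close>: the complement of \<open>E\<close> is contained
  in a Borel null set.
\<close>

definition compactly_supported_on :: "'a::euclidean_space measure \<Rightarrow> 'a set \<Rightarrow> bool" where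
  "compactly_supported_on \<mu> E \<longleftrightarrow>
     (\<exists>K. compact K \<and> (AE x in \<mu>. x \<in> K)) \<and> (AE x in \<mu>. x \<in> E)"

definition frostman_measure :: "'a::euclidean_space measure \<Rightarrow> 'a set \<Rightarrow> bool" where
  "frostman_measure \<mu> E \<longleftrightarrow>
     prob_space \<mu> \<and> sets \<mu> = sets borel \<and> compactly_supported_on \<mu> E \<and>
     (\<forall>\<eta>>0. \<exists>C. \<forall>\<^sub>F r in at_right 0. \<forall>x.
        measure \<mu> (ball x r) \<le> C * r powr (hausdorff_dim E - \<eta>))"

definition lin_sumset :: "('n::finite \<Rightarrow> real) \<Rightarrow> real set \<Rightarrow> real set" where
  "lin_sumset a A = {\<Sum>i\<in>UNIV. a i * b i | b. \<forall>i. b i \<in> A}"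

text \<open>
  The tube of width \<open>w\<close> about the line through \<open>p\<close> with direction \<open>v\<close>;
  the width is the diameter of the cross-section.  Taking it to be the radius instead only
  changes the constant \<open>M\<close> in the next definition.
\<close>

definition tube :: "'a::euclidean_space \<Rightarrow> 'a \<Rightarrow> real \<Rightarrow> 'a set" where
  "tube p v w = {y. infdist y (range (\<lambda>t::real. p + t *\<^sub>R v)) \<le> w / 2}"

definition star_like :: "'a::euclidean_space set \<Rightarrow> bool" where
  "star_like F \<longleftrightarrow>
     (\<exists>M::nat. \<forall>\<delta>>0. \<forall>p v. v \<noteq> 0 \<and> 0 \<in> tube p v \<delta> \<longrightarrow>
        (\<exists>X. finite X \<and> card X \<le> M \<and> F \<inter> tube p v \<delta> \<subseteq> (\<Union>x\<in>X. ball x \<delta>)))"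

definition fourier_transform :: "'a::euclidean_space measure \<Rightarrow> 'a \<Rightarrow> complex" where
  "fourier_transform \<mu> \<xi> = (CLINT x|\<mu>. cis (- 2 * pi * (x \<bullet> \<xi>)))"

definition fourier_decay :: "'a::euclidean_space measure \<Rightarrow> real \<Rightarrow> bool" where
  "fourier_decay \<mu> \<gamma> \<longleftrightarrow>
     (\<forall>\<eta>>0. \<exists>C>0. \<forall>\<^sub>F \<xi> in at_infinity.
        cmod (fourier_transform \<mu> \<xi>) \<le> C * norm \<xi> powr (\<eta> - \<gamma>))"

end

(*
Write |nu_x^(t)|^2 = prod_i |mu^(t x_i)|^2 for the Fourier transform of the image nu_x of the
product measure mu x ... x mu under b -> sum_i x_i b_i. If int |nu_x^(t)|^2 (1 + |t|)^(s-1) dt is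
finite, Gaussian Fourier inversion gives (nu_x x nu_x){|u - v| <= h} <= C h^s for h <= 1, which
forces every set carrying nu_x to have dimension at least s, and positive Lebesgue measure if s = 1.
So it suffices to bound the average of this energy over x.

Parts (1)-(3): since mu has compact support, |mu^|^2 is essentially constant at scale 1. Hence the
average over R <= |t| < 2R is at most int_{|z| < R} prod_i |mu^(z_i)|^2 dz, which is O(R^(d - d k))
for every k < dim A, times the largest mass of {(t, x) : |t x - z| < 1}. This mass is O(R^(-b)) for
every b < dim F if x is distributed by a measure on a star-like set F, and with b = (d - 1) k if x is
distributed by mu x ... x mu, because there one coordinate already determines t up to O(1).

Part (4): the average of |nu_x^(t)|^2 over x is an integral of mu_F^ at multiples of t (y - z); its
integral over t is O(1 / |y - z|), and this is integrable because dim A > 1/2 and d >= 2.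
*)
theory Submission
  imports Defs "HOL-Real_Asymp.Real_Asymp"
begin

section \<open>Gaussian averages of characteristic functions\<close>

text \<open>Every cutoff is Gaussian: a Gaussian is positive, factors over coordinates and is its
  own transform up to scale, so \<open>integral_gauss_char\<close> alone carries L^2 bounds between
  space and frequency. Local constancy becomes an exact formula by tilting: mu is a Gaussian times
  \<open>tilt\<close>, so mu^ is a Gaussian average of the transform of \<open>tilt\<close>.

  The obstacle in (1)-(3) is that a coordinate x_i fixes t only while x_i stays away from 0. The
  averages are therefore taken over |x_i| >= c, with a constant that blows up as c -> 0; this is
  harmless, because only finiteness almost everywhere is wanted.

  Weighting the block |t| ~ R by R^(s - 1) and summing over dyadic R requires s < 1 - d + d k + b.
  For b = (d - 1) k this reads s < 1 - d + (2d - 1) k, which at k = 1/2 + eps is 1/2 + (2d - 1) eps: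
  the origin of the exponents in (1) and (2).

  In (4) the kernel 1 / |y - z| is split into a power -1/2 of each of two coordinate differences,
  and such a power is integrable because dim A > 1/2.\<close>

definition gauss_const :: "real \<Rightarrow> real \<Rightarrow> real" where
  "gauss_const c \<kappa> = (\<Sum>n. exp (- c * (real n)\<^sup>2) * (real n + 1) powr \<kappa>)"

lemma summable_gauss:
  assumes "0 < c"
  shows "summable (\<lambda>n. exp (- c * (real n)\<^sup>2) * (real n + 1) powr \<kappa>)"
proof (rule summable_comparison_test_bigo)
  show "summable (\<lambda>n. norm (inverse (real n ^ 2)))"
    using inverse_power_summable[of 2] by simp
  show "(\<lambda>n. exp (- c * (real n)\<^sup>2) * (real n + 1) powr \<kappa>) \<in> O(\<lambda>n. inverse (real n ^ 2))"
    using assms by real_asymp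
qed

lemma gauss_const_nonneg: "0 < c \<Longrightarrow> 0 \<le> gauss_const c \<kappa>"
  unfolding gauss_const_def by (intro suminf_nonneg summable_gauss) auto

text \<open>Sum over the shells n <= R * D x < n + 1: there the Gaussian is at most exp (- c * n^2),
  and the shell lies in {D <= (n + 1) / R}, whose mass \<open>tail\<close> controls.
  \<open>D\<close> will be the distance from a point or from a line through the origin, or |t * y -
  z| / R.\<close>

lemma nn_integral_gauss_le:
  fixes D :: "'b \<Rightarrow> real"
  assumes [measurable]: "D \<in> borel_measurable M" and c: "0 < c" and R: "0 < R" and C: "0 \<le> C"
    and D0: "\<And>x. x \<in> space M \<Longrightarrow> 0 \<le> D x"
    and tail: "\<And>r. 0 < r \<Longrightarrow> emeasure M {x \<in> space M. D x \<le> r} \<le> ennreal (C * r powr \<kappa>)"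
  shows "(\<integral>\<^sup>+x. ennreal (exp (- c * (R * D x)\<^sup>2)) \<partial>M) \<le> ennreal (C * gauss_const c \<kappa> * R powr - \<kappa>)"
proof -
  define S where "S n = {x \<in> space M. D x \<le> (real n + 1) / R}" for n
  have [measurable]: "S n \<in> sets M" for n unfolding S_def by measurable
  have "(\<integral>\<^sup>+x. ennreal (exp (- c * (R * D x)\<^sup>2)) \<partial>M)
      \<le> (\<integral>\<^sup>+x. (\<Sum>n. ennreal (exp (- c * (real n)\<^sup>2)) * indicator (S n) x) \<partial>M)"
  proof (rule nn_integral_mono)
    fix x assume x: "x \<in> space M"
    define n where "n = nat \<lfloor>R * D x\<rfloor>"
    have RD: "0 \<le> R * D x" using R D0[OF x] by simp
    have n: "real n \<le> R * D x" "R * D x < real n + 1" unfolding n_def using RD by linarith+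
    have xS: "x \<in> S n" using x n(2) R by (simp add: S_def field_simps)
    have "(real n)\<^sup>2 \<le> (R * D x)\<^sup>2" using n by (intro power_mono) auto
    then have "ennreal (exp (- c * (R * D x)\<^sup>2)) \<le> ennreal (exp (- c * (real n)\<^sup>2))"
      using c by (intro ennreal_leI) simp
    also have "\<dots> = (\<Sum>k\<in>{n}. ennreal (exp (- c * (real k)\<^sup>2)) * indicator (S k) x)"
      using xS by simp
    also have "\<dots> \<le> (\<Sum>n. ennreal (exp (- c * (real n)\<^sup>2)) * indicator (S n) x)"
      by (rule sum_le_suminf) auto
    finally show "ennreal (exp (- c * (R * D x)\<^sup>2)) \<le> \<dots>" .
  qed
  also have "\<dots> = (\<Sum>n. ennreal (exp (- c * (real n)\<^sup>2)) * emeasure M (S n))"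
    by (simp add: nn_integral_suminf nn_integral_cmult_indicator)
  also have "\<dots> \<le> (\<Sum>n. ennreal (C * R powr - \<kappa> * (exp (- c * (real n)\<^sup>2) * (real n + 1) powr \<kappa>)))"
  proof (rule suminf_le)
    fix n
    have "ennreal (exp (- c * (real n)\<^sup>2)) * emeasure M (S n)
        \<le> ennreal (exp (- c * (real n)\<^sup>2)) * ennreal (C * ((real n + 1) / R) powr \<kappa>)"
      unfolding S_def using R by (intro mult_left_mono tail) auto
    also have "\<dots> = ennreal (C * R powr - \<kappa> * (exp (- c * (real n)\<^sup>2) * (real n + 1) powr \<kappa>))"
      using R C by (simp add: ennreal_mult'[symmetric] powr_divide powr_minus field_simps)
    finally show "ennreal (exp (- c * (real n)\<^sup>2)) * emeasure M (S n) \<le> \<dots>" .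
  qed auto
  also have "\<dots> = ennreal (C * R powr - \<kappa> * gauss_const c \<kappa>)"
    unfolding gauss_const_def
    by (subst suminf_ennreal2)
       (use C summable_gauss[OF c] in \<open>auto intro!: summable_mult simp: suminf_mult\<close>)
  finally show ?thesis by (simp add: mult_ac)
qed

lemma (in finite_measure) integrable_iexp':
  assumes [measurable]: "f \<in> borel_measurable M"
  shows "integrable M (\<lambda>x. iexp (f x))"
  by (rule integrable_const_bound[where B=1]) auto

text \<open>Kept for a general phase \<open>f\<close>, since it serves both t * x on the line and a
  linear form on the product space.\<close>

lemma (in finite_measure) cmod_integral_iexp_square:
  assumes f [measurable]: "f \<in> borel_measurable M"
  shows "complex_of_real ((cmod (CLINT x|M. iexp (f x)))\<^sup>2) = (CLINT p|(M \<Otimes>\<^sub>M M). iexp (f (fst p) - f (snd p)))"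
proof -
  interpret P: pair_sigma_finite M M ..
  interpret PP: finite_measure "M \<Otimes>\<^sub>M M"
    by (simp add: finite_measure_pair_measure finite_measure_axioms)
  let ?c = "CLINT x|M. iexp (f x)"
  have eq: "iexp (f u - f v) = iexp (f u) * cnj (iexp (f v))" for u v
    by (simp add: exp_cnj exp_add[symmetric] algebra_simps)
  have i: "integrable (M \<Otimes>\<^sub>M M) (\<lambda>(u, v). iexp (f u - f v))"
    using PP.integrable_iexp'[of "\<lambda>(u,v). f u - f v"] by (simp add: case_prod_unfold)
  have "complex_of_real ((cmod ?c)\<^sup>2) = ?c * cnj ?c"
    by (rule complex_norm_square)
  also have "\<dots> = (CLINT u|M. iexp (f u) * cnj ?c)"
    by (subst integral_mult_left_zero) simp
  also have "\<dots> = (CLINT u|M. CLINT v|M. iexp (f u - f v))"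
    unfolding eq by simp
  also have "\<dots> = (CLINT p|(M \<Otimes>\<^sub>M M). iexp (f (fst p) - f (snd p)))"
    using P.integral_fst[OF i] by (simp add: case_prod_unfold)
  finally show ?thesis .
qed

text \<open>Finite rather than probability measures, because the tilted measure used later is not
  normalised.\<close>

locale finite_borel_measure = finite_measure M for M :: "real measure" +
  assumes sets_eq_borel [measurable_cong]: "sets M = sets borel"
begin

lemma measurable_char [measurable]: "char M \<in> borel_measurable borel"
  unfolding char_def by measurable

lemma cmod_char_le: "cmod (char M t) \<le> measure M (space M)"
proof -
  have "cmod (char M t) \<le> (\<integral>x. cmod (iexp (t * x)) \<partial>M)"
    unfolding char_def by (rule integral_norm_bound)
  also have "\<dots> = measure M (space M)" by simp
  finally show ?thesis .
qed

lemma cmod_char_square: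
  "complex_of_real ((cmod (char M t))\<^sup>2) = (CLINT p|(M \<Otimes>\<^sub>M M). iexp (t * (fst p - snd p)))"
  using cmod_integral_iexp_square[of "\<lambda>x. t * x"] unfolding char_def by (simp add: algebra_simps)

text \<open>By Fubini, since the Gaussian average of \<open>iexp (L * z * (u - v))\<close> is the
  normal characteristic function at L * (u - v). This plays the role of Plancherel and is used in
  both directions: from small balls to L^2 averages for \<open>tilt\<close>, and from finite energy
  to near-diagonal mass for the projections.\<close>

lemma integral_gauss_char:
  "(\<integral>\<^sup>+z. ennreal ((cmod (char M (L * z)))\<^sup>2) \<partial>std_normal_distribution)
    = (\<integral>\<^sup>+p. ennreal (exp (- (L * (fst p - snd p))\<^sup>2 / 2)) \<partial>(M \<Otimes>\<^sub>M M))"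
proof -
  let ?N = std_normal_distribution
  interpret N: real_distribution ?N by (rule real_dist_normal_dist)
  interpret PP: finite_measure "M \<Otimes>\<^sub>M M"
    by (simp add: finite_measure_pair_measure finite_measure_axioms)
  interpret NP: pair_sigma_finite ?N "M \<Otimes>\<^sub>M M" ..
  interpret NPP: finite_measure "?N \<Otimes>\<^sub>M (M \<Otimes>\<^sub>M M)"
    by (simp add: finite_measure_pair_measure N.finite_measure_axioms PP.finite_measure_axioms)
  have i: "integrable (?N \<Otimes>\<^sub>M (M \<Otimes>\<^sub>M M)) (\<lambda>(z, p). iexp (L * z * (fst p - snd p)))"
    using NPP.integrable_iexp'[of "\<lambda>(z,p). L * z * (fst p - snd p)"] by (simp add: case_prod_unfold)
  have int1: "integrable ?N (\<lambda>z. (cmod (char M (L * z)))\<^sup>2)"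
    by (rule N.integrable_const_bound[where B="(measure M (space M))\<^sup>2"])
       (auto intro!: AE_I2 power_mono cmod_char_le)
  have int2: "integrable (M \<Otimes>\<^sub>M M) (\<lambda>p. exp (- (L * (fst p - snd p))\<^sup>2 / 2))"
    by (rule PP.integrable_const_bound[where B=1]) auto
  have "complex_of_real (\<integral>z. (cmod (char M (L * z)))\<^sup>2 \<partial>?N)
     = (CLINT z|?N. CLINT p|(M \<Otimes>\<^sub>M M). iexp (L * z * (fst p - snd p)))"
    unfolding integral_complex_of_real[symmetric] cmod_char_square ..
  also have "\<dots> = (CLINT p|(M \<Otimes>\<^sub>M M). CLINT z|?N. iexp (L * z * (fst p - snd p)))"
    by (rule NP.Fubini_integral[OF i, symmetric])
  also have "\<dots> = (CLINT p|(M \<Otimes>\<^sub>M M). char ?N (L * (fst p - snd p)))"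
    unfolding char_def by (intro Bochner_Integration.integral_cong refl) (simp add: mult_ac)
  also have "\<dots> = complex_of_real (\<integral>p. exp (- (L * (fst p - snd p))\<^sup>2 / 2) \<partial>(M \<Otimes>\<^sub>M M))"
    unfolding integral_complex_of_real[symmetric] char_std_normal_distribution ..
  finally have eq: "(\<integral>z. (cmod (char M (L * z)))\<^sup>2 \<partial>?N)
      = (\<integral>p. exp (- (L * (fst p - snd p))\<^sup>2 / 2) \<partial>(M \<Otimes>\<^sub>M M))"
    using of_real_eq_iff by blast
  have "(\<integral>\<^sup>+z. ennreal ((cmod (char M (L * z)))\<^sup>2) \<partial>?N) = ennreal (\<integral>z. (cmod (char M (L * z)))\<^sup>2 \<partial>?N)"
    by (rule nn_integral_eq_integral[OF int1]) (rule AE_I2, rule zero_le_power2)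
  moreover have "(\<integral>\<^sup>+p. ennreal (exp (- (L * (fst p - snd p))\<^sup>2 / 2)) \<partial>(M \<Otimes>\<^sub>M M))
      = ennreal (\<integral>p. exp (- (L * (fst p - snd p))\<^sup>2 / 2) \<partial>(M \<Otimes>\<^sub>M M))"
    by (rule nn_integral_eq_integral[OF int2]) (rule AE_I2, rule exp_ge_zero)
  ultimately show ?thesis unfolding eq by (simp only:)
qed

text \<open>
  Since \<open>exp (- y\<^sup>2 / 2)\<close> is the characteristic function of the standard normal distribution,
  undoing this weight by a density exhibits \<open>char M\<close> as a Gaussian average; then apply Jensen.
\<close>

lemma char_local_bound:
  assumes fin: "finite_measure (density M (\<lambda>y. ennreal (exp (y\<^sup>2 / 2))))"
  shows "ennreal ((cmod (char M \<tau>))\<^sup>2) \<le>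
    (\<integral>\<^sup>+z. ennreal ((cmod (char (density M (\<lambda>y. ennreal (exp (y\<^sup>2 / 2)))) (\<tau> + z)))\<^sup>2) \<partial>std_normal_distribution)"
proof -
  let ?N = std_normal_distribution
  define M' where "M' = density M (\<lambda>y. ennreal (exp (y\<^sup>2 / 2)))"
  interpret N: real_distribution ?N by (rule real_dist_normal_dist)
  interpret M': finite_borel_measure M'
    unfolding M'_def finite_borel_measure_def finite_borel_measure_axioms_def
    using fin by (simp add: sets_eq_borel)
  interpret NP: pair_sigma_finite ?N M' ..
  interpret NPP: finite_measure "?N \<Otimes>\<^sub>M M'"
    by (simp add: finite_measure_pair_measure N.finite_measure_axioms M'.finite_measure_axioms)
  have i: "integrable (?N \<Otimes>\<^sub>M M') (\<lambda>(z, y). iexp ((\<tau> + z) * y))"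
    using NPP.integrable_iexp'[of "\<lambda>(z,y). (\<tau> + z) * y"] by (simp add: case_prod_unfold)
  have int1: "integrable ?N (\<lambda>z. cmod (char M' (\<tau> + z)))"
    by (rule N.integrable_const_bound[where B="measure M' (space M')"])
       (auto intro!: AE_I2 M'.cmod_char_le)
  have int2: "integrable ?N (\<lambda>z. (cmod (char M' (\<tau> + z)))\<^sup>2)"
    by (rule N.integrable_const_bound[where B="(measure M' (space M'))\<^sup>2"])
       (auto intro!: AE_I2 power_mono M'.cmod_char_le)
  have "(CLINT z|?N. char M' (\<tau> + z)) = (CLINT y|M'. CLINT z|?N. iexp ((\<tau> + z) * y))"
    unfolding char_def by (rule NP.Fubini_integral[OF i, symmetric])
  also have "\<dots> = (CLINT y|M'. iexp (\<tau> * y) * char ?N y)"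
  proof (intro Bochner_Integration.integral_cong refl)
    fix y
    have "iexp ((\<tau> + z) * y) = iexp (\<tau> * y) * iexp (y * z)" for z
      by (simp add: exp_add[symmetric] algebra_simps)
    then show "(CLINT z|?N. iexp ((\<tau> + z) * y)) = iexp (\<tau> * y) * char ?N y"
      unfolding char_def by simp
  qed
  also have "\<dots> = (CLINT y|M. exp (y\<^sup>2 / 2) *\<^sub>R (iexp (\<tau> * y) * char ?N y))"
    unfolding M'_def by (subst integral_density) (auto simp: char_std_normal_distribution)
  also have "\<dots> = char M \<tau>"
    unfolding char_def[of M]
    by (intro Bochner_Integration.integral_cong refl)
       (simp add: char_std_normal_distribution scaleR_conv_of_real exp_of_real[symmetric] exp_add[symmetric])
  finally have "cmod (char M \<tau>) \<le> (\<integral>z. cmod (char M' (\<tau> + z)) \<partial>?N)"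
    using integral_norm_bound[of ?N "\<lambda>z. char M' (\<tau> + z)"] by simp
  then have "(cmod (char M \<tau>))\<^sup>2 \<le> (\<integral>z. cmod (char M' (\<tau> + z)) \<partial>?N)\<^sup>2"
    by (intro power_mono) auto
  also have "\<dots> \<le> (\<integral>z. (cmod (char M' (\<tau> + z)))\<^sup>2 \<partial>?N)"
    using N.variance_eq[OF int1 int2] N.variance_positive[of "\<lambda>z. cmod (char M' (\<tau> + z))"] by simp
  finally have "ennreal ((cmod (char M \<tau>))\<^sup>2) \<le> ennreal (\<integral>z. (cmod (char M' (\<tau> + z)))\<^sup>2 \<partial>?N)"
    by (rule ennreal_leI)
  also have "\<dots> = (\<integral>\<^sup>+z. ennreal ((cmod (char M' (\<tau> + z)))\<^sup>2) \<partial>?N)"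
    by (subst nn_integral_eq_integral) (use int2 in auto)
  finally show ?thesis unfolding M'_def .
qed

end

section \<open>Frostman measures\<close>

lemma frostman_measureD:
  assumes "frostman_measure \<mu> E"
  shows "prob_space \<mu>" "sets \<mu> = sets borel" "AE x in \<mu>. x \<in> E"
  using assms by (auto simp: frostman_measure_def compactly_supported_on_def)

lemma frostman_bounded:
  assumes "frostman_measure \<mu> E"
  obtains D where "0 < D" "AE x in \<mu>. norm x \<le> D"
proof -
  obtain K where K: "compact K" "AE x in \<mu>. x \<in> K"
    using assms by (auto simp: frostman_measure_def compactly_supported_on_def)
  obtain D where "0 < D" "\<forall>x\<in>K. norm x \<le> D"
    using compact_imp_bounded[OF K(1)] by (auto simp: bounded_pos)
  with K(2) show thesis by (intro that[of D]) auto
qed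

lemma frostman_cball:
  fixes \<mu> :: "'a::euclidean_space measure"
  assumes fr: "frostman_measure \<mu> E" and \<kappa>: "\<kappa> < hausdorff_dim E" "0 \<le> \<kappa>"
  shows "\<exists>C\<ge>0. \<forall>x r. 0 < r \<longrightarrow> measure \<mu> (cball x r) \<le> C * r powr \<kappa>"
proof -
  interpret prob_space \<mu> using fr by (rule frostman_measureD)
  have [measurable_cong]: "sets \<mu> = sets borel" using fr by (rule frostman_measureD)
  obtain C where "\<forall>\<^sub>F r in at_right 0. \<forall>x. measure \<mu> (ball x r) \<le> C * r powr (hausdorff_dim E - (hausdorff_dim E - \<kappa>))"
    using fr \<kappa>(1) unfolding frostman_measure_def by (meson diff_gt_0_iff_gt)
  then obtain r0 where r0: "0 < r0" "\<And>r x. 0 < r \<Longrightarrow> r < r0 \<Longrightarrow> measure \<mu> (ball x r) \<le> C * r powr \<kappa>"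
    by (auto simp: eventually_at_right_field)
  \<comment> \<open>The first summand serves 2 * r < r0, where the closed ball sits in the open ball
    of radius 2 * r. The second makes the bound at least 1, the total mass, for all larger
    r.\<close>
  define C' where "C' = \<bar>C\<bar> * 2 powr \<kappa> + (2 / r0) powr \<kappa>"
  show ?thesis
  proof (intro exI[of _ C'] conjI allI impI)
    show "0 \<le> C'" by (simp add: C'_def)
    fix x :: 'a and r :: real assume r: "0 < r"
    show "measure \<mu> (cball x r) \<le> C' * r powr \<kappa>"
    proof (cases "2 * r < r0")
      case True
      have "measure \<mu> (cball x r) \<le> measure \<mu> (ball x (2 * r))"
        using r by (intro finite_measure_mono) auto
      also have "\<dots> \<le> C * (2 * r) powr \<kappa>" using r0(2)[of "2 * r"] r True by auto
      also have "\<dots> \<le> \<bar>C\<bar> * (2 powr \<kappa> * r powr \<kappa>)"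
        using r by (simp add: powr_mult mult_right_mono)
      also have "\<dots> \<le> C' * r powr \<kappa>" by (simp add: C'_def ring_distribs)
      finally show ?thesis .
    next
      case False
      have "measure \<mu> (cball x r) \<le> 1" by (rule prob_le_1)
      also have "\<dots> \<le> (2 / r0 * r) powr \<kappa>"
        using False r r0(1) \<kappa>(2) by (intro ge_one_powr_ge_zero) (auto simp: field_simps)
      also have "\<dots> = (2 / r0) powr \<kappa> * r powr \<kappa>" using powr_mult[of "2 / r0" r \<kappa>] r r0(1) by simp
      also have "\<dots> \<le> C' * r powr \<kappa>" by (simp add: C'_def ring_distribs)
      finally show ?thesis .
    qed
  qed
qed

text \<open>Double counting of the pairs (x, y) with |x - y| <= r under mu times Lebesgue measure:
  integrating over y first gives a multiple of r^n, integrating over x first at most a multiple of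
  r^\<kappa>. For \<kappa> > n this fails as r tends to 0. The bound later keeps the lowered
  exponents in part (3) positive.\<close>

lemma frostman_dim_le:
  fixes \<mu> :: "'a::euclidean_space measure"
  assumes fr: "frostman_measure \<mu> E"
  shows "hausdorff_dim E \<le> DIM('a)"
proof (rule ccontr)
  assume "\<not> ?thesis"
  then obtain \<kappa> :: real where \<kappa>: "real DIM('a) < \<kappa>" "\<kappa> < hausdorff_dim E" using dense[of "real DIM('a)" "hausdorff_dim E"] by auto
  interpret prob_space \<mu> using fr by (rule frostman_measureD)
  have [measurable_cong]: "sets \<mu> = sets borel" using fr by (rule frostman_measureD)
  obtain C where C: "0 \<le> C" "\<And>x r. 0 < r \<Longrightarrow> measure \<mu> (cball x r) \<le> C * r powr \<kappa>"
    using frostman_cball[OF fr \<kappa>(2)] \<kappa>(1) by auto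
  obtain D where D: "0 < D" "AE x in \<mu>. norm x \<le> D" using frostman_bounded[OF fr] .
  interpret P: pair_sigma_finite \<mu> lborel ..
  define n where "n = DIM('a)"
  define v where "v = unit_ball_vol (real n)"
  have v: "0 < v" by (simp add: v_def)
  have key: "r powr (real n) \<le> C * (D + 1) ^ n * r powr \<kappa>" if r: "0 < r" "r \<le> 1" for r
  proof -
    define A where "A = {p :: 'a \<times> 'a. dist (fst p) (snd p) \<le> r} \<inter> {p. norm (snd p) \<le> D + 1}"
    have "closed A" unfolding A_def by (intro closed_Int closed_Collect_le continuous_intros)
    then have "A \<in> sets (borel \<Otimes>\<^sub>M borel)"
      unfolding borel_prod by (rule borel_closed)
    then have A: "A \<in> sets (\<mu> \<Otimes>\<^sub>M lborel)"
      by (subst sets_pair_measure_cong[OF \<open>sets \<mu> = sets borel\<close> sets_lborel])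
    have "ennreal (v * r ^ n) = (\<integral>\<^sup>+x. ennreal (v * r ^ n) \<partial>\<mu>)"
      by (simp add: emeasure_space_1)
    also have "\<dots> \<le> (\<integral>\<^sup>+x. (\<integral>\<^sup>+y. indicator A (x, y) \<partial>lborel) \<partial>\<mu>)"
    proof (rule nn_integral_mono_AE, use D(2) in eventually_elim)
      fix x :: 'a assume x: "norm x \<le> D"
      have sub: "cball x r \<subseteq> cball 0 (D + 1)"
      proof
        fix y assume "y \<in> cball x r"
        then have "norm (x - y) \<le> r" by (simp add: dist_norm)
        then show "y \<in> cball 0 (D + 1)" using x r norm_triangle_ineq4[of x "x - y"] by simp
      qed
      have "ennreal (v * r ^ n) = emeasure lborel (cball x r)"
        using r by (simp add: emeasure_cball v_def n_def)
      also have "\<dots> = (\<integral>\<^sup>+y. indicator (cball x r) y \<partial>lborel)" by simp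
      also have "\<dots> \<le> (\<integral>\<^sup>+y. indicator A (x, y) \<partial>lborel)"
        using sub by (intro nn_integral_mono) (auto simp: A_def split: split_indicator)
      finally show "ennreal (v * r ^ n) \<le> \<dots>" .
    qed
    also have "\<dots> = (\<integral>\<^sup>+y. (\<integral>\<^sup>+x. indicator A (x, y) \<partial>\<mu>) \<partial>lborel)"
      by (rule P.Fubini'[symmetric]) (use A in simp)
    also have "\<dots> \<le> (\<integral>\<^sup>+y. ennreal (C * r powr \<kappa>) * indicator (cball (0::'a) (D + 1)) y \<partial>lborel)"
    proof (rule nn_integral_mono)
      fix y :: 'a
      have "(\<integral>\<^sup>+x. indicator A (x, y) \<partial>\<mu>)
         = (\<integral>\<^sup>+x. indicator (cball 0 (D + 1)) y * indicator (cball y r) x \<partial>\<mu>)"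
        by (intro nn_integral_cong) (auto simp: A_def dist_commute split: split_indicator)
      also have "\<dots> = indicator (cball 0 (D + 1)) y * emeasure \<mu> (cball y r)"
        by (rule nn_integral_cmult_indicator) (simp add: \<open>sets \<mu> = sets borel\<close>)
      also have "\<dots> \<le> ennreal (C * r powr \<kappa>) * indicator (cball 0 (D + 1)) y"
        using C(2)[OF r(1), of y]
        by (auto simp: emeasure_eq_measure split: split_indicator intro: ennreal_leI)
      finally show "(\<integral>\<^sup>+x. indicator A (x, y) \<partial>\<mu>) \<le> \<dots>" .
    qed
    also have "\<dots> = ennreal (C * r powr \<kappa> * (v * (D + 1) ^ n))"
      using C(1) D(1) v
      by (subst nn_integral_cmult_indicator) (auto simp: emeasure_cball v_def n_def ennreal_mult)
    finally have "v * r ^ n \<le> C * r powr \<kappa> * (v * (D + 1) ^ n)"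
      using C(1) D(1) v by (subst (asm) ennreal_le_iff) auto
    then have "v * r ^ n \<le> v * (C * (D + 1) ^ n * r powr \<kappa>)" by (simp add: mult_ac)
    then show ?thesis using v r by (simp add: powr_realpow)
  qed
  define B where "B = C * (D + 1) ^ n"
  have B: "0 \<le> B" using C D by (simp add: B_def)
  \<comment> \<open>Chosen so that r powr (\<kappa> - n) = 1 / (B + 1), which turns
    \<open>key\<close> into r^n <= B / (B + 1) * r^n.\<close>
  define r where "r = (B + 1) powr (- 1 / (\<kappa> - n))"
  have r0: "0 < r" using B by (simp add: r_def)
  have "1 \<le> (B + 1) powr (1 / (\<kappa> - n))"
    using B \<kappa>(1) by (intro ge_one_powr_ge_zero) (auto simp: n_def)
  then have r1: "r \<le> 1"
    unfolding r_def minus_divide_left[symmetric] powr_minus_divide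
    using B by (auto simp: divide_le_eq_1)
  have "- 1 / (\<kappa> - n) * (\<kappa> - n) = - 1" using \<kappa>(1) by (simp add: n_def)
  then have "r powr (\<kappa> - n) = (B + 1) powr - 1"
    unfolding r_def powr_powr by simp
  then have *: "r powr (\<kappa> - n) = 1 / (B + 1)"
    using B by (simp add: powr_minus_divide)
  have "r powr \<kappa> = r powr (\<kappa> - n) * r powr n" by (simp flip: powr_add)
  then have "r powr \<kappa> = r powr n / (B + 1)" using * by simp
  with key[OF r0 r1] have "r powr n \<le> B * (r powr n / (B + 1))" by (simp add: B_def)
  also have "\<dots> < r powr n" using B r0 by (simp add: field_simps)
  finally show False by simp
qed

section \<open>Hausdorff dimension and correlation bounds\<close>

text \<open>Shows that the set whose infimum is the dimension is nonempty, so that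
  \<open>cInf_greatest\<close> applies. Consecutive intervals of lengths c / (m + 1) exhaust a
  half-line because the harmonic series diverges, while their squared lengths sum to O(c^2).\<close>

lemma hausdorff_measure_2_real: "hausdorff_measure 2 (E :: real set) = 0"
proof -
  have "hausdorff_content 2 \<delta> E = 0" if \<delta>: "0 < \<delta>" for \<delta>
  proof -
    \<comment> \<open>The factor 4 pays for interleaving the two half-lines: the i-th interval has
      length c / (i div 2 + 1) <= 2 * c / (i + 1).\<close>
    define K where "K = (\<Sum>n. 4 / (real n + 1)\<^sup>2)"
    have sK: "summable (\<lambda>n. 4 / (real n + 1)\<^sup>2)"
    proof -
      have "summable (\<lambda>n. inverse (real (Suc n) ^ 2))"
        using inverse_power_summable[of 2] by (subst summable_Suc_iff) simp
      from summable_mult[OF this, of 4] show ?thesis by (simp add: field_simps)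
    qed
    have K0: "0 \<le> K" unfolding K_def by (intro suminf_nonneg sK) auto
    have le: "hausdorff_content 2 \<delta> E \<le> ennreal (c\<^sup>2 * K)" if c: "0 < c" "c \<le> \<delta>" for c
    proof -
      define I where "I m = {c * harm m .. c * harm (Suc m)}" for m
      define U where "U n = (if even n then I (n div 2) else uminus ` I (n div 2))" for n
      have step: "c * harm (Suc m) - c * harm m = c / (real m + 1)" for m
        by (simp add: harm_Suc field_simps)
      have diamI: "diameter (I m) = c / (real m + 1)" for m
        unfolding I_def using step[of m] c by (subst diameter_closed_interval) (auto simp: harm_Suc)
      have diam: "diameter (U n) = c / (real (n div 2) + 1)" for n
      proof (cases "even n")
        case False
        have "uminus ` I m = {- (c * harm (Suc m)) .. - (c * harm m)}" for m
          unfolding I_def by (rule image_uminus_atLeastAtMost)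
        then show ?thesis using False step[of "n div 2"] c
          by (auto simp: U_def harm_Suc diameter_closed_interval)
      qed (simp add: U_def diamI)
      have bnd: "bounded (U n)" for n
        unfolding U_def I_def by (auto simp: image_uminus_atLeastAtMost)
      have cov: "\<exists>m. \<bar>x\<bar> \<in> I m" for x :: real
      proof -
        have ex: "\<exists>m. \<bar>x\<bar> < c * harm m"
        proof -
          define m where "m = nat \<lceil>exp (\<bar>x\<bar> / c)\<rceil>"
          have "\<bar>x\<bar> / c = ln (exp (\<bar>x\<bar> / c))" by simp
          also have "exp (\<bar>x\<bar> / c) < real m + 1" unfolding m_def by linarith
          then have "ln (exp (\<bar>x\<bar> / c)) < ln (real m + 1)" by (subst ln_less_cancel_iff) auto
          also have "\<dots> \<le> harm m" using ln_le_harm[of m] by (simp add: add.commute)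
          finally show ?thesis using c by (auto simp: field_simps)
        qed
        define k where "k = (LEAST m. \<bar>x\<bar> < c * harm m)"
        have k: "\<bar>x\<bar> < c * harm k" unfolding k_def using ex by (rule LeastI_ex)
        have "k \<noteq> 0" using k by (auto simp: harm_def intro: ccontr)
        then obtain j where j: "k = Suc j" using not0_implies_Suc by blast
        have "\<not> \<bar>x\<bar> < c * harm j" using not_less_Least[of j "\<lambda>m. \<bar>x\<bar> < c * harm m"] j k_def by simp
        with k j show ?thesis by (intro exI[of _ j]) (auto simp: I_def)
      qed
      have covU: "E \<subseteq> (\<Union>i. U i)"
      proof
        fix x :: real
        obtain m where m: "\<bar>x\<bar> \<in> I m" using cov by blast
        show "x \<in> (\<Union>i. U i)"
        proof (cases "0 \<le> x")
          case True
          then have "x \<in> U (2 * m)" using m by (simp add: U_def)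
          then show ?thesis by blast
        next
          case False
          then have "x \<in> U (2 * m + 1)" using m by (auto simp: U_def intro!: image_eqI[of _ _ "-x"])
          then show ?thesis by blast
        qed
      qed
      have "hausdorff_content 2 \<delta> E \<le> (\<Sum>i. hausdorff_gauge 2 (U i))"
        unfolding hausdorff_content_def
      proof (rule INF_lower, safe)
        fix i
        have "c / (real (i div 2) + 1) \<le> c / 1" using c by (intro divide_left_mono) auto
        then show "diameter (U i) \<le> \<delta>" using c by (simp add: diam)
      qed (use covU bnd in auto)
      also have "\<dots> \<le> (\<Sum>i. ennreal (c\<^sup>2 * (4 / (real i + 1)\<^sup>2)))"
      proof (rule suminf_le)
        fix i
        have "c / (real (i div 2) + 1) \<le> c * (2 / (real i + 1))"
        proof -
          have "i \<le> 2 * (i div 2) + 1" by presburger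
          then have "real i \<le> 2 * real (i div 2) + 1"
            by linarith
          then have "1 / (real (i div 2) + 1) \<le> 2 / (real i + 1)"
            by (simp add: divide_simps)
          then show ?thesis using mult_left_mono[of _ _ c] c by fastforce
        qed
        then have "(c / (real (i div 2) + 1)) powr 2 \<le> (c * (2 / (real i + 1))) powr 2"
          using c by (intro powr_mono2) auto
        also have "\<dots> = c\<^sup>2 * (4 / (real i + 1)\<^sup>2)"
          using c by (simp add: power_mult_distrib power_divide)
        finally show "hausdorff_gauge 2 (U i) \<le> ennreal (c\<^sup>2 * (4 / (real i + 1)\<^sup>2))"
          by (auto simp: hausdorff_gauge_def diam intro: ennreal_leI)
      qed auto
      also have "\<dots> = ennreal (c\<^sup>2 * K)"
        unfolding K_def suminf_mult[OF sK, symmetric]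
        by (rule suminf_ennreal2) (use summable_mult[OF sK] in auto)
      finally show ?thesis .
    qed
    have "hausdorff_content 2 \<delta> E \<le> ennreal e" if e: "0 < e" for e
    proof -
      define c where "c = min \<delta> (sqrt (e / (K + 1)))"
      have c: "0 < c" "c \<le> \<delta>" using \<delta> e K0 by (auto simp: c_def)
      have "c\<^sup>2 \<le> (sqrt (e / (K + 1)))\<^sup>2" using c by (intro power_mono) (auto simp: c_def)
      also have "\<dots> = e / (K + 1)" using e K0 by simp
      finally have "c\<^sup>2 * K \<le> e / (K + 1) * K" using K0 by (intro mult_right_mono)
      also have "\<dots> \<le> e" using e K0 by (simp add: field_simps)
      finally show ?thesis using le[OF c] by (meson ennreal_leI order_trans)
    qed
    then have "hausdorff_content 2 \<delta> E \<le> 0"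
      by (metis add_0 ennreal_le_epsilon)
    then show ?thesis by simp
  qed
  then show ?thesis by (auto simp: hausdorff_measure_def)
qed

text \<open>The ball condition \<open>\<nu> (cball u h) \<le> C * h powr s\<close> averaged over u
  with respect to \<open>\<nu>\<close>; only this averaged form can be read off from an L^2 bound on
  the Fourier side.\<close>

definition correlation_bound :: "real measure \<Rightarrow> real \<Rightarrow> real \<Rightarrow> bool" where
  "correlation_bound \<nu> C s \<longleftrightarrow>
     (\<forall>h. 0 < h \<and> h \<le> 1 \<longrightarrow> emeasure (\<nu> \<Otimes>\<^sub>M \<nu>) {p. \<bar>fst p - snd p\<bar> \<le> h} \<le> ennreal (C * h powr s))"

lemma closed_near_diagonal: "closed {p :: real \<times> real. \<bar>fst p - snd p\<bar> \<le> h}"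
  by (intro closed_Collect_le continuous_intros)

lemma sets_near_diagonal:
  assumes "sets \<nu> = sets borel"
  shows "{p :: real \<times> real. \<bar>fst p - snd p\<bar> \<le> h} \<in> sets (\<nu> \<Otimes>\<^sub>M \<nu>)"
  unfolding sets_pair_measure_cong[OF assms assms] borel_prod
  by (intro borel_closed closed_near_diagonal)

lemma correlation_bound_mono:
  assumes "correlation_bound \<nu> C s" "C \<le> C'"
  shows "correlation_bound \<nu> C' s"
  using assms unfolding correlation_bound_def
  by (meson ennreal_leI mult_right_mono order_trans powr_ge_zero)

lemma emeasure_near_diagonal:
  assumes "prob_space \<nu>" and bo: "sets \<nu> = sets borel"
  shows "emeasure (\<nu> \<Otimes>\<^sub>M \<nu>) {p. \<bar>fst p - snd p\<bar> \<le> h} = (\<integral>\<^sup>+u. emeasure \<nu> (cball u h) \<partial>\<nu>)"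
    and "(\<lambda>u. emeasure \<nu> (cball u h)) \<in> borel_measurable \<nu>"
proof -
  interpret prob_space \<nu> by fact
  have eq: "Pair u -` {p. \<bar>fst p - snd p\<bar> \<le> h} = cball u h" for u
    by (auto simp: dist_real_def)
  show "emeasure (\<nu> \<Otimes>\<^sub>M \<nu>) {p. \<bar>fst p - snd p\<bar> \<le> h} = (\<integral>\<^sup>+u. emeasure \<nu> (cball u h) \<partial>\<nu>)"
    by (subst emeasure_pair_measure_alt[OF sets_near_diagonal[OF bo]]) (simp only: eq)
  show "(\<lambda>u. emeasure \<nu> (cball u h)) \<in> borel_measurable \<nu>"
    using measurable_emeasure_Pair[OF sets_near_diagonal[OF bo, of h]] by (simp only: eq)
qed

text \<open>Chebyshev's inequality at the dyadic scales turns the average bound into a pointwise one.\<close>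

lemma correlation_bound_imp_ball_bound:
  assumes ps: "prob_space \<nu>" and bo: "sets \<nu> = sets borel"
    and corr: "correlation_bound \<nu> C \<sigma>" and s: "0 < s" "s < \<sigma>"
  obtains G r0 where "G \<in> sets \<nu>" "1 / 2 \<le> measure \<nu> G" "0 < r0" "r0 \<le> 1"
    "\<And>u r. u \<in> G \<Longrightarrow> 0 \<le> r \<Longrightarrow> r \<le> r0 \<Longrightarrow> measure \<nu> (cball u r) \<le> (2 * r) powr s"
proof -
  interpret prob_space \<nu> by fact
  have [measurable_cong]: "sets \<nu> = sets borel" by fact
  have meas [measurable]: "(\<lambda>u. emeasure \<nu> (cball u h)) \<in> borel_measurable \<nu>" for h
    by (rule emeasure_near_diagonal) fact+
  define a where "a k = (1 / 2 :: real) ^ k" for k :: nat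
  have a: "0 < a k" "a k \<le> 1" for k by (auto simp: a_def power_le_one)
  have aSuc: "a k = 2 * a (Suc k)" for k by (simp add: a_def)
  \<comment> \<open>The points at which scale k is bad. Their mass is at most a multiple of a k powr
    (\<sigma> - s), which is geometric in k, so discarding the bad points of all scales from some k0
    on costs at most half of the mass.\<close>
  define B where "B k = {u \<in> space \<nu>. ennreal (a k powr s) \<le> emeasure \<nu> (cball u (a k))}" for k
  have [measurable]: "B k \<in> sets \<nu>" for k unfolding B_def by measurable
  define q where "q = (1 / 2 :: real) powr (\<sigma> - s)"
  have q: "0 < q" "q < 1" using s powr_less_mono2[of "\<sigma> - s" "1/2" 1] by (auto simp: q_def)
  have B: "measure \<nu> (B k) \<le> \<bar>C\<bar> * q ^ k" for k
  proof -
    have "ennreal (a k powr s) * emeasure \<nu> (B k) = (\<integral>\<^sup>+u. ennreal (a k powr s) * indicator (B k) u \<partial>\<nu>)"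
      by (simp add: nn_integral_cmult)
    also have "\<dots> \<le> (\<integral>\<^sup>+u. emeasure \<nu> (cball u (a k)) \<partial>\<nu>)"
      by (intro nn_integral_mono) (auto simp: B_def split: split_indicator)
    also have "\<dots> \<le> ennreal (C * a k powr \<sigma>)"
      using corr a[of k] unfolding correlation_bound_def emeasure_near_diagonal(1)[OF ps bo] by auto
    also have "\<dots> \<le> ennreal (\<bar>C\<bar> * a k powr \<sigma>)"
      by (intro ennreal_leI mult_right_mono) auto
    finally have "ennreal (a k powr s * measure \<nu> (B k)) \<le> ennreal (\<bar>C\<bar> * a k powr \<sigma>)"
      by (simp add: emeasure_eq_measure ennreal_mult')
    then have "a k powr s * measure \<nu> (B k) \<le> \<bar>C\<bar> * a k powr \<sigma>"
      by (simp add: ennreal_le_iff)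
    then have "measure \<nu> (B k) \<le> \<bar>C\<bar> * (a k powr \<sigma> / a k powr s)"
      using a[of k] by (simp add: field_simps)
    also have "a k powr \<sigma> / a k powr s = a k powr (\<sigma> - s)" by (simp add: powr_diff)
    also have "\<dots> = q ^ k"
      by (simp add: a_def q_def powr_power powr_realpow[symmetric] powr_powr mult.commute)
    finally show ?thesis .
  qed
  have "(\<lambda>n. \<bar>C\<bar> * q ^ n * (1 / (1 - q))) \<longlonglongrightarrow> \<bar>C\<bar> * 0 * (1 / (1 - q))"
    using q by (intro tendsto_intros LIMSEQ_power_zero) auto
  then have "eventually (\<lambda>n. \<bar>C\<bar> * q ^ n * (1 / (1 - q)) < 1 / 2) sequentially"
    by (rule order_tendstoD) simp
  then obtain k0 where k0: "\<bar>C\<bar> * q ^ k0 * (1 / (1 - q)) < 1 / 2"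
    by (auto simp: eventually_sequentially)
  have sg: "(\<lambda>k. \<bar>C\<bar> * q ^ (k + k0)) sums (\<bar>C\<bar> * q ^ k0 * (1 / (1 - q)))"
    using sums_mult[OF geometric_sums[of q], of "\<bar>C\<bar> * q ^ k0"] q by (simp add: power_add mult_ac)
  define G where "G = space \<nu> - (\<Union>k. B (k + k0))"
  have [measurable]: "G \<in> sets \<nu>" by (simp add: G_def)
  have sumB: "summable (\<lambda>k. measure \<nu> (B (k + k0)))"
    by (rule summable_comparison_test'[OF sums_summable[OF sg], of 0]) (use B in auto)
  have "measure \<nu> (\<Union>k. B (k + k0)) \<le> (\<Sum>k. measure \<nu> (B (k + k0)))"
    by (rule finite_measure_subadditive_countably) (use sumB in auto)
  also have "\<dots> \<le> (\<Sum>k. \<bar>C\<bar> * q ^ (k + k0))"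
    by (rule suminf_le[OF B sumB sums_summable[OF sg]])
  also have "\<dots> = \<bar>C\<bar> * q ^ k0 * (1 / (1 - q))" using sg by (simp add: sums_iff)
  finally have "measure \<nu> (\<Union>k. B (k + k0)) \<le> 1 / 2" using k0 by linarith
  then have "1 / 2 \<le> measure \<nu> G"
    unfolding G_def by (subst prob_compl) auto
  moreover have "measure \<nu> (cball u r) \<le> (2 * r) powr s" if u: "u \<in> G" and r: "0 \<le> r" "r \<le> a k0" for u r
  proof -
    have dy: "measure \<nu> (cball u (a k)) < a k powr s" if "k0 \<le> k" for k
    proof -
      have "u \<notin> B (k - k0 + k0)" "u \<in> space \<nu>" using u by (auto simp: G_def)
      then have "emeasure \<nu> (cball u (a k)) < ennreal (a k powr s)" using that by (auto simp: B_def)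
      then show ?thesis by (simp add: emeasure_eq_measure ennreal_less_iff)
    qed
    have pos: "measure \<nu> (cball u \<rho>) \<le> (2 * \<rho>) powr s" if \<rho>: "0 < \<rho>" "\<rho> \<le> a k0" for \<rho>
    proof -
      have "\<exists>n. a n < \<rho>" using real_arch_pow_inv[of \<rho> "1 / 2"] \<rho> by (auto simp: a_def)
      then obtain n where n: "a n < \<rho>" "\<And>m. m < n \<Longrightarrow> \<not> a m < \<rho>"
        using exists_least_iff[of "\<lambda>n. a n < \<rho>"] by blast
      have "k0 < n"
      proof (rule ccontr)
        assume "\<not> k0 < n"
        then have "a k0 \<le> a n" by (auto simp: a_def intro: power_decreasing)
        then show False using n \<rho> by linarith
      qed
      then obtain k where k: "n = Suc k" "k0 \<le> k" by (cases n) auto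
      have "\<rho> \<le> a k" using n(2)[of k] k by simp
      then have "measure \<nu> (cball u \<rho>) \<le> measure \<nu> (cball u (a k))"
        by (intro finite_measure_mono) auto
      also have "\<dots> \<le> a k powr s" using dy[OF k(2)] by simp
      also have "\<dots> \<le> (2 * \<rho>) powr s"
        using n(1) k aSuc[of k] a[of k] s by (intro powr_mono2) auto
      finally show ?thesis .
    qed
    \<comment> \<open>Radius 0 arises from covering sets of diameter 0. Since 0 powr s = 0, the
      claim then says that u is not an atom, which follows by letting the dyadic radii
      shrink.\<close>
    show ?thesis
    proof (cases "r = 0")
      case True
      have "measure \<nu> (cball u 0) \<le> 0"
      proof (rule LIMSEQ_le_const)
        have "(\<lambda>k. ((1 / 2) powr s) ^ k) \<longlonglongrightarrow> 0"
          using powr_less_mono2[of s "1/2" 1] s by (intro LIMSEQ_power_zero) auto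
        then show "(\<lambda>k. a k powr s) \<longlonglongrightarrow> 0"
          by (simp add: a_def powr_power powr_realpow[symmetric] powr_powr mult.commute)
        show "\<exists>N. \<forall>k\<ge>N. measure \<nu> (cball u 0) \<le> a k powr s"
        proof (intro exI[of _ k0] allI impI)
          fix k assume "k0 \<le> k"
          have "measure \<nu> (cball u 0) \<le> measure \<nu> (cball u (a k))"
            using a[of k] by (intro finite_measure_mono subset_cball) auto
          also have "\<dots> \<le> a k powr s" using dy[OF \<open>k0 \<le> k\<close>] by simp
          finally show "measure \<nu> (cball u 0) \<le> a k powr s" .
        qed
      qed
      then show ?thesis using True by simp
    qed (use pos r in auto)
  qed
  ultimately show thesis using a[of k0] by (intro that[of G "a k0"]) auto
qed

text \<open>Mass distribution principle on the good set \<open>G\<close>: a cover of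
  \<open>E\<close> covers almost all of \<open>G\<close>, so its gauge sum is bounded below by a
  multiple of the mass of \<open>G\<close>.\<close>

lemma hausdorff_dim_ge:
  assumes ps: "prob_space \<nu>" and bo: "sets \<nu> = sets borel" and E: "AE u in \<nu>. u \<in> E"
    and corr: "correlation_bound \<nu> C \<sigma>"
  shows "\<sigma> \<le> hausdorff_dim E"
  unfolding hausdorff_dim_def
proof (rule cInf_greatest)
  show "{s. 0 \<le> s \<and> hausdorff_measure s E = 0} \<noteq> {}"
    using hausdorff_measure_2_real[of E] by (auto intro: exI[of _ 2])
  fix t assume "t \<in> {s. 0 \<le> s \<and> hausdorff_measure s E = 0}"
  then have t: "0 \<le> t" "hausdorff_measure t E = 0" by auto
  show "\<sigma> \<le> t"
  proof (rule ccontr)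
    assume "\<not> \<sigma> \<le> t"
    \<comment> \<open>An exponent strictly below \<sigma> leaves room for the Chebyshev loss, and t
      \<le> s is what the comparison with the gauge needs.\<close>
    define s where "s = (t + \<sigma>) / 2"
    have s: "0 < s" "s < \<sigma>" "t \<le> s" using \<open>\<not> \<sigma> \<le> t\<close> t(1) by (auto simp: s_def)
    interpret prob_space \<nu> by fact
    have [measurable_cong]: "sets \<nu> = sets borel" by fact
    obtain G r0 where G: "G \<in> sets \<nu>" "1 / 2 \<le> measure \<nu> G" and r0: "0 < r0" "r0 \<le> 1"
      and ball: "\<And>u r. u \<in> G \<Longrightarrow> 0 \<le> r \<Longrightarrow> r \<le> r0 \<Longrightarrow> measure \<nu> (cball u r) \<le> (2 * r) powr s"
      using correlation_bound_imp_ball_bound[OF ps bo corr s(1,2)] by metis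
    have "ennreal (1 / (2 * 2 powr s)) \<le> hausdorff_content t r0 E"
      unfolding hausdorff_content_def
    proof (rule INF_greatest)
      fix U assume "U \<in> {U :: nat \<Rightarrow> real set. E \<subseteq> (\<Union>i. U i) \<and> (\<forall>i. bounded (U i) \<and> diameter (U i) \<le> r0)}"
      then have U: "E \<subseteq> (\<Union>i. U i)" "\<And>i. bounded (U i)" "\<And>i. diameter (U i) \<le> r0" by auto
      \<comment> \<open>Covering sets are arbitrary, so each one meeting \<open>G\<close> is
        replaced by a closed ball, which is measurable; its centre is taken in \<open>G\<close>
        because the ball bound holds only there.\<close>
      define V where "V i = (if U i \<inter> G = {} then {} else cball (SOME u. u \<in> U i \<inter> G) (diameter (U i)))" for i
      have UV: "U i \<inter> G \<subseteq> V i" for i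
      proof
        fix w assume w: "w \<in> U i \<inter> G"
        then have "(SOME u. u \<in> U i \<inter> G) \<in> U i \<inter> G" by (rule someI)
        then show "w \<in> V i"
          using w diameter_bounded_bound[OF U(2)[of i]] by (auto simp: V_def)
      qed
      have [measurable]: "V i \<in> sets \<nu>" for i by (auto simp: V_def bo)
      have Vi: "emeasure \<nu> (V i) \<le> ennreal (2 powr s) * hausdorff_gauge t (U i)" for i
      proof (cases "U i \<inter> G = {}")
        case False
        then have "(SOME u. u \<in> U i \<inter> G) \<in> U i \<inter> G" by (metis ex_in_conv someI_ex)
        then have "measure \<nu> (V i) \<le> (2 * diameter (U i)) powr s"
          using False U(2,3)[of i] by (simp add: V_def ball diameter_ge_0)
        also have "\<dots> = 2 powr s * diameter (U i) powr s"
          using U(2)[of i] by (simp add: powr_mult diameter_ge_0)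
        finally have 1: "emeasure \<nu> (V i) \<le> ennreal (2 powr s) * ennreal (diameter (U i) powr s)"
          by (simp add: emeasure_eq_measure ennreal_mult'[symmetric] ennreal_leI)
        have d: "0 \<le> diameter (U i)" "diameter (U i) \<le> 1"
          using U(2,3)[of i] r0 by (auto simp: diameter_ge_0)
        \<comment> \<open>Diameters are at most r0 <= 1, so lowering the exponent from s to t
          increases the power. For t = 0 the gauge is the constant 1, even at diameter 0.\<close>
        have "ennreal (diameter (U i) powr s) \<le> hausdorff_gauge t (U i)"
        proof (cases "t = 0")
          case True
          then show ?thesis using False d s by (auto simp: hausdorff_gauge_def powr_le1 intro!: ennreal_leI)
        next
          case t0: False
          then show ?thesis
            using False d s by (auto simp: hausdorff_gauge_def intro!: ennreal_leI powr_mono')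
        qed
        then show ?thesis using 1 by (meson mult_left_mono order_trans zero_le)
      qed (simp add: V_def)
      have "ennreal (1 / 2) \<le> emeasure \<nu> G" unfolding emeasure_eq_measure using G(2) by (rule ennreal_leI)
      also have "\<dots> \<le> emeasure \<nu> (\<Union>i. V i)"
      proof (rule emeasure_mono_AE)
        show "AE u in \<nu>. u \<in> G \<longrightarrow> u \<in> (\<Union>i. V i)"
          using E
        proof eventually_elim
          case (elim u)
          then obtain i where "u \<in> U i" using U(1) by blast
          then show ?case using UV[of i] by blast
        qed
      qed measurable
      also have "\<dots> \<le> (\<Sum>i. emeasure \<nu> (V i))"
        by (rule emeasure_subadditive_countably) auto
      also have "\<dots> \<le> (\<Sum>i. ennreal (2 powr s) * hausdorff_gauge t (U i))"
        by (rule suminf_le) (auto intro: Vi)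
      also have "\<dots> = ennreal (2 powr s) * (\<Sum>i. hausdorff_gauge t (U i))" by simp
      finally have "ennreal (1 / 2 powr s) * ennreal (1 / 2)
          \<le> ennreal (1 / 2 powr s) * (ennreal (2 powr s) * (\<Sum>i. hausdorff_gauge t (U i)))"
        by (rule mult_left_mono) simp
      also have "\<dots> = (\<Sum>i. hausdorff_gauge t (U i))"
        by (simp add: mult.assoc[symmetric] ennreal_mult'[symmetric])
      also have "ennreal (1 / 2 powr s) * ennreal (1 / 2) = ennreal (1 / (2 * 2 powr s))"
        by (subst ennreal_mult'[symmetric]) (simp_all add: mult.commute)
      finally show "ennreal (1 / (2 * 2 powr s)) \<le> (\<Sum>i. hausdorff_gauge t (U i))" .
    qed
    also have "\<dots> \<le> hausdorff_measure t E"
      unfolding hausdorff_measure_def using r0 by (intro SUP_upper) auto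
    finally show False using t(2) by (simp add: ennreal_eq_0_iff)
  qed
qed

text \<open>
  With \<open>b u = \<nu> (ball u (h/2))\<close> one has \<open>\<integral> b\<^sup>2 \<le> h * (\<nu> \<times> \<nu>) {\<bar>v - w\<bar> \<le> h} \<le> C h\<^sup>2\<close>, so
  \<open>b \<le> b\<^sup>2 / (4 C h) + C h\<close> bounds the integral of \<open>b\<close> over \<open>U\<close>, which dominates
  \<open>h * \<nu> V\<close> if the \<open>h\<close>-balls about \<open>V\<close> lie in \<open>U\<close>.
\<close>

lemma correlation_bound_open:
  assumes ps: "prob_space \<nu>" and bo: "sets \<nu> = sets borel"
    and corr: "correlation_bound \<nu> C 1" and C: "0 < C" and h: "0 < h" "h \<le> 1"
    and U: "open U" and V: "V \<in> sets \<nu>" "\<And>v. v \<in> V \<Longrightarrow> ball v h \<subseteq> U"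
  shows "emeasure \<nu> V \<le> ennreal (1 / 4) + ennreal C * emeasure lborel U"
proof -
  interpret prob_space \<nu> by fact
  have [measurable_cong]: "sets \<nu> = sets borel" by fact
  have [measurable]: "U \<in> sets borel" "V \<in> sets \<nu>" using U V by auto
  interpret P: pair_sigma_finite \<nu> lborel ..
  interpret PP: prob_space "\<nu> \<Otimes>\<^sub>M \<nu>" by (intro prob_space_pair prob_space_axioms)
  interpret Q: pair_sigma_finite "\<nu> \<Otimes>\<^sub>M \<nu>" lborel ..
  define A where "A = {p :: real \<times> real. \<bar>fst p - snd p\<bar> < h / 2}"
  have "open A" unfolding A_def by (intro open_Collect_less continuous_intros)
  then have "A \<in> sets (borel \<Otimes>\<^sub>M borel)" unfolding borel_prod by (rule borel_open)
  then have A [measurable]: "A \<in> sets (\<nu> \<Otimes>\<^sub>M lborel)"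
    by (subst sets_pair_measure_cong[OF bo sets_lborel])
  define b where "b u = emeasure \<nu> (ball u (h / 2))" for u
  have b_int: "b u = (\<integral>\<^sup>+v. indicator A (v, u) \<partial>\<nu>)" for u
  proof -
    have "(\<integral>\<^sup>+v. indicator A (v, u) \<partial>\<nu>) = (\<integral>\<^sup>+v. indicator (ball u (h / 2)) v \<partial>\<nu>)"
      by (intro nn_integral_cong) (auto simp: A_def dist_real_def abs_minus_commute split: split_indicator)
    then show ?thesis by (simp add: b_def bo)
  qed
  have [measurable]: "b \<in> borel_measurable lborel"
    unfolding b_int[abs_def] by measurable
  have ball_lborel: "emeasure lborel (ball v (h / 2)) = ennreal h" for v :: real
    using h by (simp add: ball_eq_greaterThanLessThan)
  have "ennreal h * emeasure \<nu> V = (\<integral>\<^sup>+v. ennreal h * indicator V v \<partial>\<nu>)"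
    by (simp add: nn_integral_cmult_indicator)
  also have "\<dots> \<le> (\<integral>\<^sup>+v. (\<integral>\<^sup>+u. indicator U u * indicator A (v, u) \<partial>lborel) \<partial>\<nu>)"
  proof (rule nn_integral_mono)
    fix v
    have "ennreal h * indicator V v = (\<integral>\<^sup>+u. indicator (ball v (h / 2)) u * indicator V v \<partial>lborel)"
      by (subst nn_integral_multc) (auto simp: ball_lborel intro!: borel_measurable_indicator)
    also have "\<dots> \<le> (\<integral>\<^sup>+u. indicator U u * indicator A (v, u) \<partial>lborel)"
      using V(2)[of v] h by (intro nn_integral_mono)
        (auto simp: A_def dist_real_def abs_minus_commute subset_eq split: split_indicator)
    finally show "ennreal h * indicator V v \<le> \<dots>" .
  qed
  also have "\<dots> = (\<integral>\<^sup>+u. (\<integral>\<^sup>+v. indicator U u * indicator A (v, u) \<partial>\<nu>) \<partial>lborel)"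
    by (rule P.Fubini'[symmetric]) measurable
  also have "\<dots> = (\<integral>\<^sup>+u. indicator U u * b u \<partial>lborel)"
    by (simp add: nn_integral_cmult b_int)
  also have "\<dots> \<le> (\<integral>\<^sup>+u. ennreal (1 / (4 * C * h)) * (b u * b u) + ennreal (C * h) * indicator U u \<partial>lborel)"
  proof (rule nn_integral_mono)
    fix u
    define x where "x = measure \<nu> (ball u (h / 2))"
    have b: "b u = ennreal x" by (simp add: b_def x_def emeasure_eq_measure)
    have "0 \<le> (x - 2 * C * h)\<^sup>2 / (4 * C * h)" using C h by simp
    also have "\<dots> = 1 / (4 * C * h) * (x * x) + C * h - x"
      using C h by (simp add: power2_eq_square field_simps)
    finally have "x \<le> 1 / (4 * C * h) * (x * x) + C * h" by simp
    then have "ennreal x \<le> ennreal (1 / (4 * C * h)) * (b u * b u) + ennreal (C * h)"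
      unfolding b using C h
      by (auto simp: ennreal_mult'[symmetric] ennreal_plus[symmetric] x_def simp del: ennreal_plus intro!: ennreal_leI)
    then show "indicator U u * b u \<le> ennreal (1 / (4 * C * h)) * (b u * b u) + ennreal (C * h) * indicator U u"
      by (auto simp: b split: split_indicator)
  qed
  also have "\<dots> = ennreal (1 / (4 * C * h)) * (\<integral>\<^sup>+u. b u * b u \<partial>lborel) + ennreal (C * h) * emeasure lborel U"
    by (simp add: nn_integral_add nn_integral_cmult)
  also have "(\<integral>\<^sup>+u. b u * b u \<partial>lborel)
      = (\<integral>\<^sup>+u. (\<integral>\<^sup>+v. (\<integral>\<^sup>+w. indicator A (v, u) * indicator A (w, u) \<partial>\<nu>) \<partial>\<nu>) \<partial>lborel)"
  proof (rule nn_integral_cong)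
    fix u :: real
    have 1: "(\<integral>\<^sup>+w. indicator A (v, u) * indicator A (w, u) \<partial>\<nu>) = indicator A (v, u) * b u" for v
      unfolding b_int by (rule nn_integral_cmult) measurable
    have 2: "(\<integral>\<^sup>+v. indicator A (v, u) * b u \<partial>\<nu>) = b u * b u"
      unfolding b_int[of u] by (rule nn_integral_multc) measurable
    show "b u * b u = (\<integral>\<^sup>+v. (\<integral>\<^sup>+w. indicator A (v, u) * indicator A (w, u) \<partial>\<nu>) \<partial>\<nu>)"
      unfolding 1 2 ..
  qed
  also have "\<dots> = (\<integral>\<^sup>+u. (\<integral>\<^sup>+p. indicator A (fst p, u) * indicator A (snd p, u) \<partial>(\<nu> \<Otimes>\<^sub>M \<nu>)) \<partial>lborel)"
    by (intro nn_integral_cong) (subst nn_integral_fst[symmetric], auto)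
  also have "\<dots> = (\<integral>\<^sup>+p. (\<integral>\<^sup>+u. indicator A (fst p, u) * indicator A (snd p, u) \<partial>lborel) \<partial>(\<nu> \<Otimes>\<^sub>M \<nu>))"
    by (rule Q.Fubini') measurable
  \<comment> \<open>A point u within h / 2 of both v and w exists only if |v - w| <= h, and all such
    u lie in an interval of length h.\<close>
  also have "\<dots> \<le> (\<integral>\<^sup>+p. ennreal h * indicator {p. \<bar>fst p - snd p\<bar> \<le> h} p \<partial>(\<nu> \<Otimes>\<^sub>M \<nu>))"
  proof (rule nn_integral_mono)
    fix p :: "real \<times> real"
    have "(\<integral>\<^sup>+u. indicator A (fst p, u) * indicator A (snd p, u) \<partial>lborel)
        \<le> (\<integral>\<^sup>+u. indicator (ball (fst p) (h / 2)) u * indicator {p. \<bar>fst p - snd p\<bar> \<le> h} p \<partial>lborel)"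
    proof (rule nn_integral_mono)
      fix u
      have "\<bar>fst p - u\<bar> < h / 2 \<Longrightarrow> \<bar>snd p - u\<bar> < h / 2 \<Longrightarrow> \<bar>fst p - snd p\<bar> \<le> h" by linarith
      then show "indicator A (fst p, u) * indicator A (snd p, u)
          \<le> indicator (ball (fst p) (h / 2)) u * (indicator {p. \<bar>fst p - snd p\<bar> \<le> h} p :: ennreal)"
        by (auto simp: A_def dist_real_def split: split_indicator)
    qed
    also have "\<dots> = ennreal h * indicator {p. \<bar>fst p - snd p\<bar> \<le> h} p"
      by (subst nn_integral_multc) (auto simp: ball_lborel intro!: borel_measurable_indicator)
    finally show "(\<integral>\<^sup>+u. indicator A (fst p, u) * indicator A (snd p, u) \<partial>lborel) \<le> \<dots>" .
  qed
  also have "\<dots> = ennreal h * emeasure (\<nu> \<Otimes>\<^sub>M \<nu>) {p. \<bar>fst p - snd p\<bar> \<le> h}"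
    by (rule nn_integral_cmult_indicator) (rule sets_near_diagonal[OF bo])
  also have "\<dots> \<le> ennreal h * ennreal (C * h)"
    using corr h by (intro mult_left_mono) (auto simp: correlation_bound_def)
  finally have "ennreal h * emeasure \<nu> V
      \<le> ennreal (1 / (4 * C * h)) * (ennreal h * ennreal (C * h)) + ennreal (C * h) * emeasure lborel U"
    by (meson add_right_mono mult_left_mono order_trans zero_le)
  also have "ennreal (1 / (4 * C * h)) * (ennreal h * ennreal (C * h)) = ennreal h * ennreal (1 / 4)"
    using C h by (simp add: ennreal_mult'[symmetric] del: ennreal_numeral)
  also have "ennreal (C * h) = ennreal h * ennreal C" using C h by (simp add: ennreal_mult' mult.commute)
  also have "ennreal h * ennreal (1 / 4) + ennreal h * ennreal C * emeasure lborel U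
      = ennreal h * (ennreal (1 / 4) + ennreal C * emeasure lborel U)"
    by (simp add: ring_distribs mult.assoc)
  finally show ?thesis using h by (subst (asm) ennreal_mult_le_mult_iff) auto
qed

text \<open>A null set \<open>E\<close> would lie in an open \<open>U\<close> of measure at most 1 /
  (4 * D). The sets \<open>V n\<close> of points with a ball of radius 1 / (n + 1) inside
  \<open>U\<close> increase to \<open>U\<close>, and each has mass at most 1/4 + D / (4 * D) = 1/2,
  although together they carry all of \<open>\<nu>\<close>.\<close>

lemma outer_measure_pos:
  assumes ps: "prob_space \<nu>" and bo: "sets \<nu> = sets borel" and E: "AE u in \<nu>. u \<in> E"
    and corr: "correlation_bound \<nu> C 1"
  shows "0 < outer_measure_of lborel E"
proof (rule ccontr)
  assume "\<not> ?thesis"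
  then have "outer_measure_of lborel E = 0" by (simp add: not_gr_zero)
  interpret prob_space \<nu> by fact
  define D where "D = max C 1"
  have D: "1 \<le> D" and corr': "correlation_bound \<nu> D 1"
    using corr by (auto simp: D_def intro: correlation_bound_mono)
  have "(INF B \<in> {B \<in> sets lborel. E \<subseteq> B}. emeasure lborel B) < ennreal (1 / (8 * D))"
    using \<open>outer_measure_of lborel E = 0\<close> D by (simp add: outer_measure_of_def)
  then obtain B where B: "B \<in> sets borel" "E \<subseteq> B" "emeasure lborel B < ennreal (1 / (8 * D))"
    by (auto simp: INF_less_iff)
  obtain U where U: "open U" "B \<subseteq> U" "emeasure lborel (U - B) < ennreal (1 / (8 * D))"
    using outer_regular_lborel[OF B(1), of "1 / (8 * D)"] D by auto
  have [measurable]: "U \<in> sets lborel" "B \<in> sets lborel" using U B by auto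
  have "emeasure lborel U \<le> emeasure lborel (B \<union> (U - B))"
    using U(1) B(1) by (intro emeasure_mono) auto
  also have "\<dots> \<le> emeasure lborel B + emeasure lborel (U - B)"
    using U(1) B(1) by (intro emeasure_subadditive) auto
  also have "\<dots> \<le> ennreal (1 / (8 * D)) + ennreal (1 / (8 * D))"
    using B(3) U(3) by (intro add_mono) auto
  also have "\<dots> = ennreal (1 / (4 * D))"
    using D by (subst ennreal_plus[symmetric]) (auto simp: field_simps)
  finally have LU: "emeasure lborel U \<le> ennreal (1 / (4 * D))" .
  define V where "V n = {v. ball v (1 / real (Suc n)) \<subseteq> U}" for n
  have V_eq: "V n = (\<Inter>w\<in>-U. {v. 1 / real (Suc n) \<le> dist v w})" for n
    by (force simp: V_def)
  have V [measurable]: "V n \<in> sets \<nu>" for n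
    unfolding V_eq bo by (intro borel_closed closed_INT ballI closed_Collect_le continuous_intros)
  have inc: "incseq V"
  proof (rule incseq_SucI)
    fix n
    have "1 / real (Suc (Suc n)) \<le> 1 / real (Suc n)" by (intro divide_left_mono) auto
    then show "V n \<le> V (Suc n)" unfolding V_def using subset_ball by blast
  qed
  have UV: "U \<subseteq> (\<Union>n. V n)"
  proof
    fix v assume "v \<in> U"
    then obtain e where e: "0 < e" "ball v e \<subseteq> U" using U(1) openE by blast
    then obtain n where "1 / real (Suc n) < e" using nat_approx_posE by metis
    then have "v \<in> V n" unfolding V_def using e(2) subset_ball[of "1 / real (Suc n)" e v] by auto
    then show "v \<in> (\<Union>n. V n)" by blast
  qed
  have Vn: "emeasure \<nu> (V n) \<le> ennreal (1 / 2)" for n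
  proof -
    have "emeasure \<nu> (V n) \<le> ennreal (1 / 4) + ennreal D * emeasure lborel U"
      by (rule correlation_bound_open[OF ps bo corr', where h="1 / real (Suc n)"])
         (use D U(1) V in \<open>auto simp: V_def\<close>)
    also have "\<dots> \<le> ennreal (1 / 4) + ennreal D * ennreal (1 / (4 * D))"
      by (intro add_left_mono mult_left_mono LU) auto
    also have "\<dots> = ennreal (1 / 2)"
      using D by (subst ennreal_mult'[symmetric], simp, subst ennreal_plus[symmetric]) auto
    finally show ?thesis .
  qed
  have "AE v in \<nu>. v \<in> (\<Union>n. V n)"
    using E by eventually_elim (use B(2) U(2) UV in blast)
  then have "1 = emeasure \<nu> (\<Union>n. V n)"
    by (subst emeasure_eq_1_AE) auto
  also have "\<dots> = (SUP n. emeasure \<nu> (V n))"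
    using V inc by (intro SUP_emeasure_incseq[symmetric]) auto
  also have "\<dots> \<le> ennreal (1 / 2)" by (intro SUP_least Vn)
  finally have "ennreal 1 \<le> ennreal (1 / 2)" by simp
  then show False by (subst (asm) ennreal_le_iff) auto
qed

section \<open>Projections of product measures\<close>

definition proj_measure :: "real measure \<Rightarrow> ('n::finite \<Rightarrow> real) \<Rightarrow> real measure" where
  "proj_measure \<mu> x = distr (Pi\<^sub>M UNIV (\<lambda>_. \<mu>)) borel (\<lambda>b. \<Sum>i\<in>UNIV. x i * b i)"

text \<open>The squared modulus of the characteristic function of
  \<open>proj_measure \<mu> x\<close> is written out as a product so that the coordinates decouple
  when x is averaged. The weight is the inhomogeneous form of the one for the Riesz s-energy; at s =
  1 it disappears and a plain L^2 norm remains.\<close>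

definition fourier_energy :: "real measure \<Rightarrow> real \<Rightarrow> ('n::finite \<Rightarrow> real) \<Rightarrow> ennreal" where
  "fourier_energy \<mu> s x =
     (\<integral>\<^sup>+t. ennreal ((\<Prod>i\<in>UNIV. (cmod (char \<mu> (t * x i)))\<^sup>2) * (1 + \<bar>t\<bar>) powr (s - 1)) \<partial>lborel)"

locale real_prob = prob_space \<mu> for \<mu> :: "real measure" +
  assumes sets_eq_borel [measurable_cong]: "sets \<mu> = sets borel"
begin

sublocale finite_borel_measure \<mu>
  by unfold_locales (rule sets_eq_borel)

sublocale prod: product_prob_space "\<lambda>_. \<mu>" UNIV ..

lemma measurable_proj [measurable]:
  "(\<lambda>b. \<Sum>i\<in>UNIV. x i * b i) \<in> borel_measurable (Pi\<^sub>M (UNIV :: 'n::finite set) (\<lambda>_. \<mu>))"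
  by measurable

lemma prob_space_proj: "prob_space (proj_measure \<mu> x)"
  unfolding proj_measure_def
  by (rule prob_space.prob_space_distr) (simp_all add: prob_space_PiM prob_space_axioms)

lemma sets_proj [simp]: "sets (proj_measure \<mu> x) = sets borel"
  by (simp add: proj_measure_def)

text \<open>
  The sumset need not be Borel, but it contains the compact sumsets of the compact subsets of \<open>A\<close>.
\<close>

lemma AE_proj:
  fixes x :: "'n::finite \<Rightarrow> real"
  assumes "AE y in \<mu>. y \<in> A"
  shows "AE u in proj_measure \<mu> x. u \<in> lin_sumset x A"
proof -
  let ?P = "Pi\<^sub>M (UNIV :: 'n set) (\<lambda>_. \<mu>)"
  interpret PR: prob_space "proj_measure \<mu> x" by (rule prob_space_proj)
  obtain N where N: "{y \<in> space \<mu>. y \<notin> A} \<subseteq> N" "N \<in> null_sets \<mu>"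
    using assms by (auto elim: AE_E3 simp: eventually_ae_filter)
  define B where "B = space \<mu> - N"
  have sp: "space \<mu> = UNIV" using sets_eq_imp_space_eq[OF sets_eq_borel] by simp
  have B: "B \<subseteq> A" "B \<in> sets borel" "emeasure \<mu> B = 1"
    using N by (auto simp: B_def sp sets_eq_borel[symmetric] emeasure_space_1[unfolded sp] emeasure_Diff_null_set null_setsD2)
  have "\<exists>K. compact K \<and> K \<subseteq> B \<and> ennreal r < emeasure \<mu> K" if "0 \<le> r" "r < 1" for r
  proof -
    have "emeasure \<mu> B = (SUP K\<in>{K. K \<subseteq> B \<and> compact K}. emeasure \<mu> K)"
      by (rule inner_regular) (use B(2) sets_eq_borel in auto)
    moreover have "ennreal r < ennreal 1" using that by (simp add: ennreal_less_iff)
    ultimately have "ennreal r < (SUP K\<in>{K. K \<subseteq> B \<and> compact K}. emeasure \<mu> K)"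
      using B(3) by simp
    then show ?thesis by (auto simp: less_SUP_iff)
  qed
  then obtain K where K: "\<And>r. 0 \<le> r \<Longrightarrow> r < 1 \<Longrightarrow> compact (K r) \<and> K r \<subseteq> B \<and> ennreal r < emeasure \<mu> (K r)"
    by metis
  have cpt: "compact (lin_sumset x (K r))" if r: "0 \<le> r" "r < 1" for r
  proof -
    have "closed {b :: real ^ 'n. \<forall>i. b $ i \<in> K r}"
      using K[OF r] compact_imp_closed
      by (intro closed_Collect_all) (auto intro!: closed_vimage[unfolded vimage_def] continuous_intros)
    moreover obtain M where M: "\<And>y. y \<in> K r \<Longrightarrow> \<bar>y\<bar> \<le> M"
      using compact_imp_bounded[of "K r"] K[OF r] by (auto simp: bounded_iff)
    have "bounded {b :: real ^ 'n. \<forall>i. b $ i \<in> K r}"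
    proof (rule boundedI)
      fix b :: "real ^ 'n" assume "b \<in> {b. \<forall>i. b $ i \<in> K r}"
      then have "(\<Sum>i\<in>UNIV. \<bar>b $ i\<bar>) \<le> (\<Sum>i\<in>(UNIV :: 'n set). M)" by (intro sum_mono M) auto
      then show "norm b \<le> (\<Sum>i\<in>(UNIV :: 'n set). M)" using norm_le_l1_cart[of b] by linarith
    qed
    ultimately have "compact {b :: real ^ 'n. \<forall>i. b $ i \<in> K r}" by (simp add: compact_eq_bounded_closed)
    then have "compact ((\<lambda>b. \<Sum>i\<in>UNIV. x i * b $ i) ` {b. \<forall>i. b $ i \<in> K r})"
      by (intro compact_continuous_image continuous_intros)
    also have "(\<lambda>b. \<Sum>i\<in>UNIV. x i * b $ i) ` {b. \<forall>i. b $ i \<in> K r} = lin_sumset x (K r)"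
    proof (intro equalityI subsetI)
      fix u assume "u \<in> lin_sumset x (K r)"
      then obtain b where b: "\<And>i. b i \<in> K r" "u = (\<Sum>i\<in>UNIV. x i * b i)"
        by (auto simp: lin_sumset_def)
      then show "u \<in> (\<lambda>b. \<Sum>i\<in>UNIV. x i * b $ i) ` {b. \<forall>i. b $ i \<in> K r}"
        by (intro image_eqI[of _ _ "\<chi> i. b i"]) auto
    qed (auto simp: lin_sumset_def)
    finally show ?thesis .
  qed
  \<comment> \<open>A countable union of compact sumsets is Borel, and its mass is at least (1 - 1 /
    (n + 1)) ^ d for every n, hence 1.\<close>
  define S where "S = (\<Union>n. lin_sumset x (K (1 - 1 / real (Suc n))))"
  have r: "0 \<le> 1 - 1 / real (Suc n)" "1 - 1 / real (Suc n) < 1" for n by auto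
  have S: "S \<in> sets borel" unfolding S_def by (intro sets.countable_UN') (auto intro!: borel_compact cpt r)
  have "ennreal ((1 - 1 / real (Suc n)) ^ CARD('n)) \<le> emeasure (proj_measure \<mu> x) S" for n
  proof -
    let ?K = "K (1 - 1 / real (Suc n))"
    have Ks: "?K \<in> sets \<mu>" using K[OF r] by (auto simp: sets_eq_borel borel_compact)
    have Ls: "lin_sumset x ?K \<in> sets borel" by (intro borel_compact cpt r)
    have "ennreal ((1 - 1 / real (Suc n)) ^ CARD('n)) = ennreal (1 - 1 / real (Suc n)) ^ CARD('n)"
      using r by (simp add: ennreal_power)
    also have "\<dots> \<le> emeasure \<mu> ?K ^ CARD('n)"
      using K[OF r[of n]] by (intro power_mono) auto
    also have "\<dots> = emeasure ?P (PiE UNIV (\<lambda>_. ?K))"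
      using Ks by (subst prod.emeasure_PiM) auto
    also have "\<dots> \<le> emeasure ?P ((\<lambda>b. \<Sum>i\<in>UNIV. x i * b i) -` lin_sumset x ?K \<inter> space ?P)"
      by (intro emeasure_mono measurable_sets[OF measurable_proj Ls])
         (auto simp: lin_sumset_def space_PiM sp PiE_iff)
    also have "\<dots> = emeasure (proj_measure \<mu> x) (lin_sumset x ?K)"
      unfolding proj_measure_def using Ls by (subst emeasure_distr) auto
    also have "\<dots> \<le> emeasure (proj_measure \<mu> x) S"
      using S by (intro emeasure_mono) (auto simp: S_def)
    finally show ?thesis .
  qed
  then have le: "(1 - 1 / real (Suc n)) ^ CARD('n) \<le> measure (proj_measure \<mu> x) S" for n
    by (simp add: PR.emeasure_eq_measure)
  have "(\<lambda>n. (1 - 1 / real (Suc n)) ^ CARD('n)) \<longlonglongrightarrow> (1 - 0) ^ CARD('n)"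
    by (intro tendsto_intros LIMSEQ_Suc[OF lim_1_over_n])
  then have "(1 - 0) ^ CARD('n) \<le> measure (proj_measure \<mu> x) S"
    by (rule LIMSEQ_le_const2) (use le in blast)
  then have "measure (proj_measure \<mu> x) S = 1" using PR.prob_le_1[of S] by simp
  then have "AE u in proj_measure \<mu> x. u \<in> S"
    using S by (simp add: PR.prob_eq_1)
  moreover have "S \<subseteq> lin_sumset x A"
    unfolding S_def lin_sumset_def using K[OF r] B(1) by blast
  ultimately show ?thesis by (auto elim: eventually_mono)
qed

lemma char_proj_PiM:
  fixes x :: "'n::finite \<Rightarrow> real"
  shows "char (proj_measure \<mu> x) t = (CLINT b|(Pi\<^sub>M UNIV (\<lambda>_. \<mu>)). iexp (t * (\<Sum>i\<in>UNIV. x i * b i)))"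
  unfolding char_def proj_measure_def by (subst integral_distr) auto

lemma char_proj:
  fixes x :: "'n::finite \<Rightarrow> real"
  shows "char (proj_measure \<mu> x) t = (\<Prod>i\<in>UNIV. char \<mu> (t * x i))"
proof -
  have "char (proj_measure \<mu> x) t
      = (CLINT b|(Pi\<^sub>M UNIV (\<lambda>_. \<mu>)). \<Prod>i\<in>UNIV. iexp (t * x i * b i))"
    unfolding char_proj_PiM by (simp add: exp_sum[symmetric] sum_distrib_left mult.assoc)
  also have "\<dots> = (\<Prod>i\<in>UNIV. char \<mu> (t * x i))"
    unfolding char_def
    by (rule prod.product_integral_prod) (simp, rule integrable_iexp', measurable)
  finally show ?thesis .
qed

lemma cmod_char_proj:
  fixes x :: "'n::finite \<Rightarrow> real"
  shows "(cmod (char (proj_measure \<mu> x) t))\<^sup>2 = (\<Prod>i\<in>UNIV. (cmod (char \<mu> (t * x i)))\<^sup>2)"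
  by (simp add: char_proj prod_norm[symmetric] prod_power_distrib)

text \<open>The indicator of |u - v| <= h is at most exp (1/2) times a Gaussian of width h, which
  \<open>integral_gauss_char\<close> with L = 1 / h moves to the frequency side. The substitution
  there gives a factor h and the comparison of weights h powr (s - 1), together h powr s.\<close>

lemma fourier_energy_imp_correlation:
  fixes x :: "'n::finite \<Rightarrow> real"
  assumes fin: "fourier_energy \<mu> s x < \<infinity>" and s: "0 \<le> s" "s \<le> 1"
  shows "\<exists>C. correlation_bound (proj_measure \<mu> x) C s"
proof -
  let ?\<nu> = "proj_measure \<mu> x"
  interpret N: prob_space ?\<nu> by (rule prob_space_proj)
  interpret N: finite_borel_measure ?\<nu> by unfold_locales simp
  obtain e where e: "0 \<le> e" "fourier_energy \<mu> s x = ennreal e"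
    using fin by (cases "fourier_energy \<mu> s x") auto
  have "correlation_bound ?\<nu> (2 * exp (1/2) * e) s"
    unfolding correlation_bound_def
  proof (intro allI impI, elim conjE)
    fix h :: real assume h: "0 < h" "h \<le> 1"
    \<comment> \<open>Here h <= 1 and 0 <= s enter: (h * (1 + |t|)) powr (1 - s) is at most 1 + h *
      |t|, and the Gaussian absorbs this linear growth.\<close>
    have dom: "std_normal_density (h * t) \<le> 2 * h powr (s - 1) * (1 + \<bar>t\<bar>) powr (s - 1)" for t
    proof -
      define y where "y = h * \<bar>t\<bar>"
      have y: "0 \<le> y" using h by (simp add: y_def)
      have "(h * (1 + \<bar>t\<bar>)) powr (1 - s) \<le> (1 + y) powr (1 - s)"
        using h s by (intro powr_mono2) (auto simp: y_def distrib_left)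
      also have "\<dots> \<le> (1 + y) powr 1" using y s by (intro powr_mono) auto
      also have "\<dots> = 1 + y" using y by simp
      also have "\<dots> \<le> 2 * (1 + y\<^sup>2 / 2)"
        using zero_le_power2[of "y - 1/2"] by (simp add: power2_eq_square field_simps)
      also have "\<dots> \<le> 2 * exp (y\<^sup>2 / 2)" by (intro mult_left_mono exp_ge_add_one_self) auto
      finally have le: "(h * (1 + \<bar>t\<bar>)) powr (1 - s) \<le> 2 * exp (y\<^sup>2 / 2)" .
      have "0 < (h * (1 + \<bar>t\<bar>)) powr (1 - s)" using h by simp
      from le_imp_inverse_le[OF le this] have "exp (- (y\<^sup>2 / 2)) \<le> 2 * inverse ((h * (1 + \<bar>t\<bar>)) powr (1 - s))"
        by (simp add: exp_minus)
      also have "inverse ((h * (1 + \<bar>t\<bar>)) powr (1 - s)) = (h * (1 + \<bar>t\<bar>)) powr (s - 1)"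
        by (simp flip: powr_minus)
      finally have "exp (- (y\<^sup>2 / 2)) \<le> 2 * (h * (1 + \<bar>t\<bar>)) powr (s - 1)" .
      moreover have "std_normal_density (h * t) \<le> exp (- (y\<^sup>2 / 2))"
      proof -
        have "1 \<le> sqrt (2 * pi)" using pi_ge_two by (intro real_le_rsqrt) (simp add: power2_eq_square)
        then have "1 / sqrt (2 * pi) \<le> 1" by simp
        then have "1 / sqrt (2 * pi) * exp (- (h * t)\<^sup>2 / 2) \<le> 1 * exp (- (h * t)\<^sup>2 / 2)"
          by (rule mult_right_mono) simp
        then show ?thesis by (simp add: std_normal_density_def y_def power_mult_distrib)
      qed
      ultimately show ?thesis using h by (simp add: powr_mult mult.assoc)
    qed
    have "emeasure (?\<nu> \<Otimes>\<^sub>M ?\<nu>) {p. \<bar>fst p - snd p\<bar> \<le> h}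
        = (\<integral>\<^sup>+p. indicator {p. \<bar>fst p - snd p\<bar> \<le> h} p \<partial>(?\<nu> \<Otimes>\<^sub>M ?\<nu>))"
      by (rule nn_integral_indicator[symmetric], rule sets_near_diagonal) simp
    also have "\<dots> \<le> (\<integral>\<^sup>+p. ennreal (exp (1/2)) * ennreal (exp (- (1 / h * (fst p - snd p))\<^sup>2 / 2)) \<partial>(?\<nu> \<Otimes>\<^sub>M ?\<nu>))"
    proof (rule nn_integral_mono)
      fix p :: "real \<times> real"
      have "1 \<le> exp (1/2 + - (1 / h * (fst p - snd p))\<^sup>2 / 2)" if "\<bar>fst p - snd p\<bar> \<le> h"
      proof -
        have "\<bar>1 / h * (fst p - snd p)\<bar> \<le> 1" using that h by (simp add: abs_mult field_simps)
        then have "(1 / h * (fst p - snd p))\<^sup>2 \<le> 1" by (simp add: abs_square_le_1)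
        then show ?thesis by simp
      qed
      then show "indicator {p. \<bar>fst p - snd p\<bar> \<le> h} p
          \<le> ennreal (exp (1/2)) * ennreal (exp (- (1 / h * (fst p - snd p))\<^sup>2 / 2))"
        unfolding ennreal_mult'[OF exp_ge_zero, symmetric] exp_add[symmetric]
        by (auto split: split_indicator simp flip: ennreal_1 intro: ennreal_leI)
    qed
    also have "\<dots> = ennreal (exp (1/2)) * (\<integral>\<^sup>+p. ennreal (exp (- (1 / h * (fst p - snd p))\<^sup>2 / 2)) \<partial>(?\<nu> \<Otimes>\<^sub>M ?\<nu>))"
      by (rule nn_integral_cmult) measurable
    also have "\<dots> = ennreal (exp (1/2)) * (\<integral>\<^sup>+z. ennreal ((cmod (char ?\<nu> (1 / h * z)))\<^sup>2) \<partial>std_normal_distribution)"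
      unfolding N.integral_gauss_char ..
    also have "(\<integral>\<^sup>+z. ennreal ((cmod (char ?\<nu> (1 / h * z)))\<^sup>2) \<partial>std_normal_distribution)
        = (\<integral>\<^sup>+z. ennreal (std_normal_density z) * ennreal ((cmod (char ?\<nu> (1 / h * z)))\<^sup>2) \<partial>lborel)"
      by (rule nn_integral_density) measurable
    also have "\<dots> = ennreal \<bar>h\<bar> * (\<integral>\<^sup>+t. ennreal (std_normal_density (0 + h * t)) * ennreal ((cmod (char ?\<nu> (1 / h * (0 + h * t))))\<^sup>2) \<partial>lborel)"
      by (rule nn_integral_real_affine) (measurable, use h in simp)
    also have "\<dots> \<le> ennreal h * (\<integral>\<^sup>+t. ennreal (2 * h powr (s - 1)) * ennreal ((\<Prod>i\<in>UNIV. (cmod (char \<mu> (t * x i)))\<^sup>2) * (1 + \<bar>t\<bar>) powr (s - 1)) \<partial>lborel)"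
    proof (rule mult_mono, goal_cases)
      case 2
      show ?case
      proof (rule nn_integral_mono)
        fix t
        have "ennreal (std_normal_density (0 + h * t)) * ennreal ((cmod (char ?\<nu> (1 / h * (0 + h * t))))\<^sup>2)
            = ennreal (std_normal_density (h * t) * (cmod (char ?\<nu> t))\<^sup>2)"
          using h by (simp add: ennreal_mult')
        also have "\<dots> \<le> ennreal (2 * h powr (s - 1) * (1 + \<bar>t\<bar>) powr (s - 1) * (cmod (char ?\<nu> t))\<^sup>2)"
          by (intro ennreal_leI mult_right_mono dom) auto
        also have "\<dots> = ennreal (2 * h powr (s - 1)) * ennreal ((\<Prod>i\<in>UNIV. (cmod (char \<mu> (t * x i)))\<^sup>2) * (1 + \<bar>t\<bar>) powr (s - 1))"
          by (subst ennreal_mult'[symmetric]) (simp_all add: cmod_char_proj mult_ac)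
        finally show "ennreal (std_normal_density (0 + h * t)) * ennreal ((cmod (char ?\<nu> (1 / h * (0 + h * t))))\<^sup>2) \<le> \<dots>" .
      qed
    qed (use h in auto)
    also have "\<dots> = ennreal h * (ennreal (2 * h powr (s - 1)) * fourier_energy \<mu> s x)"
      unfolding fourier_energy_def by (subst nn_integral_cmult) auto
    also have "\<dots> = ennreal (2 * (h powr 1 * h powr (s - 1)) * e)"
      using h e by (simp add: ennreal_mult'[symmetric] mult_ac)
    also have "h powr 1 * h powr (s - 1) = h powr s" by (subst powr_add[symmetric]) simp
    finally have "emeasure (?\<nu> \<Otimes>\<^sub>M ?\<nu>) {p. \<bar>fst p - snd p\<bar> \<le> h} \<le> ennreal (exp (1/2)) * ennreal (2 * h powr s * e)"
      by (meson mult_left_mono order_trans zero_le)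
    then show "emeasure (?\<nu> \<Otimes>\<^sub>M ?\<nu>) {p. \<bar>fst p - snd p\<bar> \<le> h} \<le> ennreal (2 * exp (1/2) * e * h powr s)"
      using e by (simp add: ennreal_mult'[symmetric] mult_ac)
  qed
  then show ?thesis ..
qed

end

section \<open>Localisation of the characteristic function to unit windows\<close>

definition gauss_bump :: "real \<Rightarrow> ennreal" where
  "gauss_bump w = ennreal (exp (- w\<^sup>2 / 4))"

lemma measurable_gauss_bump [measurable]: "gauss_bump \<in> borel_measurable borel"
  unfolding gauss_bump_def by measurable

text \<open>The Gaussians are a smooth substitute for the indicator of |t x - \<zeta>| <= 1. The
  bound is uniform in \<zeta> because \<zeta> is integrated out afterwards; \<open>X\<close>
  supplies the coordinates, so that functions and vectors are covered alike.\<close>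

definition bump_bound :: "'b measure \<Rightarrow> ('n::finite \<Rightarrow> 'b \<Rightarrow> real) \<Rightarrow> real \<Rightarrow> real \<Rightarrow> bool" where
  "bump_bound \<rho> X K \<beta> \<longleftrightarrow> (\<forall>R \<zeta>. 1 \<le> R \<longrightarrow>
     (\<integral>\<^sup>+x. (\<integral>\<^sup>+t. indicator {t. R \<le> \<bar>t\<bar> \<and> \<bar>t\<bar> < 2 * R} t * (\<Prod>i\<in>UNIV. gauss_bump (t * X i x - \<zeta> i)) \<partial>lborel) \<partial>\<rho>)
       \<le> ennreal (K * R powr - \<beta>))"

locale frostman_real = real_prob +
  fixes D C \<kappa> :: real
  assumes bounded: "AE y in \<mu>. \<bar>y\<bar> \<le> D"
    and C: "0 \<le> C"
    and ball: "0 < r \<Longrightarrow> measure \<mu> (cball x r) \<le> C * r powr \<kappa>"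
begin

text \<open>Undoes the Gaussian weight as \<open>char_local_bound\<close> requires. On the support
  |y| <= D the density is at most exp (D^2 / 2), so \<open>tilt\<close> is finite and inherits the
  ball bounds up to this factor.\<close>

definition tilt :: "real measure" where
  "tilt = density \<mu> (\<lambda>y. ennreal (exp (y\<^sup>2 / 2)))"

lemma sets_tilt [measurable_cong, simp]: "sets tilt = sets borel"
  by (simp add: tilt_def sets_eq_borel)

lemma nn_integral_tilt_le:
  assumes [measurable]: "f \<in> borel_measurable borel"
  shows "(\<integral>\<^sup>+y. f y \<partial>tilt) \<le> ennreal (exp (D\<^sup>2 / 2)) * (\<integral>\<^sup>+y. f y \<partial>\<mu>)"
proof -
  have "(\<integral>\<^sup>+y. f y \<partial>tilt) = (\<integral>\<^sup>+y. ennreal (exp (y\<^sup>2 / 2)) * f y \<partial>\<mu>)"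
    unfolding tilt_def by (rule nn_integral_density) measurable
  also have "\<dots> \<le> (\<integral>\<^sup>+y. ennreal (exp (D\<^sup>2 / 2)) * f y \<partial>\<mu>)"
  proof (rule nn_integral_mono_AE, use bounded in eventually_elim)
    fix y assume "\<bar>y\<bar> \<le> D"
    then have "y\<^sup>2 \<le> D\<^sup>2" using power_mono[of "\<bar>y\<bar>" D 2] by simp
    then show "ennreal (exp (y\<^sup>2 / 2)) * f y \<le> ennreal (exp (D\<^sup>2 / 2)) * f y"
      by (intro mult_right_mono ennreal_leI) auto
  qed
  also have "\<dots> = ennreal (exp (D\<^sup>2 / 2)) * (\<integral>\<^sup>+y. f y \<partial>\<mu>)" by (rule nn_integral_cmult) measurable
  finally show ?thesis .
qed

sublocale tilt: finite_borel_measure tilt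
proof -
  have "emeasure tilt (space tilt) = (\<integral>\<^sup>+y. 1 \<partial>tilt)" by simp
  also have "\<dots> \<le> ennreal (exp (D\<^sup>2 / 2)) * (\<integral>\<^sup>+y. 1 \<partial>\<mu>)" by (rule nn_integral_tilt_le) simp
  also have "\<dots> < \<infinity>" by (simp add: emeasure_space_1)
  finally have "finite_measure tilt" by (intro finite_measureI) simp
  then show "finite_borel_measure tilt"
    by (simp add: finite_borel_measure_def finite_borel_measure_axioms_def)
qed

definition tilt_power :: "real \<Rightarrow> ennreal" where
  "tilt_power z = ennreal ((cmod (char tilt z))\<^sup>2)"

lemma measurable_tilt_power [measurable]: "tilt_power \<in> borel_measurable borel"
  unfolding tilt_power_def by measurable

text \<open>The substitution z -> 2 * R * z turns the weight into a multiple of the standard normal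
  density, and \<open>integral_gauss_char\<close> with L = 2 * R yields the kernel exp (- 2 * (R *
  (u - v))^2), hence \<open>gauss_const 2\<close>. The Jacobian contributes R, the ball bound R powr
  - \<kappa>, and each copy of \<open>tilt\<close> a factor exp (D^2 / 2).\<close>

lemma nn_integral_tilt_power:
  assumes R: "0 < R"
  shows "(\<integral>\<^sup>+z. ennreal (exp (- z\<^sup>2 / (8 * R\<^sup>2))) * tilt_power z \<partial>lborel)
    \<le> ennreal (2 * sqrt (2 * pi) * (exp (D\<^sup>2 / 2))\<^sup>2 * C * gauss_const 2 \<kappa> * R powr (1 - \<kappa>))"
proof -
  let ?e = "ennreal (exp (D\<^sup>2 / 2))"
  have g: "ennreal (exp (- (0 + 2 * R * z)\<^sup>2 / (8 * R\<^sup>2))) = ennreal (sqrt (2 * pi)) * ennreal (std_normal_density z)" for z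
    using R by (subst ennreal_mult'[symmetric])
      (auto simp: std_normal_density_def power_mult_distrib field_simps)
  have "(\<integral>\<^sup>+z. ennreal (exp (- z\<^sup>2 / (8 * R\<^sup>2))) * tilt_power z \<partial>lborel)
      = ennreal \<bar>2 * R\<bar> * (\<integral>\<^sup>+z. ennreal (exp (- (0 + 2 * R * z)\<^sup>2 / (8 * R\<^sup>2))) * tilt_power (0 + 2 * R * z) \<partial>lborel)"
    by (rule nn_integral_real_affine) (measurable, use R in simp)
  also have "\<dots> = ennreal \<bar>2 * R\<bar> * (\<integral>\<^sup>+z. ennreal (sqrt (2 * pi)) * (ennreal (std_normal_density z) * tilt_power (2 * R * z)) \<partial>lborel)"
    unfolding g by (simp add: mult.assoc)
  also have "\<dots> = ennreal \<bar>2 * R\<bar> * (ennreal (sqrt (2 * pi)) * (\<integral>\<^sup>+z. ennreal (std_normal_density z) * tilt_power (2 * R * z) \<partial>lborel))"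
    by (subst nn_integral_cmult) auto
  also have "(\<integral>\<^sup>+z. ennreal (std_normal_density z) * tilt_power (2 * R * z) \<partial>lborel)
      = (\<integral>\<^sup>+z. tilt_power (2 * R * z) \<partial>std_normal_distribution)"
    by (rule nn_integral_density[symmetric]) measurable
  also have "\<dots> = (\<integral>\<^sup>+p. ennreal (exp (- (2 * R * (fst p - snd p))\<^sup>2 / 2)) \<partial>(tilt \<Otimes>\<^sub>M tilt))"
    unfolding tilt_power_def by (rule tilt.integral_gauss_char)
  also have "\<dots> = (\<integral>\<^sup>+v. (\<integral>\<^sup>+u. ennreal (exp (- (2 * R * (v - u))\<^sup>2 / 2)) \<partial>tilt) \<partial>tilt)"
    by (subst tilt.nn_integral_fst[symmetric]) auto
  also have "\<dots> \<le> (\<integral>\<^sup>+v. ?e * ennreal (C * gauss_const 2 \<kappa> * R powr - \<kappa>) \<partial>tilt)"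
  proof (rule nn_integral_mono)
    fix v :: real
    have "(\<integral>\<^sup>+u. ennreal (exp (- (2 * R * (v - u))\<^sup>2 / 2)) \<partial>tilt)
        \<le> ?e * (\<integral>\<^sup>+u. ennreal (exp (- (2 * R * (v - u))\<^sup>2 / 2)) \<partial>\<mu>)"
      by (rule nn_integral_tilt_le) measurable
    also have "(\<integral>\<^sup>+u. ennreal (exp (- (2 * R * (v - u))\<^sup>2 / 2)) \<partial>\<mu>)
        = (\<integral>\<^sup>+u. ennreal (exp (- 2 * (R * \<bar>u - v\<bar>)\<^sup>2)) \<partial>\<mu>)"
      by (intro nn_integral_cong) (simp add: power_mult_distrib power2_commute)
    also have "\<dots> \<le> ennreal (C * gauss_const 2 \<kappa> * R powr - \<kappa>)"
    proof (rule nn_integral_gauss_le)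
      fix r :: real assume "0 < r"
      have "{x \<in> space \<mu>. \<bar>x - v\<bar> \<le> r} = cball v r"
        using sets_eq_imp_space_eq[OF sets_eq_borel] by (auto simp: dist_real_def)
      then show "emeasure \<mu> {x \<in> space \<mu>. \<bar>x - v\<bar> \<le> r} \<le> ennreal (C * r powr \<kappa>)"
        using ball[OF \<open>0 < r\<close>, of v] by (simp add: emeasure_eq_measure ennreal_leI)
    qed (use R C in auto)
    finally show "(\<integral>\<^sup>+u. ennreal (exp (- (2 * R * (v - u))\<^sup>2 / 2)) \<partial>tilt) \<le> ?e * ennreal (C * gauss_const 2 \<kappa> * R powr - \<kappa>)"
      by (simp add: mult_left_mono)
  qed
  also have "\<dots> \<le> ?e * (\<integral>\<^sup>+v. ?e * ennreal (C * gauss_const 2 \<kappa> * R powr - \<kappa>) \<partial>\<mu>)"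
    by (rule nn_integral_tilt_le) simp
  also have "\<dots> = ?e * (?e * ennreal (C * gauss_const 2 \<kappa> * R powr - \<kappa>))"
    by (simp add: emeasure_space_1)
  finally have "(\<integral>\<^sup>+z. ennreal (exp (- z\<^sup>2 / (8 * R\<^sup>2))) * tilt_power z \<partial>lborel)
     \<le> ennreal \<bar>2 * R\<bar> * (ennreal (sqrt (2 * pi)) * (?e * (?e * ennreal (C * gauss_const 2 \<kappa> * R powr - \<kappa>))))"
    by (simp add: mult_left_mono)
  also have "\<dots> = ennreal (2 * R * (sqrt (2 * pi) * (exp (D\<^sup>2 / 2) * (exp (D\<^sup>2 / 2) * (C * gauss_const 2 \<kappa> * R powr - \<kappa>)))))"
    using R C gauss_const_nonneg[of 2 \<kappa>] by (simp add: ennreal_mult)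
  also have "2 * R * (sqrt (2 * pi) * (exp (D\<^sup>2 / 2) * (exp (D\<^sup>2 / 2) * (C * gauss_const 2 \<kappa> * R powr - \<kappa>))))
     = 2 * sqrt (2 * pi) * (exp (D\<^sup>2 / 2))\<^sup>2 * C * gauss_const 2 \<kappa> * (R powr 1 * R powr - \<kappa>)"
    using R by (simp add: power2_eq_square)
  also have "R powr 1 * R powr - \<kappa> = R powr (1 - \<kappa>)" by (subst powr_add[symmetric]) simp
  finally show ?thesis .
qed

text \<open>The Gaussian exp (- w^2 / 2), w = t * x - z, is divided: half of it stays as
  \<open>gauss_bump w\<close>, the other half pays for a cutoff to |z| of order R. Indeed z^2 <= 2 *
  w^2 + 2 * (t * x)^2 and |t * x| <= 2 * R * D' give z^2 / (8 * R^2) <= w^2 / 4 + D'^2. The cutoff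
  is independent of t and x, so it can be pulled out of their average.\<close>

lemma char_window:
  assumes R: "1 \<le> R" and t: "\<bar>t\<bar> \<le> 2 * R" and x: "\<bar>x\<bar> \<le> D'"
  shows "ennreal ((cmod (char \<mu> (t * x)))\<^sup>2)
    \<le> (\<integral>\<^sup>+z. gauss_bump (t * x - z) * (ennreal (exp (D'\<^sup>2) * exp (- z\<^sup>2 / (8 * R\<^sup>2))) * tilt_power z) \<partial>lborel)"
proof -
  have "ennreal ((cmod (char \<mu> (t * x)))\<^sup>2) \<le> (\<integral>\<^sup>+z. tilt_power (t * x + z) \<partial>std_normal_distribution)"
    unfolding tilt_power_def tilt_def
    by (rule char_local_bound) (fold tilt_def, rule tilt.finite_measure_axioms)
  also have "\<dots> = (\<integral>\<^sup>+z. ennreal (std_normal_density z) * tilt_power (t * x + z) \<partial>lborel)"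
    by (rule nn_integral_density) measurable
  also have "\<dots> = ennreal \<bar>1\<bar> * (\<integral>\<^sup>+z. ennreal (std_normal_density (- (t * x) + 1 * z)) * tilt_power (t * x + (- (t * x) + 1 * z)) \<partial>lborel)"
    by (rule nn_integral_real_affine) auto
  also have "\<dots> = (\<integral>\<^sup>+z. ennreal (std_normal_density (z - t * x)) * tilt_power z \<partial>lborel)"
    by simp
  also have "\<dots> \<le> (\<integral>\<^sup>+z. gauss_bump (t * x - z) * (ennreal (exp (D'\<^sup>2) * exp (- z\<^sup>2 / (8 * R\<^sup>2))) * tilt_power z) \<partial>lborel)"
  proof (rule nn_integral_mono)
    fix z :: real
    define w where "w = t * x - z"
    have R2: "1 \<le> R\<^sup>2" using R by (simp add: one_le_power)
    have "(t * x)\<^sup>2 \<le> (2 * R * D')\<^sup>2"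
      using t x R mult_mono[OF t x] by (intro power2_le_iff_abs_le[THEN iffD2]) (auto simp: abs_mult)
    then have tx: "(t * x)\<^sup>2 \<le> 4 * R\<^sup>2 * D'\<^sup>2" by (simp add: power_mult_distrib)
    have "z\<^sup>2 + (2 * (t * x) - z)\<^sup>2 = 2 * w\<^sup>2 + 2 * (t * x)\<^sup>2"
      by (simp add: w_def power2_eq_square algebra_simps)
    then have "z\<^sup>2 \<le> 2 * w\<^sup>2 + 2 * (t * x)\<^sup>2" using zero_le_power2[of "2 * (t * x) - z"] by linarith
    also have "\<dots> \<le> 2 * (R\<^sup>2 * w\<^sup>2) + 2 * (4 * R\<^sup>2 * D'\<^sup>2)"
      using tx mult_right_mono[OF R2, of "w\<^sup>2"] by auto
    finally have "z\<^sup>2 / (8 * R\<^sup>2) \<le> (2 * (R\<^sup>2 * w\<^sup>2) + 2 * (4 * R\<^sup>2 * D'\<^sup>2)) / (8 * R\<^sup>2)"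
      using R2 by (intro divide_right_mono) auto
    also have "\<dots> = w\<^sup>2 / 4 + D'\<^sup>2" using R by (simp add: add_divide_distrib)
    finally have le: "- w\<^sup>2 / 2 \<le> - w\<^sup>2 / 4 + (D'\<^sup>2 + - z\<^sup>2 / (8 * R\<^sup>2))" by simp
    have "1 \<le> sqrt (2 * pi)" using pi_ge_two by (intro real_le_rsqrt) (simp add: power2_eq_square)
    then have "1 / sqrt (2 * pi) \<le> 1" by simp
    then have "1 / sqrt (2 * pi) * exp (- (z - t * x)\<^sup>2 / 2) \<le> 1 * exp (- (z - t * x)\<^sup>2 / 2)"
      by (rule mult_right_mono) simp
    also have "\<dots> = exp (- w\<^sup>2 / 2)" by (simp add: w_def power2_commute)
    also have "\<dots> \<le> exp (- w\<^sup>2 / 4 + (D'\<^sup>2 + - z\<^sup>2 / (8 * R\<^sup>2)))" using le by (simp only: exp_le_cancel_iff)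
    also have "\<dots> = exp (- w\<^sup>2 / 4) * (exp (D'\<^sup>2) * exp (- z\<^sup>2 / (8 * R\<^sup>2)))" by (simp only: exp_add)
    finally have "std_normal_density (z - t * x) \<le> exp (- w\<^sup>2 / 4) * (exp (D'\<^sup>2) * exp (- z\<^sup>2 / (8 * R\<^sup>2)))"
      by (simp add: std_normal_density_def)
    then have "ennreal (std_normal_density (z - t * x)) \<le> gauss_bump w * ennreal (exp (D'\<^sup>2) * exp (- z\<^sup>2 / (8 * R\<^sup>2)))"
      unfolding gauss_bump_def by (subst ennreal_mult'[symmetric]) (auto intro: ennreal_leI)
    then have "ennreal (std_normal_density (z - t * x)) * tilt_power z
        \<le> gauss_bump w * ennreal (exp (D'\<^sup>2) * exp (- z\<^sup>2 / (8 * R\<^sup>2))) * tilt_power z"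
      by (rule mult_right_mono) simp
    then show "ennreal (std_normal_density (z - t * x)) * tilt_power z
        \<le> gauss_bump (t * x - z) * (ennreal (exp (D'\<^sup>2) * exp (- z\<^sup>2 / (8 * R\<^sup>2))) * tilt_power z)"
      by (simp add: w_def mult.assoc)
  qed
  finally show ?thesis .
qed

end

section \<open>Fourier energy of almost every projection\<close>

lemma real_dyadic_ivl:
  assumes "1 \<le> (r :: real)"
  shows "\<exists>j::nat. 2 ^ j \<le> r \<and> r < 2 * 2 ^ j"
proof -
  define k where "k = nat \<lfloor>r\<rfloor>"
  have k: "1 \<le> k" "real k \<le> r" "r < real k + 1" using assms by (auto simp: k_def) linarith+
  obtain j where j: "2 ^ j \<le> k" "k < 2 ^ (j + 1)" using ex_power_ivl1[of 2 k] k by auto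
  have "real (2 ^ j) \<le> real k" using j(1) by (rule of_nat_mono)
  then have "2 ^ j \<le> r" using k(2) by (simp only: of_nat_power of_nat_numeral)
  moreover have "real (k + 1) \<le> real (2 ^ (j + 1))" using j(2) by (intro of_nat_mono) simp
  then have "r < 2 * 2 ^ j" using k(3) by simp
  ultimately show ?thesis by blast
qed

context frostman_real
begin

text \<open>The order of integration is the point: expanding every factor into its window first
  gives an integral over \<zeta> outside, and for fixed \<zeta> the average over (t, x) is exactly
  what \<open>bump_bound\<close> controls. The cutoffs left over integrate to a product of
  one-dimensional bounds.\<close>

lemma fourier_block:
  fixes X :: "'n::finite \<Rightarrow> 'b \<Rightarrow> real"
  assumes fin: "finite_measure \<rho>" and X [measurable]: "\<And>i. X i \<in> borel_measurable \<rho>"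
    and bd: "AE x in \<rho>. \<forall>i. \<bar>X i x\<bar> \<le> D'"
    and bump: "bump_bound \<rho> X K \<beta>" and K: "0 \<le> K"
  obtains A where "0 \<le> A" "\<And>R. 1 \<le> R \<Longrightarrow>
    (\<integral>\<^sup>+x. (\<integral>\<^sup>+t. indicator {t. R \<le> \<bar>t\<bar> \<and> \<bar>t\<bar> < 2 * R} t * (\<Prod>i\<in>UNIV. ennreal ((cmod (char \<mu> (t * X i x)))\<^sup>2)) \<partial>lborel) \<partial>\<rho>)
      \<le> ennreal (A * R powr (CARD('n) * (1 - \<kappa>) - \<beta>))"
proof -
  interpret \<rho>: finite_measure \<rho> by fact
  interpret L: product_sigma_finite "\<lambda>_::'n. lborel :: real measure" ..
  interpret L: finite_product_sigma_finite "\<lambda>_::'n. lborel :: real measure" UNIV by standard simp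
  let ?L = "Pi\<^sub>M (UNIV :: 'n set) (\<lambda>_. lborel :: real measure)"
  interpret TL: pair_sigma_finite "lborel :: real measure" ?L ..
  interpret RL: pair_sigma_finite \<rho> ?L ..
  define c where "c = exp (D'\<^sup>2) * (2 * sqrt (2 * pi) * (exp (D\<^sup>2 / 2))\<^sup>2 * C * gauss_const 2 \<kappa>)"
  have c: "0 \<le> c" using C gauss_const_nonneg[of 2 \<kappa>] by (simp add: c_def)
  show thesis
  proof (rule that[of "K * c ^ CARD('n)"])
    show "0 \<le> K * c ^ CARD('n)" using K c by simp
    fix R :: real assume R: "1 \<le> R"
    define I where "I = {t :: real. R \<le> \<bar>t\<bar> \<and> \<bar>t\<bar> < 2 * R}"
    have [measurable]: "I \<in> sets borel" unfolding I_def by measurable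
    define h where "h z = ennreal (exp (D'\<^sup>2) * exp (- z\<^sup>2 / (8 * R\<^sup>2))) * tilt_power z" for z
    have [measurable]: "h \<in> borel_measurable borel" unfolding h_def by measurable
    have J: "(\<integral>\<^sup>+z. h z \<partial>lborel) \<le> ennreal (c * R powr (1 - \<kappa>))"
    proof -
      have "(\<integral>\<^sup>+z. h z \<partial>lborel) = (\<integral>\<^sup>+z. ennreal (exp (D'\<^sup>2)) * (ennreal (exp (- z\<^sup>2 / (8 * R\<^sup>2))) * tilt_power z) \<partial>lborel)"
        unfolding h_def by (simp add: ennreal_mult' mult.assoc)
      also have "\<dots> = ennreal (exp (D'\<^sup>2)) * (\<integral>\<^sup>+z. ennreal (exp (- z\<^sup>2 / (8 * R\<^sup>2))) * tilt_power z \<partial>lborel)"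
        by (rule nn_integral_cmult) measurable
      also have "\<dots> \<le> ennreal (exp (D'\<^sup>2)) * ennreal (2 * sqrt (2 * pi) * (exp (D\<^sup>2 / 2))\<^sup>2 * C * gauss_const 2 \<kappa> * R powr (1 - \<kappa>))"
        using R by (intro mult_left_mono nn_integral_tilt_power) auto
      also have "\<dots> = ennreal (c * R powr (1 - \<kappa>))"
        by (subst ennreal_mult'[symmetric]) (simp_all add: c_def mult.assoc)
      finally show ?thesis .
    qed
    let ?B = "\<lambda>x t \<zeta>. indicator I t * (\<Prod>i\<in>UNIV. gauss_bump (t * X i x - \<zeta> i)) :: ennreal"
    let ?H = "\<lambda>\<zeta>::'n \<Rightarrow> real. \<Prod>i\<in>UNIV. h (\<zeta> i)"
    have "(\<integral>\<^sup>+x. (\<integral>\<^sup>+t. indicator I t * (\<Prod>i\<in>UNIV. ennreal ((cmod (char \<mu> (t * X i x)))\<^sup>2)) \<partial>lborel) \<partial>\<rho>)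
        \<le> (\<integral>\<^sup>+x. (\<integral>\<^sup>+t. (\<integral>\<^sup>+\<zeta>. ?H \<zeta> * ?B x t \<zeta> \<partial>?L) \<partial>lborel) \<partial>\<rho>)"
    proof (rule nn_integral_mono_AE, use bd in eventually_elim, rule nn_integral_mono)
      fix x and t :: real assume x: "\<forall>i. \<bar>X i x\<bar> \<le> D'"
      show "indicator I t * (\<Prod>i\<in>UNIV. ennreal ((cmod (char \<mu> (t * X i x)))\<^sup>2)) \<le> (\<integral>\<^sup>+\<zeta>. ?H \<zeta> * ?B x t \<zeta> \<partial>?L)"
      proof (cases "t \<in> I")
        case True
        then have "(\<Prod>i\<in>UNIV. ennreal ((cmod (char \<mu> (t * X i x)))\<^sup>2))
            \<le> (\<Prod>i\<in>UNIV. \<integral>\<^sup>+z. gauss_bump (t * X i x - z) * h z \<partial>lborel)"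
          unfolding h_def using x R by (intro prod_mono_ennreal char_window) (auto simp: I_def)
        also have "\<dots> = (\<integral>\<^sup>+\<zeta>. (\<Prod>i\<in>UNIV. gauss_bump (t * X i x - \<zeta> i) * h (\<zeta> i)) \<partial>?L)"
          by (rule L.product_nn_integral_prod[symmetric]) auto
        also have "\<dots> = (\<integral>\<^sup>+\<zeta>. ?H \<zeta> * ?B x t \<zeta> \<partial>?L)"
          using True by (intro nn_integral_cong) (simp add: prod.distrib mult.commute)
        finally show ?thesis using True by simp
      qed simp
    qed
    also have "\<dots> = (\<integral>\<^sup>+x. (\<integral>\<^sup>+\<zeta>. (\<integral>\<^sup>+t. ?H \<zeta> * ?B x t \<zeta> \<partial>lborel) \<partial>?L) \<partial>\<rho>)"
    proof (intro nn_integral_cong)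
      fix x
      show "(\<integral>\<^sup>+t. (\<integral>\<^sup>+\<zeta>. ?H \<zeta> * ?B x t \<zeta> \<partial>?L) \<partial>lborel) = (\<integral>\<^sup>+\<zeta>. (\<integral>\<^sup>+t. ?H \<zeta> * ?B x t \<zeta> \<partial>lborel) \<partial>?L)"
        by (rule TL.Fubini'[symmetric]) measurable
    qed
    also have "\<dots> = (\<integral>\<^sup>+\<zeta>. (\<integral>\<^sup>+x. (\<integral>\<^sup>+t. ?H \<zeta> * ?B x t \<zeta> \<partial>lborel) \<partial>\<rho>) \<partial>?L)"
      by (rule RL.Fubini'[symmetric]) measurable
    also have "\<dots> \<le> (\<integral>\<^sup>+\<zeta>. ?H \<zeta> * ennreal (K * R powr - \<beta>) \<partial>?L)"
    proof (rule nn_integral_mono)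
      fix \<zeta> :: "'n \<Rightarrow> real"
      have "(\<integral>\<^sup>+x. (\<integral>\<^sup>+t. ?H \<zeta> * ?B x t \<zeta> \<partial>lborel) \<partial>\<rho>) = (\<integral>\<^sup>+x. ?H \<zeta> * (\<integral>\<^sup>+t. ?B x t \<zeta> \<partial>lborel) \<partial>\<rho>)"
        by (intro nn_integral_cong nn_integral_cmult) measurable
      also have "\<dots> = ?H \<zeta> * (\<integral>\<^sup>+x. (\<integral>\<^sup>+t. ?B x t \<zeta> \<partial>lborel) \<partial>\<rho>)"
        by (intro nn_integral_cmult) measurable
      also have "\<dots> \<le> ?H \<zeta> * ennreal (K * R powr - \<beta>)"
        using bump R unfolding bump_bound_def I_def by (intro mult_left_mono) auto
      finally show "(\<integral>\<^sup>+x. (\<integral>\<^sup>+t. ?H \<zeta> * ?B x t \<zeta> \<partial>lborel) \<partial>\<rho>) \<le> ?H \<zeta> * ennreal (K * R powr - \<beta>)" .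
    qed
    also have "\<dots> = (\<integral>\<^sup>+\<zeta>. ?H \<zeta> \<partial>?L) * ennreal (K * R powr - \<beta>)"
      by (rule nn_integral_multc) measurable
    also have "(\<integral>\<^sup>+\<zeta>. ?H \<zeta> \<partial>?L) = (\<Prod>i\<in>(UNIV :: 'n set). \<integral>\<^sup>+z. h z \<partial>lborel)"
      by (rule L.product_nn_integral_prod) auto
    also have "\<dots> * ennreal (K * R powr - \<beta>) \<le> (\<Prod>i\<in>(UNIV :: 'n set). ennreal (c * R powr (1 - \<kappa>))) * ennreal (K * R powr - \<beta>)"
      by (intro mult_right_mono prod_mono_ennreal J) auto
    also have "(\<Prod>i\<in>(UNIV :: 'n set). ennreal (c * R powr (1 - \<kappa>))) = ennreal ((c * R powr (1 - \<kappa>)) ^ CARD('n))"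
      using c by (simp add: ennreal_power)
    also have "\<dots> * ennreal (K * R powr - \<beta>) = ennreal ((c * R powr (1 - \<kappa>)) ^ CARD('n) * (K * R powr - \<beta>))"
      using c K by (intro ennreal_mult[symmetric]) auto
    also have "(c * R powr (1 - \<kappa>)) ^ CARD('n) * (K * R powr - \<beta>)
        = K * c ^ CARD('n) * ((R powr (1 - \<kappa>)) ^ CARD('n) * R powr - \<beta>)"
      by (simp add: power_mult_distrib)
    also have "(R powr (1 - \<kappa>)) ^ CARD('n) = R powr (CARD('n) * (1 - \<kappa>))"
      using R by (simp add: powr_power mult.commute)
    also have "R powr (CARD('n) * (1 - \<kappa>)) * R powr - \<beta> = R powr (CARD('n) * (1 - \<kappa>) - \<beta>)"
      by (subst powr_add[symmetric]) simp
    finally show "(\<integral>\<^sup>+x. (\<integral>\<^sup>+t. indicator {t. R \<le> \<bar>t\<bar> \<and> \<bar>t\<bar> < 2 * R} t * (\<Prod>i\<in>UNIV. ennreal ((cmod (char \<mu> (t * X i x)))\<^sup>2)) \<partial>lborel) \<partial>\<rho>)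
      \<le> ennreal (K * c ^ CARD('n) * R powr (CARD('n) * (1 - \<kappa>) - \<beta>))"
      unfolding I_def .
  qed
qed

lemma cmod_char_le_1: "cmod (char \<mu> t) \<le> 1"
  using cmod_char_le[of t] prob_space by simp

lemma fourier_energy_finite_AE:
  fixes X :: "'n::finite \<Rightarrow> 'b \<Rightarrow> real"
  assumes fin: "finite_measure \<rho>" and X [measurable]: "\<And>i. X i \<in> borel_measurable \<rho>"
    and bd: "AE x in \<rho>. \<forall>i. \<bar>X i x\<bar> \<le> D'"
    and bump: "bump_bound \<rho> X K \<beta>" "0 \<le> K"
    and s: "s \<le> 1" "s < 1 - CARD('n) * (1 - \<kappa>) + \<beta>"
  shows "AE x in \<rho>. fourier_energy \<mu> s (\<lambda>i. X i x) < \<infinity>"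
proof -
  interpret \<rho>: finite_measure \<rho> by fact
  obtain A where A: "0 \<le> A" "\<And>R. 1 \<le> R \<Longrightarrow>
    (\<integral>\<^sup>+x. (\<integral>\<^sup>+t. indicator {t. R \<le> \<bar>t\<bar> \<and> \<bar>t\<bar> < 2 * R} t * (\<Prod>i\<in>UNIV. ennreal ((cmod (char \<mu> (t * X i x)))\<^sup>2)) \<partial>lborel) \<partial>\<rho>)
      \<le> ennreal (A * R powr (CARD('n) * (1 - \<kappa>) - \<beta>))"
    using fourier_block[OF fin X bd bump] by blast
  define I where "I j = {t :: real. 2 ^ j \<le> \<bar>t\<bar> \<and> \<bar>t\<bar> < 2 * 2 ^ j}" for j :: nat
  have [measurable]: "I j \<in> sets borel" for j unfolding I_def by measurable
  let ?F = "\<lambda>x t. \<Prod>i\<in>UNIV. ennreal ((cmod (char \<mu> (t * X i x)))\<^sup>2)"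
  define G where "G j x = (\<integral>\<^sup>+t. indicator (I j) t * ?F x t \<partial>lborel)" for j x
  have [measurable]: "G j \<in> borel_measurable \<rho>" for j unfolding G_def by measurable
  define w where "w j = ennreal ((2 ^ j) powr (s - 1))" for j :: nat
  have le: "fourier_energy \<mu> s (\<lambda>i. X i x) \<le> 2 + (\<Sum>j. w j * G j x)" if "x \<in> space \<rho>" for x
  proof -
    have [measurable]: "?F x \<in> borel_measurable borel" by measurable
    have "fourier_energy \<mu> s (\<lambda>i. X i x)
        \<le> (\<integral>\<^sup>+t. indicator {-1..1} t + (\<Sum>j. w j * (indicator (I j) t * ?F x t)) \<partial>lborel)"
      unfolding fourier_energy_def
    proof (rule nn_integral_mono)
      fix t :: real
      have F: "?F x t = ennreal (\<Prod>i\<in>UNIV. (cmod (char \<mu> (t * X i x)))\<^sup>2)" by (simp add: prod_ennreal)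
      show "ennreal ((\<Prod>i\<in>UNIV. (cmod (char \<mu> (t * X i x)))\<^sup>2) * (1 + \<bar>t\<bar>) powr (s - 1))
          \<le> indicator {-1..1} t + (\<Sum>j. w j * (indicator (I j) t * ?F x t))"
      proof (cases "\<bar>t\<bar> < 1")
        case True
        have "(\<Prod>i\<in>(UNIV::'n set). (cmod (char \<mu> (t * X i x)))\<^sup>2) \<le> 1"
          by (intro prod_le_1) (auto intro!: power_le_one cmod_char_le_1)
        moreover have "(1 + \<bar>t\<bar>) powr (s - 1) \<le> 1"
        proof -
          have "(1 + \<bar>t\<bar>) powr (s - 1) \<le> (1 + \<bar>t\<bar>) powr 0" using s by (intro powr_mono) auto
          also have "\<dots> = 1" unfolding powr_zero_eq_one using abs_ge_zero[of t] by auto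
          finally show ?thesis .
        qed
        ultimately have "(\<Prod>i\<in>UNIV. (cmod (char \<mu> (t * X i x)))\<^sup>2) * (1 + \<bar>t\<bar>) powr (s - 1) \<le> 1 * 1"
          by (intro mult_mono) (auto intro!: prod_nonneg)
        then have "ennreal ((\<Prod>i\<in>UNIV. (cmod (char \<mu> (t * X i x)))\<^sup>2) * (1 + \<bar>t\<bar>) powr (s - 1)) \<le> 1"
          by (simp add: ennreal_le_1)
        also have "\<dots> \<le> indicator {-1..1} t + (\<Sum>j. w j * (indicator (I j) t * ?F x t))"
          using True by (auto simp: indicator_def)
        finally show ?thesis .
      next
        case False
        then obtain j :: nat where j: "2 ^ j \<le> \<bar>t\<bar>" "\<bar>t\<bar> < 2 * 2 ^ j" using real_dyadic_ivl[of "\<bar>t\<bar>"] by auto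
        have "(1 + \<bar>t\<bar>) powr (s - 1) \<le> (2 ^ j) powr (s - 1)"
          using s j(1) by (intro powr_mono2') auto
        then have "ennreal ((\<Prod>i\<in>UNIV. (cmod (char \<mu> (t * X i x)))\<^sup>2) * (1 + \<bar>t\<bar>) powr (s - 1))
            \<le> ennreal ((2 ^ j) powr (s - 1) * (\<Prod>i\<in>UNIV. (cmod (char \<mu> (t * X i x)))\<^sup>2))"
          by (subst mult.commute) (intro ennreal_leI mult_right_mono prod_nonneg, auto)
        also have "\<dots> = w j * (indicator (I j) t * ?F x t)"
          unfolding F w_def using j by (simp add: ennreal_mult' I_def)
        also have "\<dots> = (\<Sum>k\<in>{j}. w k * (indicator (I k) t * ?F x t))" by simp
        also have "\<dots> \<le> (\<Sum>k. w k * (indicator (I k) t * ?F x t))" by (rule sum_le_suminf) auto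
        also have "\<dots> \<le> indicator {-1..1} t + \<dots>" by simp
        finally show ?thesis .
      qed
    qed
    also have "\<dots> = (\<integral>\<^sup>+t. indicator {-1..1::real} t \<partial>lborel) + (\<integral>\<^sup>+t. (\<Sum>j. w j * (indicator (I j) t * ?F x t)) \<partial>lborel)"
      by (rule nn_integral_add) measurable
    also have "(\<integral>\<^sup>+t. (\<Sum>j. w j * (indicator (I j) t * ?F x t)) \<partial>lborel) = (\<Sum>j. w j * G j x)"
      unfolding G_def by (subst nn_integral_suminf) (measurable, simp add: nn_integral_cmult)
    also have "(\<integral>\<^sup>+t. indicator {-1..1::real} t \<partial>lborel) = 2" by simp
    finally show ?thesis .
  qed
  \<comment> \<open>Block j contributes at most a multiple of 2 powr (- \<theta> * j), the weight 2
    powr (j * (s - 1)) included; the hypothesis on s says that \<theta> > 0.\<close>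
  define \<theta> where "\<theta> = 1 - s + \<beta> - CARD('n) * (1 - \<kappa>)"
  define q where "q = 2 powr - \<theta>"
  have q: "0 < q" "q < 1" using s powr_less_mono[of "- \<theta>" 0 2] by (auto simp: q_def \<theta>_def)
  have wG: "w j * (\<integral>\<^sup>+x. G j x \<partial>\<rho>) \<le> ennreal (A * q ^ j)" for j
  proof -
    have "w j * (\<integral>\<^sup>+x. G j x \<partial>\<rho>) \<le> w j * ennreal (A * (2 ^ j) powr (CARD('n) * (1 - \<kappa>) - \<beta>))"
      unfolding G_def I_def by (intro mult_left_mono A(2)) auto
    also have "\<dots> = ennreal (A * ((2 ^ j) powr (s - 1) * (2 ^ j) powr (CARD('n) * (1 - \<kappa>) - \<beta>)))"
      unfolding w_def by (subst ennreal_mult'[symmetric]) (simp_all add: mult_ac)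
    also have "(2 ^ j) powr (s - 1) * (2 ^ j) powr (CARD('n) * (1 - \<kappa>) - \<beta>) = (2 ^ j :: real) powr - \<theta>"
      by (subst powr_add[symmetric]) (simp add: \<theta>_def algebra_simps)
    also have "\<dots> = q ^ j" by (simp add: q_def powr_power powr_realpow[symmetric] powr_powr mult.commute)
    finally show ?thesis .
  qed
  have "(\<integral>\<^sup>+x. fourier_energy \<mu> s (\<lambda>i. X i x) \<partial>\<rho>) \<le> (\<integral>\<^sup>+x. 2 + (\<Sum>j. w j * G j x) \<partial>\<rho>)"
    by (intro nn_integral_mono le)
  also have "\<dots> = (\<integral>\<^sup>+x. 2 \<partial>\<rho>) + (\<integral>\<^sup>+x. (\<Sum>j. w j * G j x) \<partial>\<rho>)" by (rule nn_integral_add) measurable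
  also have "(\<integral>\<^sup>+x. (\<Sum>j. w j * G j x) \<partial>\<rho>) = (\<Sum>j. w j * (\<integral>\<^sup>+x. G j x \<partial>\<rho>))"
    by (subst nn_integral_suminf) (measurable, simp add: nn_integral_cmult)
  also have "\<dots> \<le> (\<Sum>j. ennreal (A * q ^ j))" by (intro suminf_le wG) auto
  also have "\<dots> = ennreal (\<Sum>j. A * q ^ j)"
    using A(1) q by (intro suminf_ennreal2 summable_mult summable_geometric) auto
  finally have "(\<integral>\<^sup>+x. fourier_energy \<mu> s (\<lambda>i. X i x) \<partial>\<rho>) \<le> (\<integral>\<^sup>+x. 2 \<partial>\<rho>) + ennreal (\<Sum>j. A * q ^ j)"
    by (simp add: add_left_mono)
  also have "\<dots> < \<infinity>" by (simp add: less_top[symmetric] ennreal_mult_eq_top_iff)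
  finally have "(\<integral>\<^sup>+x. fourier_energy \<mu> s (\<lambda>i. X i x) \<partial>\<rho>) \<noteq> \<infinity>" by simp
  then have "AE x in \<rho>. fourier_energy \<mu> s (\<lambda>i. X i x) \<noteq> \<infinity>"
    by (intro nn_integral_noteq_infinite) (simp_all add: fourier_energy_def)
  then show ?thesis by eventually_elim (simp add: less_top)
qed

end

section \<open>Gaussian bumps averaged over product and star-like measures\<close>

lemma nn_integral_gauss_bump: "(\<integral>\<^sup>+w. gauss_bump w \<partial>lborel) = ennreal (2 * sqrt pi)"
proof -
  interpret N: prob_space std_normal_distribution by (rule prob_space_normal_density) simp
  have g: "gauss_bump (0 + sqrt 2 * z) = ennreal (sqrt (2 * pi)) * ennreal (std_normal_density z)" for z
    unfolding gauss_bump_def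
    by (subst ennreal_mult'[symmetric]) (auto simp: std_normal_density_def power_mult_distrib)
  have "(\<integral>\<^sup>+w. gauss_bump w \<partial>lborel) = ennreal \<bar>sqrt 2\<bar> * (\<integral>\<^sup>+z. gauss_bump (0 + sqrt 2 * z) \<partial>lborel)"
    by (rule nn_integral_real_affine) auto
  also have "\<dots> = ennreal \<bar>sqrt 2\<bar> * (ennreal (sqrt (2 * pi)) * (\<integral>\<^sup>+z. ennreal (std_normal_density z) \<partial>lborel))"
    unfolding g by (subst nn_integral_cmult) auto
  also have "(\<integral>\<^sup>+z. ennreal (std_normal_density z) \<partial>lborel) = emeasure std_normal_distribution (space std_normal_distribution)"
    by (simp add: emeasure_density)
  also have "\<dots> = 1" by (rule N.emeasure_space_1)
  also have "ennreal \<bar>sqrt 2\<bar> * (ennreal (sqrt (2 * pi)) * 1) = ennreal (2 * sqrt pi)"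
    by (simp add: ennreal_mult'[symmetric] real_sqrt_mult)
  finally show ?thesis .
qed

text \<open>Substitution w = t * y - z. The factor 1 / b is the reason why one coordinate has to be
  kept away from 0.\<close>

lemma nn_integral_gauss_bump_line:
  assumes y: "b \<le> \<bar>y\<bar>" and b: "0 < b"
  shows "(\<integral>\<^sup>+t. gauss_bump (t * y - z) \<partial>lborel) \<le> ennreal (2 * sqrt pi / b)"
proof -
  have "ennreal (2 * sqrt pi) = ennreal \<bar>y\<bar> * (\<integral>\<^sup>+t. gauss_bump (- z + y * t) \<partial>lborel)"
    unfolding nn_integral_gauss_bump[symmetric]
    by (rule nn_integral_real_affine) (use y b in auto)
  also have "\<dots> \<ge> ennreal b * (\<integral>\<^sup>+t. gauss_bump (- z + y * t) \<partial>lborel)"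
    using y by (intro mult_right_mono ennreal_leI) auto
  finally have "ennreal (1 / b) * (ennreal b * (\<integral>\<^sup>+t. gauss_bump (- z + y * t) \<partial>lborel)) \<le> ennreal (1 / b) * ennreal (2 * sqrt pi)"
    by (rule mult_left_mono) simp
  then show ?thesis
    using b by (simp add: mult.assoc[symmetric] ennreal_mult'[symmetric] mult.commute)
qed

text \<open>Now t is fixed and y varies: t * y within O(1) of z places y within O(1 / R) of z /
  t.\<close>

lemma (in frostman_real) nn_integral_gauss_bump_le:
  assumes R: "0 < R" "R \<le> \<bar>t\<bar>"
  shows "(\<integral>\<^sup>+y. gauss_bump (t * y - z) \<partial>\<mu>) \<le> ennreal (C * gauss_const (1/4) \<kappa> * R powr - \<kappa>)"
proof -
  have "(\<integral>\<^sup>+y. gauss_bump (t * y - z) \<partial>\<mu>) = (\<integral>\<^sup>+y. ennreal (exp (- (1/4) * (R * (\<bar>t * y - z\<bar> / R))\<^sup>2)) \<partial>\<mu>)"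
    using R unfolding gauss_bump_def by simp
  also have "\<dots> \<le> ennreal (C * gauss_const (1/4) \<kappa> * R powr - \<kappa>)"
  proof (rule nn_integral_gauss_le)
    fix r :: real assume r: "0 < r"
    have "{y \<in> space \<mu>. \<bar>t * y - z\<bar> / R \<le> r} \<subseteq> cball (z / t) r"
    proof safe
      fix y assume "\<bar>t * y - z\<bar> / R \<le> r"
      then have "\<bar>t * y - z\<bar> \<le> r * R" using R by (simp add: field_simps)
      also have "\<dots> \<le> r * \<bar>t\<bar>" using R r by (intro mult_left_mono) auto
      finally have "\<bar>t * y - z\<bar> / \<bar>t\<bar> \<le> r" using R by (simp add: field_simps)
      also have "\<bar>t * y - z\<bar> / \<bar>t\<bar> = \<bar>z / t - y\<bar>"
        using R by (simp add: abs_divide[symmetric] diff_divide_distrib abs_minus_commute)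
      finally show "y \<in> cball (z / t) r" by (simp add: dist_real_def)
    qed
    then have "emeasure \<mu> {y \<in> space \<mu>. \<bar>t * y - z\<bar> / R \<le> r} \<le> emeasure \<mu> (cball (z / t) r)"
      by (intro emeasure_mono) (auto simp: sets_eq_borel)
    also have "\<dots> \<le> ennreal (C * r powr \<kappa>)"
      using ball[OF r, of "z / t"] by (simp add: emeasure_eq_measure ennreal_leI)
    finally show "emeasure \<mu> {y \<in> space \<mu>. \<bar>t * y - z\<bar> / R \<le> r} \<le> ennreal (C * r powr \<kappa>)" .
  qed (use R C in auto)
  finally show ?thesis .
qed

text \<open>By Tonelli the average over a is taken first, with t fixed: each coordinate other than
  i0 gains R powr - \<kappa>. The coordinate i0 is left aside and used to integrate over t, at the
  cost of a constant only.\<close>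

lemma (in frostman_real) bump_bound_product:
  fixes i0 :: "'n::finite"
  assumes b: "0 < b"
  obtains K where "0 \<le> K"
    "bump_bound (density (Pi\<^sub>M UNIV (\<lambda>_. \<mu>)) (indicator {a. b \<le> \<bar>a i0\<bar>})) (\<lambda>i a. a (i :: 'n)) K ((CARD('n) - 1) * \<kappa>)"
proof -
  let ?P = "Pi\<^sub>M (UNIV :: 'n set) (\<lambda>_. \<mu>)"
  define B where "B = {a :: 'n \<Rightarrow> real. b \<le> \<bar>a i0\<bar>}"
  have sp: "space \<mu> = UNIV" using sets_eq_imp_space_eq[OF sets_eq_borel] by simp
  have "{a \<in> space ?P. b \<le> \<bar>a i0\<bar>} \<in> sets ?P" by measurable
  then have [measurable]: "B \<in> sets ?P" by (simp add: B_def space_PiM sp)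
  interpret PL: pair_sigma_finite ?P "lborel :: real measure" ..
  interpret MuL: pair_sigma_finite \<mu> "lborel :: real measure" ..
  define k where "k = C * gauss_const (1/4) \<kappa>"
  have k: "0 \<le> k" using C gauss_const_nonneg[of "1/4" \<kappa>] by (simp add: k_def)
  define K where "K = k ^ (CARD('n) - 1) * (2 * sqrt pi / b)"
  show thesis
  proof (rule that[of K], unfold bump_bound_def, safe)
    show "0 \<le> K" using k b by (simp add: K_def)
    fix R :: real and \<zeta> :: "'n \<Rightarrow> real" assume R: "1 \<le> R"
    define I where "I = {t :: real. R \<le> \<bar>t\<bar> \<and> \<bar>t\<bar> < 2 * R}"
    have [measurable]: "I \<in> sets borel" unfolding I_def by measurable
    \<comment> \<open>The restriction to |a i0| >= b is moved into the factor of i0, so that the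
      integrand remains a product.\<close>
    define g where "g t i y = (if i = i0 then indicator {y. b \<le> \<bar>y\<bar>} y else 1) * gauss_bump (t * y - \<zeta> i)" for t i y
    have [measurable]: "(\<lambda>y. g t i y) \<in> borel_measurable borel" for t i
      unfolding g_def by (cases "i = i0") auto
    have gprod: "indicator B a * (\<Prod>i\<in>UNIV. gauss_bump (t * a i - \<zeta> i)) = (\<Prod>i\<in>UNIV. g t i (a i))" for a t
    proof -
      have "(\<Prod>i\<in>UNIV. if i = i0 then indicator {y. b \<le> \<bar>y\<bar>} (a i) else (1 :: ennreal)) = indicator B a"
        by (simp add: B_def indicator_def)
      then show ?thesis by (simp add: g_def prod.distrib)
    qed
    have "(\<integral>\<^sup>+a. (\<integral>\<^sup>+t. indicator I t * (\<Prod>i\<in>UNIV. gauss_bump (t * a i - \<zeta> i)) \<partial>lborel) \<partial>(density ?P (indicator B)))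
       = (\<integral>\<^sup>+a. indicator B a * (\<integral>\<^sup>+t. indicator I t * (\<Prod>i\<in>UNIV. gauss_bump (t * a i - \<zeta> i)) \<partial>lborel) \<partial>?P)"
      by (rule nn_integral_density) measurable
    also have "\<dots> = (\<integral>\<^sup>+a. (\<integral>\<^sup>+t. indicator B a * (indicator I t * (\<Prod>i\<in>UNIV. gauss_bump (t * a i - \<zeta> i))) \<partial>lborel) \<partial>?P)"
      by (intro nn_integral_cong nn_integral_cmult[symmetric]) measurable
    also have "\<dots> = (\<integral>\<^sup>+t. (\<integral>\<^sup>+a. indicator B a * (indicator I t * (\<Prod>i\<in>UNIV. gauss_bump (t * a i - \<zeta> i))) \<partial>?P) \<partial>lborel)"
      by (rule PL.Fubini'[symmetric]) measurable
    \<comment> \<open>The condition t \<in> I is used for the gains R powr - \<kappa> and then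
      dropped, since the remaining factor is integrable over the whole line.\<close>
    also have "\<dots> \<le> (\<integral>\<^sup>+t. (\<integral>\<^sup>+y. indicator {y. b \<le> \<bar>y\<bar>} y * gauss_bump (t * y - \<zeta> i0) \<partial>\<mu>) * ennreal ((k * R powr - \<kappa>) ^ (CARD('n) - 1)) \<partial>lborel)"
    proof (rule nn_integral_mono)
      fix t :: real
      show "(\<integral>\<^sup>+a. indicator B a * (indicator I t * (\<Prod>i\<in>UNIV. gauss_bump (t * a i - \<zeta> i))) \<partial>?P)
         \<le> (\<integral>\<^sup>+y. indicator {y. b \<le> \<bar>y\<bar>} y * gauss_bump (t * y - \<zeta> i0) \<partial>\<mu>) * ennreal ((k * R powr - \<kappa>) ^ (CARD('n) - 1))"
      proof (cases "t \<in> I")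
        case True
        have "(\<integral>\<^sup>+a. indicator B a * (indicator I t * (\<Prod>i\<in>UNIV. gauss_bump (t * a i - \<zeta> i))) \<partial>?P)
            = (\<integral>\<^sup>+a. (\<Prod>i\<in>UNIV. g t i (a i)) \<partial>?P)"
          using True by (simp add: gprod)
        also have "\<dots> = (\<Prod>i\<in>UNIV. \<integral>\<^sup>+y. g t i y \<partial>\<mu>)"
          by (rule prod.product_nn_integral_prod) auto
        also have "\<dots> = (\<integral>\<^sup>+y. g t i0 y \<partial>\<mu>) * (\<Prod>i\<in>UNIV - {i0}. \<integral>\<^sup>+y. g t i y \<partial>\<mu>)"
          by (rule prod.remove) auto
        also have "\<dots> \<le> (\<integral>\<^sup>+y. g t i0 y \<partial>\<mu>) * (\<Prod>i\<in>UNIV - {i0}. ennreal (k * R powr - \<kappa>))"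
        proof (intro mult_left_mono prod_mono_ennreal)
          fix i assume "i \<in> UNIV - {i0}"
          then have "(\<integral>\<^sup>+y. g t i y \<partial>\<mu>) = (\<integral>\<^sup>+y. gauss_bump (t * y - \<zeta> i) \<partial>\<mu>)" by (simp add: g_def)
          also have "\<dots> \<le> ennreal (k * R powr - \<kappa>)"
            unfolding k_def using True R by (intro nn_integral_gauss_bump_le) (auto simp: I_def)
          finally show "(\<integral>\<^sup>+y. g t i y \<partial>\<mu>) \<le> ennreal (k * R powr - \<kappa>)" .
        qed simp
        also have "\<dots> = (\<integral>\<^sup>+y. g t i0 y \<partial>\<mu>) * ennreal ((k * R powr - \<kappa>) ^ (CARD('n) - 1))"
          using k by (simp add: ennreal_power)
        finally show ?thesis by (simp add: g_def)
      qed simp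
    qed
    also have "\<dots> = (\<integral>\<^sup>+t. (\<integral>\<^sup>+y. indicator {y. b \<le> \<bar>y\<bar>} y * gauss_bump (t * y - \<zeta> i0) \<partial>\<mu>) \<partial>lborel) * ennreal ((k * R powr - \<kappa>) ^ (CARD('n) - 1))"
      by (rule nn_integral_multc) measurable
    also have "(\<integral>\<^sup>+t. (\<integral>\<^sup>+y. indicator {y. b \<le> \<bar>y\<bar>} y * gauss_bump (t * y - \<zeta> i0) \<partial>\<mu>) \<partial>lborel)
        = (\<integral>\<^sup>+y. (\<integral>\<^sup>+t. indicator {y. b \<le> \<bar>y\<bar>} y * gauss_bump (t * y - \<zeta> i0) \<partial>lborel) \<partial>\<mu>)"
      by (rule MuL.Fubini') measurable
    also have "\<dots> \<le> (\<integral>\<^sup>+y. ennreal (2 * sqrt pi / b) \<partial>\<mu>)"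
      by (intro nn_integral_mono) (auto simp: indicator_def nn_integral_gauss_bump_line[OF _ b])
    also have "\<dots> = ennreal (2 * sqrt pi / b)" by (simp add: emeasure_space_1)
    also have "ennreal (2 * sqrt pi / b) * ennreal ((k * R powr - \<kappa>) ^ (CARD('n) - 1))
        = ennreal ((2 * sqrt pi / b) * (k * R powr - \<kappa>) ^ (CARD('n) - 1))"
      using b k by (intro ennreal_mult[symmetric]) auto
    also have "(2 * sqrt pi / b) * (k * R powr - \<kappa>) ^ (CARD('n) - 1) = K * (R powr - \<kappa>) ^ (CARD('n) - 1)"
      by (simp add: K_def power_mult_distrib)
    also have "(R powr - \<kappa>) ^ (CARD('n) - 1) = R powr - ((CARD('n) - 1) * \<kappa>)"
      using R by (simp add: powr_power mult.commute)
    finally show "(\<integral>\<^sup>+a. (\<integral>\<^sup>+t. indicator {t. R \<le> \<bar>t\<bar> \<and> \<bar>t\<bar> < 2 * R} t * (\<Prod>i\<in>UNIV. gauss_bump (t * a i - \<zeta> i)) \<partial>lborel)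
          \<partial>(density ?P (indicator {a. b \<le> \<bar>a i0\<bar>}))) \<le> ennreal (K * R powr - ((CARD('n) - 1) * \<kappa>))"
      unfolding I_def B_def by (simp add: mult_right_mono)
  qed
qed

text \<open>The product of bumps is a Gaussian in N = |t x - v|, used twice with half of the
  exponent. Since v / t lies on the line spanned by v, N dominates R times the distance of x from
  that line, which the tube bound handles; N also dominates the coordinate i0, which allows
  integration over t. Halving the exponent explains the factors sqrt 2 and 1/8.\<close>

lemma bump_bound_tube:
  fixes \<rho> :: "(real ^ 'n) measure" and i0 :: 'n
  assumes sets [measurable_cong]: "sets \<rho> = sets borel" and fin: "finite_measure \<rho>"
    and b: "0 < b" and T: "0 \<le> T"
    and tube: "\<And>v r. 0 < r \<Longrightarrow> emeasure \<rho> {x. infdist x (range (\<lambda>\<tau>. \<tau> *\<^sub>R v)) \<le> r} \<le> ennreal (T * r powr \<beta>)"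
  obtains K where "0 \<le> K"
    "bump_bound (density \<rho> (indicator {x. b \<le> \<bar>x $ i0\<bar>})) (\<lambda>i x. x $ i) K \<beta>"
proof -
  interpret finite_measure \<rho> by fact
  have sp: "space \<rho> = UNIV" using sets_eq_imp_space_eq[OF sets] by simp
  define B where "B = {x :: real ^ 'n. b \<le> \<bar>x $ i0\<bar>}"
  have "closed B" unfolding B_def by (intro closed_Collect_le continuous_intros)
  then have [measurable]: "B \<in> sets borel" by simp
  have comp [measurable]: "(\<lambda>x :: real ^ 'n. x $ i) \<in> borel_measurable borel" for i
    by (intro borel_measurable_continuous_onI continuous_intros)
  define G where "G = 2 * sqrt pi / (b / sqrt 2)"
  have G: "0 \<le> G" using b by (simp add: G_def)
  define K where "K = G * (T * gauss_const (1/8) \<beta>)"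
  show thesis
  proof (rule that[of K], unfold bump_bound_def, safe)
    show "0 \<le> K" using G T gauss_const_nonneg[of "1/8" \<beta>] by (simp add: K_def)
    fix R :: real and \<zeta> :: "'n \<Rightarrow> real" assume R: "1 \<le> R"
    define I where "I = {t :: real. R \<le> \<bar>t\<bar> \<and> \<bar>t\<bar> < 2 * R}"
    have [measurable]: "I \<in> sets borel" unfolding I_def by measurable
    define v where "v = (\<chi> i. \<zeta> i)"
    define d where "d x = infdist x (range (\<lambda>\<tau>. \<tau> *\<^sub>R v))" for x
    have [measurable]: "d \<in> borel_measurable borel"
      unfolding d_def by (intro borel_measurable_continuous_onI continuous_on_infdist continuous_on_id)
    have pt: "indicator I t * (\<Prod>i\<in>UNIV. gauss_bump (t * x $ i - \<zeta> i))
        \<le> ennreal (exp (- (1/8) * (R * d x)\<^sup>2)) * gauss_bump (t * (x $ i0 / sqrt 2) - \<zeta> i0 / sqrt 2)" for x t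
    proof (cases "t \<in> I")
      case True
      then have t: "R \<le> \<bar>t\<bar>" by (simp add: I_def)
      define N where "N = norm (t *\<^sub>R x - v)"
      have "(\<Prod>i\<in>UNIV. gauss_bump (t * x $ i - \<zeta> i)) = ennreal (\<Prod>i\<in>UNIV. exp (- (t * x $ i - \<zeta> i)\<^sup>2 / 4))"
        unfolding gauss_bump_def by (simp add: prod_ennreal)
      also have "(\<Prod>i\<in>UNIV. exp (- (t * x $ i - \<zeta> i)\<^sup>2 / 4)) = exp (- N\<^sup>2 / 4)"
        unfolding N_def norm_vec_def L2_set_def
        by (simp add: exp_sum[symmetric] v_def sum_nonneg sum_divide_distrib sum_negf)
      also have "- N\<^sup>2 / 4 \<le> - (1/8) * (R * d x)\<^sup>2 + - (t * (x $ i0 / sqrt 2) - \<zeta> i0 / sqrt 2)\<^sup>2 / 4"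
      proof -
        have "d x \<le> dist x ((1 / t) *\<^sub>R v)" unfolding d_def by (rule infdist_le) auto
        also have "x - (1 / t) *\<^sub>R v = (1 / t) *\<^sub>R (t *\<^sub>R x - v)"
          using t R by (simp add: scaleR_diff_right)
        then have "dist x ((1 / t) *\<^sub>R v) = N / \<bar>t\<bar>" by (simp add: dist_norm N_def)
        finally have "\<bar>t\<bar> * d x \<le> N" using t R by (simp add: field_simps)
        moreover have "R * d x \<le> \<bar>t\<bar> * d x" using t by (intro mult_right_mono) (simp_all add: d_def infdist_nonneg)
        ultimately have 1: "(R * d x)\<^sup>2 \<le> N\<^sup>2" using R by (intro power_mono) (simp_all add: d_def infdist_nonneg)
        have "\<bar>(t *\<^sub>R x - v) $ i0\<bar> \<le> N" unfolding N_def by (rule component_le_norm_cart)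
        then have "\<bar>t * x $ i0 - \<zeta> i0\<bar>\<^sup>2 \<le> N\<^sup>2" by (intro power_mono) (simp_all add: v_def)
        then have 2: "(t * x $ i0 - \<zeta> i0)\<^sup>2 \<le> N\<^sup>2" by simp
        have "(t * (x $ i0 / sqrt 2) - \<zeta> i0 / sqrt 2)\<^sup>2 = ((t * x $ i0 - \<zeta> i0) / sqrt 2)\<^sup>2"
          by (simp add: diff_divide_distrib)
        also have "\<dots> = (t * x $ i0 - \<zeta> i0)\<^sup>2 / 2" by (simp add: power_divide)
        finally show ?thesis using 1 2 by simp
      qed
      then have "ennreal (exp (- N\<^sup>2 / 4))
          \<le> ennreal (exp (- (1/8) * (R * d x)\<^sup>2 + - (t * (x $ i0 / sqrt 2) - \<zeta> i0 / sqrt 2)\<^sup>2 / 4))"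
        by (intro ennreal_leI) (simp only: exp_le_cancel_iff)
      also have "\<dots> = ennreal (exp (- (1/8) * (R * d x)\<^sup>2)) * gauss_bump (t * (x $ i0 / sqrt 2) - \<zeta> i0 / sqrt 2)"
        unfolding gauss_bump_def exp_add by (rule ennreal_mult') simp
      finally show ?thesis using True by simp
    qed simp
    have "(\<integral>\<^sup>+x. (\<integral>\<^sup>+t. indicator I t * (\<Prod>i\<in>UNIV. gauss_bump (t * x $ i - \<zeta> i)) \<partial>lborel) \<partial>(density \<rho> (indicator B)))
       = (\<integral>\<^sup>+x. indicator B x * (\<integral>\<^sup>+t. indicator I t * (\<Prod>i\<in>UNIV. gauss_bump (t * x $ i - \<zeta> i)) \<partial>lborel) \<partial>\<rho>)"
      by (rule nn_integral_density) measurable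
    also have "\<dots> \<le> (\<integral>\<^sup>+x. ennreal G * ennreal (exp (- (1/8) * (R * d x)\<^sup>2)) \<partial>\<rho>)"
    proof (rule nn_integral_mono)
      fix x
      show "indicator B x * (\<integral>\<^sup>+t. indicator I t * (\<Prod>i\<in>UNIV. gauss_bump (t * x $ i - \<zeta> i)) \<partial>lborel)
          \<le> ennreal G * ennreal (exp (- (1/8) * (R * d x)\<^sup>2))"
      proof (cases "x \<in> B")
        case True
        have "(\<integral>\<^sup>+t. indicator I t * (\<Prod>i\<in>UNIV. gauss_bump (t * x $ i - \<zeta> i)) \<partial>lborel)
            \<le> (\<integral>\<^sup>+t. ennreal (exp (- (1/8) * (R * d x)\<^sup>2)) * gauss_bump (t * (x $ i0 / sqrt 2) - \<zeta> i0 / sqrt 2) \<partial>lborel)"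
          by (intro nn_integral_mono pt)
        also have "\<dots> = ennreal (exp (- (1/8) * (R * d x)\<^sup>2)) * (\<integral>\<^sup>+t. gauss_bump (t * (x $ i0 / sqrt 2) - \<zeta> i0 / sqrt 2) \<partial>lborel)"
          by (rule nn_integral_cmult) measurable
        also have "\<dots> \<le> ennreal (exp (- (1/8) * (R * d x)\<^sup>2)) * ennreal G"
          unfolding G_def using True b
          by (intro mult_left_mono nn_integral_gauss_bump_line) (auto simp: B_def abs_divide divide_right_mono)
        finally show ?thesis using True by (simp add: mult.commute)
      qed simp
    qed
    also have "\<dots> = ennreal G * (\<integral>\<^sup>+x. ennreal (exp (- (1/8) * (R * d x)\<^sup>2)) \<partial>\<rho>)"
      by (rule nn_integral_cmult) measurable
    also have "\<dots> \<le> ennreal G * ennreal (T * gauss_const (1/8) \<beta> * R powr - \<beta>)"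
    proof (intro mult_left_mono nn_integral_gauss_le)
      show "emeasure \<rho> {x \<in> space \<rho>. d x \<le> r} \<le> ennreal (T * r powr \<beta>)" if "0 < r" for r
        using tube[OF that, of v] by (simp add: sp d_def)
      show "d \<in> borel_measurable \<rho>" by measurable
    qed (use R T in \<open>auto simp: d_def infdist_nonneg\<close>)
    also have "\<dots> = ennreal (K * R powr - \<beta>)"
      using G by (simp add: K_def ennreal_mult'[symmetric] mult.assoc)
    finally show "(\<integral>\<^sup>+x. (\<integral>\<^sup>+t. indicator {t. R \<le> \<bar>t\<bar> \<and> \<bar>t\<bar> < 2 * R} t * (\<Prod>i\<in>UNIV. gauss_bump (t * x $ i - \<zeta> i)) \<partial>lborel)
          \<partial>(density \<rho> (indicator {x. b \<le> \<bar>x $ i0\<bar>}))) \<le> ennreal (K * R powr - \<beta>)"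
      unfolding I_def B_def .
  qed
qed

lemma star_like_tube_bound:
  fixes \<rho> :: "'a::euclidean_space measure"
  assumes star: "star_like F" and fr: "frostman_measure \<rho> F" and \<beta>: "0 \<le> \<beta>" "\<beta> < hausdorff_dim F"
  obtains T where "0 \<le> T"
    "\<And>v r. 0 < r \<Longrightarrow> emeasure \<rho> {x. infdist x (range (\<lambda>\<tau>. \<tau> *\<^sub>R v)) \<le> r} \<le> ennreal (T * r powr \<beta>)"
proof -
  interpret prob_space \<rho> using fr by (rule frostman_measureD)
  have sets [measurable_cong]: "sets \<rho> = sets borel" using fr by (rule frostman_measureD)
  have F: "AE x in \<rho>. x \<in> F" using fr by (rule frostman_measureD)
  obtain C where C: "0 \<le> C" "\<forall>x r. 0 < r \<longrightarrow> measure \<rho> (cball x r) \<le> C * r powr \<beta>"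
    using frostman_cball[OF fr \<beta>(2,1)] by blast
  obtain M :: nat where M: "\<forall>\<delta>>0. \<forall>p v. v \<noteq> 0 \<and> 0 \<in> tube p v \<delta> \<longrightarrow>
      (\<exists>X. finite X \<and> card X \<le> M \<and> F \<inter> tube p v \<delta> \<subseteq> (\<Union>x\<in>X. ball x \<delta>))"
    using star unfolding star_like_def by (elim exE)
  \<comment> \<open>The first summand counts M balls of radius 2 * r, as a tube of radius r has
    width 2 * r. The second covers v = 0, where the line degenerates to a point and the tube to a
    ball; this occurs because v will be an arbitrary frequency.\<close>
  define T where "T = real M * C * 2 powr \<beta> + C"
  show thesis
  proof (rule that[of T])
    show "0 \<le> T" using C by (simp add: T_def)
    fix v :: 'a and r :: real assume r: "0 < r"
    have "measure \<rho> {x. infdist x (range (\<lambda>\<tau>. \<tau> *\<^sub>R v)) \<le> r} \<le> T * r powr \<beta>"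
    proof (cases "v = 0")
      case True
      then have "{x. infdist x (range (\<lambda>\<tau>. \<tau> *\<^sub>R v)) \<le> r} = cball 0 r"
        by (auto simp: infdist_singleton dist_commute simp del: dist_0_norm)
      also have "measure \<rho> \<dots> \<le> C * r powr \<beta>" using C(2) r by blast
      also have "\<dots> \<le> T * r powr \<beta>" using C by (intro mult_right_mono) (auto simp: T_def)
      finally show ?thesis .
    next
      case False
      have tb: "tube 0 v (2 * r) = {x. infdist x (range (\<lambda>\<tau>. \<tau> *\<^sub>R v)) \<le> r}" by (simp add: tube_def)
      have "0 \<in> range (\<lambda>\<tau>. \<tau> *\<^sub>R v)" by (auto intro!: image_eqI[of _ _ 0])
      then have "0 \<in> tube 0 v (2 * r)" using r by (simp add: tb)
      then obtain X where X: "finite X" "card X \<le> M" "F \<inter> tube 0 v (2 * r) \<subseteq> (\<Union>x\<in>X. ball x (2 * r))"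
        using M[rule_format, of "2 * r" v 0] r False by auto
      have "measure \<rho> {x. infdist x (range (\<lambda>\<tau>. \<tau> *\<^sub>R v)) \<le> r} \<le> measure \<rho> (\<Union>x\<in>X. ball x (2 * r))"
      proof (rule finite_measure_mono_AE)
        show "AE x in \<rho>. x \<in> {x. infdist x (range (\<lambda>\<tau>. \<tau> *\<^sub>R v)) \<le> r} \<longrightarrow> x \<in> (\<Union>x\<in>X. ball x (2 * r))"
          using F by eventually_elim (use X(3) tb in blast)
        show "(\<Union>x\<in>X. ball x (2 * r)) \<in> sets \<rho>"
          unfolding sets by (intro borel_open open_UN) auto
      qed
      also have "\<dots> \<le> (\<Sum>x\<in>X. measure \<rho> (ball x (2 * r)))"
        using X(1) by (intro finite_measure_subadditive_finite) (auto simp: sets)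
      also have "\<dots> \<le> (\<Sum>x\<in>X. C * (2 * r) powr \<beta>)"
      proof (rule sum_mono)
        fix x
        have "measure \<rho> (ball x (2 * r)) \<le> measure \<rho> (cball x (2 * r))"
          by (intro finite_measure_mono) (auto simp: sets)
        also have "\<dots> \<le> C * (2 * r) powr \<beta>" using C(2) r by simp
        finally show "measure \<rho> (ball x (2 * r)) \<le> C * (2 * r) powr \<beta>" .
      qed
      also have "\<dots> = real (card X) * (C * (2 * r) powr \<beta>)" by simp
      also have "\<dots> \<le> real M * (C * (2 * r) powr \<beta>)" using X(2) C by (intro mult_right_mono) auto
      also have "\<dots> = real M * C * 2 powr \<beta> * r powr \<beta>" using r by (simp add: powr_mult)
      also have "\<dots> \<le> T * r powr \<beta>" using C by (intro mult_right_mono) (auto simp: T_def)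
      finally show ?thesis .
    qed
    then show "emeasure \<rho> {x. infdist x (range (\<lambda>\<tau>. \<tau> *\<^sub>R v)) \<le> r} \<le> ennreal (T * r powr \<beta>)"
      by (simp add: emeasure_eq_measure ennreal_leI)
  qed
qed

section \<open>Measures with Fourier decay\<close>

text \<open>A dyadic majorant of \<open>\<bar>u\<bar> powr (- 1/2)\<close>; it is infinite at \<open>0\<close>.\<close>

definition riesz_half :: "real \<Rightarrow> ennreal" where
  "riesz_half u = 1 + (\<Sum>k. ennreal (sqrt (2 * 2 ^ k)) * indicator {u. \<bar>u\<bar> \<le> 1 / 2 ^ k} u)"

lemma measurable_riesz_half [measurable]: "riesz_half \<in> borel_measurable borel"
  unfolding riesz_half_def by measurable

lemma riesz_half_ge_1: "1 \<le> riesz_half u"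
  by (simp add: riesz_half_def)

text \<open>Together with \<open>riesz_half_ge_1\<close> this makes a product of two such kernels
  infinite as soon as one difference vanishes, so the estimate of line integrals is trivial
  there.\<close>

lemma riesz_half_0: "riesz_half 0 = \<infinity>"
proof (rule ccontr)
  assume "riesz_half 0 \<noteq> \<infinity>"
  then obtain r where r: "0 \<le> r" "riesz_half 0 = ennreal r" by (cases "riesz_half 0") auto
  obtain N :: nat where N: "r < real N" using reals_Archimedean2 by blast
  have "ennreal (real N) = (\<Sum>k<N. 1)" by (simp add: ennreal_of_nat_eq_real_of_nat)
  also have "\<dots> \<le> (\<Sum>k<N. ennreal (sqrt (2 * 2 ^ k)) * indicator {u. \<bar>u\<bar> \<le> 1 / 2 ^ k} (0 :: real))"
  proof (rule sum_mono)
    fix k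
    have "(1::real) \<le> 2 ^ k" by simp
    then have "1 \<le> sqrt (2 * 2 ^ k)" by (simp only: real_sqrt_ge_1_iff)
    then have "ennreal 1 \<le> ennreal (sqrt (2 * 2 ^ k))" by (rule ennreal_leI)
    then show "(1 :: ennreal) \<le> ennreal (sqrt (2 * 2 ^ k)) * indicator {u :: real. \<bar>u\<bar> \<le> 1 / 2 ^ k} 0"
      by simp
  qed
  also have "\<dots> \<le> (\<Sum>k. ennreal (sqrt (2 * 2 ^ k)) * indicator {u. \<bar>u\<bar> \<le> 1 / 2 ^ k} (0 :: real))"
    by (rule sum_le_suminf) auto
  also have "\<dots> \<le> riesz_half 0" by (simp add: riesz_half_def)
  finally show False using r N by (simp add: ennreal_le_iff)
qed

lemma riesz_half_ge:
  assumes "u \<noteq> 0"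
  shows "ennreal (1 / sqrt \<bar>u\<bar>) \<le> riesz_half u"
proof (cases "\<bar>u\<bar> \<le> 1")
  case False
  then have "ennreal (1 / sqrt \<bar>u\<bar>) \<le> 1" by (simp add: ennreal_le_1)
  then show ?thesis using riesz_half_ge_1 order_trans by blast
next
  case True
  then have "1 \<le> 1 / \<bar>u\<bar>" using assms by simp
  then obtain j :: nat where j: "2 ^ j \<le> 1 / \<bar>u\<bar>" "1 / \<bar>u\<bar> < 2 * 2 ^ j"
    using real_dyadic_ivl by blast
  have "1 / sqrt \<bar>u\<bar> = sqrt (1 / \<bar>u\<bar>)" by (simp add: real_sqrt_divide)
  also have "\<dots> \<le> sqrt (2 * 2 ^ j)" using j(2) by simp
  finally have le: "1 / sqrt \<bar>u\<bar> \<le> sqrt (2 * 2 ^ j)" .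
  define c where "c k = ennreal (sqrt (2 * 2 ^ k)) * indicator {u. \<bar>u\<bar> \<le> 1 / 2 ^ k} u" for k :: nat
  have "ennreal (1 / sqrt \<bar>u\<bar>) \<le> c j"
    using j(1) le assms by (simp add: c_def field_simps ennreal_leI)
  also have "\<dots> = (\<Sum>k\<in>{j}. c k)" by simp
  also have "\<dots> \<le> (\<Sum>k. c k)" by (rule sum_le_suminf) auto
  also have "\<dots> \<le> riesz_half u" by (simp add: riesz_half_def c_def)
  finally show ?thesis .
qed

text \<open>Term k contributes a multiple of 2^(k/2) * 2^(-\<kappa> k), a convergent geometric
  series since \<kappa> > 1/2. The form 1 <= L lets the same constant bound coordinates that carry
  the factor 1.\<close>

lemma (in frostman_real) riesz_half_bound:
  assumes "1 / 2 < \<kappa>"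
  obtains L where "1 \<le> L" "\<And>z. (\<integral>\<^sup>+y. riesz_half (z - y) \<partial>\<mu>) \<le> ennreal L"
proof -
  define q where "q = 2 powr (1 / 2 - \<kappa>)"
  have q: "0 < q" "q < 1" using assms powr_less_mono[of "1 / 2 - \<kappa>" 0 2] by (auto simp: q_def)
  define L where "L = 1 + (\<Sum>k. C * sqrt 2 * q ^ k)"
  have sm: "summable (\<lambda>k. C * sqrt 2 * q ^ k)" using q by (intro summable_mult summable_geometric) auto
  have sn: "0 \<le> (\<Sum>k. C * sqrt 2 * q ^ k)" using sm q C by (intro suminf_nonneg) auto
  show thesis
  proof (rule that[of L])
    show "1 \<le> L" using sn by (simp add: L_def)
    fix z
    have [measurable]: "(\<lambda>y. indicator (cball z r) y :: ennreal) \<in> borel_measurable \<mu>" for r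
      by (intro borel_measurable_indicator) (simp add: sets_eq_borel)
    have "(\<integral>\<^sup>+y. riesz_half (z - y) \<partial>\<mu>)
        = (\<integral>\<^sup>+y. 1 + (\<Sum>k. ennreal (sqrt (2 * 2 ^ k)) * indicator (cball z (1 / 2 ^ k)) y) \<partial>\<mu>)"
      by (intro nn_integral_cong) (simp add: riesz_half_def indicator_def dist_real_def)
    also have "\<dots> = (\<integral>\<^sup>+y. 1 \<partial>\<mu>) + (\<integral>\<^sup>+y. (\<Sum>k. ennreal (sqrt (2 * 2 ^ k)) * indicator (cball z (1 / 2 ^ k)) y) \<partial>\<mu>)"
      by (rule nn_integral_add) measurable
    also have "(\<integral>\<^sup>+y. 1 \<partial>\<mu>) = 1" by (simp add: emeasure_space_1)
    also have "(\<integral>\<^sup>+y. (\<Sum>k. ennreal (sqrt (2 * 2 ^ k)) * indicator (cball z (1 / 2 ^ k)) y) \<partial>\<mu>)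
        = (\<Sum>k. \<integral>\<^sup>+y. ennreal (sqrt (2 * 2 ^ k)) * indicator (cball z (1 / 2 ^ k)) y \<partial>\<mu>)"
      by (rule nn_integral_suminf) measurable
    also have "\<dots> = (\<Sum>k. ennreal (sqrt (2 * 2 ^ k)) * emeasure \<mu> (cball z (1 / 2 ^ k)))"
      by (intro suminf_cong nn_integral_cmult_indicator) (simp add: sets_eq_borel)
    also have "1 + (\<Sum>k. ennreal (sqrt (2 * 2 ^ k)) * emeasure \<mu> (cball z (1 / 2 ^ k)))
        \<le> 1 + (\<Sum>k. ennreal (C * sqrt 2 * q ^ k))"
    proof (intro add_left_mono suminf_le)
      fix k :: nat
      have "ennreal (sqrt (2 * 2 ^ k)) * emeasure \<mu> (cball z (1 / 2 ^ k))
          \<le> ennreal (sqrt (2 * 2 ^ k)) * ennreal (C * (1 / 2 ^ k) powr \<kappa>)"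
        using ball[of "1 / 2 ^ k" z] by (intro mult_left_mono) (auto simp: emeasure_eq_measure ennreal_leI)
      also have "\<dots> = ennreal (C * sqrt 2 * (sqrt (2 ^ k) * (1 / 2 ^ k) powr \<kappa>))"
        by (subst ennreal_mult'[symmetric]) (simp_all add: real_sqrt_mult mult_ac)
      also have "sqrt (2 ^ k) * (1 / 2 ^ k) powr \<kappa> = q ^ k"
      proof -
        have "sqrt (2 ^ k) = (2 ^ k) powr (1 / 2)" by (simp add: powr_half_sqrt)
        moreover have "(1 / 2 ^ k) powr \<kappa> = (2 ^ k :: real) powr - \<kappa>" by (simp add: powr_divide powr_minus_divide)
        ultimately have "sqrt (2 ^ k) * (1 / 2 ^ k) powr \<kappa> = (2 ^ k) powr (1 / 2 - \<kappa>)"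
          by (simp flip: powr_add)
        also have "\<dots> = q ^ k" by (simp add: q_def powr_power powr_realpow[symmetric] powr_powr mult.commute)
        finally show ?thesis .
      qed
      finally show "ennreal (sqrt (2 * 2 ^ k)) * emeasure \<mu> (cball z (1 / 2 ^ k)) \<le> ennreal (C * sqrt 2 * q ^ k)" .
    qed auto
    also have "(\<Sum>k. ennreal (C * sqrt 2 * q ^ k)) = ennreal (\<Sum>k. C * sqrt 2 * q ^ k)"
      using sm q C by (intro suminf_ennreal2) auto
    also have "1 + ennreal (\<Sum>k. C * sqrt 2 * q ^ k) = ennreal L"
      using sn by (simp add: L_def ennreal_plus)
    finally show "(\<integral>\<^sup>+y. riesz_half (z - y) \<partial>\<mu>) \<le> ennreal L" .
  qed
qed

section \<open>Line integrals of a decaying Fourier transform\<close>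

lemma cmod_fourier_transform_le:
  assumes "finite_measure \<rho>"
  shows "cmod (fourier_transform \<rho> \<xi>) \<le> measure \<rho> (space \<rho>)"
proof -
  interpret finite_measure \<rho> by fact
  have "cmod (fourier_transform \<rho> \<xi>) \<le> (\<integral>x. cmod (cis (- 2 * pi * (x \<bullet> \<xi>))) \<partial>\<rho>)"
    unfolding fourier_transform_def by (rule integral_norm_bound)
  also have "\<dots> = measure \<rho> (space \<rho>)" by simp
  finally show ?thesis .
qed

lemma fourier_decay_line_integral:
  fixes \<rho> :: "'a::euclidean_space measure"
  assumes fin: "finite_measure \<rho>" and \<gamma>: "1 < \<gamma>" and dec: "fourier_decay \<rho> \<gamma>"
  obtains A where "0 < A"
    "\<And>w. w \<noteq> 0 \<Longrightarrow> (\<integral>\<^sup>+t. ennreal (cmod (fourier_transform \<rho> (t *\<^sub>R w))) \<partial>lborel) \<le> ennreal (A / norm w)"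
proof -
  \<comment> \<open>Half of the excess \<gamma> - 1 is given up as \<eta>; the exponent left is -
    (\<gamma> + 1) / 2, still below -1 and hence integrable at infinity.\<close>
  define e where "e = (\<gamma> - 1) / 2 - \<gamma>"
  have e: "e < - 1" using \<gamma> by (simp add: e_def field_simps)
  have "0 < (\<gamma> - 1) / 2" using \<gamma> by simp
  then obtain C where C: "0 < C" "\<forall>\<^sub>F \<xi> in at_infinity. cmod (fourier_transform \<rho> \<xi>) \<le> C * norm \<xi> powr e"
    using dec unfolding fourier_decay_def e_def by blast
  then obtain b0 where b0: "\<forall>\<xi>. b0 \<le> norm \<xi> \<longrightarrow> cmod (fourier_transform \<rho> \<xi>) \<le> C * norm \<xi> powr e"
    unfolding eventually_at_infinity by blast
  define b where "b = max b0 1"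
  have b: "1 \<le> b" by (simp add: b_def)
  define m where "m = measure \<rho> (space \<rho>)"
  define f where "f t = ennreal (if t \<in> {b..} then t powr e else 0)" for t :: real
  have [measurable]: "f \<in> borel_measurable borel" unfolding f_def by measurable
  \<comment> \<open>A majorant depending only on the length of the frequency: total mass up to b,
    where the decay says nothing, and a power tail on both sides beyond. Along t * w it is g (|w| *
    t), so rescaling produces the factor 1 / |w|.\<close>
  define g where "g t = ennreal m * indicator {-b..b} t + ennreal C * (f t + f (- t))" for t
  have [measurable]: "g \<in> borel_measurable borel" unfolding g_def by measurable
  have bound: "ennreal (cmod (fourier_transform \<rho> \<xi>)) \<le> g r" if r: "\<bar>r\<bar> = norm \<xi>" for \<xi> r
  proof (cases "\<bar>r\<bar> \<le> b")
    case True
    then have "ennreal (cmod (fourier_transform \<rho> \<xi>)) \<le> ennreal m * indicator {-b..b} r"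
      using cmod_fourier_transform_le[OF fin, of \<xi>] by (auto simp: m_def indicator_def intro: ennreal_leI)
    also have "\<dots> \<le> g r" by (simp add: g_def)
    finally show ?thesis .
  next
    case False
    then have "cmod (fourier_transform \<rho> \<xi>) \<le> C * \<bar>r\<bar> powr e"
      using b0 r by (simp add: b_def)
    then have "ennreal (cmod (fourier_transform \<rho> \<xi>)) \<le> ennreal C * ennreal (\<bar>r\<bar> powr e)"
      using C(1) by (simp add: ennreal_mult'[symmetric] ennreal_leI)
    also have "\<dots> \<le> ennreal C * (f r + f (- r))"
      using False b by (intro mult_left_mono) (auto simp: f_def indicator_def abs_if split: if_splits)
    also have "\<dots> \<le> g r" by (simp add: g_def)
    finally show ?thesis .
  qed
  define J where "J = - (b powr (e + 1)) / (e + 1)"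
  have "((\<lambda>t. t powr e) has_integral J) {b..}"
    unfolding J_def using e b by (intro has_integral_powr_to_inf) auto
  then have "((\<lambda>t. if t \<in> {b..} then t powr e else 0) has_integral J) UNIV"
    by (simp only: has_integral_restrict_UNIV)
  moreover have "(\<lambda>t. if t \<in> {b..} then t powr e else 0) \<in> borel_measurable borel" by measurable
  ultimately have fJ: "(\<integral>\<^sup>+t. f t \<partial>lborel) = ennreal J"
    unfolding f_def by (intro nn_integral_has_integral_lborel) simp_all
  have J: "0 \<le> J" using e by (simp add: J_def divide_nonneg_neg divide_nonpos_neg)
  have fJ': "(\<integral>\<^sup>+t. f (- t) \<partial>lborel) = ennreal J"
    using nn_integral_real_affine[of f "-1" 0] fJ by simp
  define A where "A = m * (2 * b) + C * (J + J) + 1"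
  have m: "0 \<le> m" by (simp add: m_def)
  have "(\<integral>\<^sup>+t. g t \<partial>lborel) = ennreal m * ennreal (2 * b) + ennreal C * (ennreal J + ennreal J)"
    unfolding g_def using b
    by (subst nn_integral_add, simp, simp) (simp add: nn_integral_cmult nn_integral_add nn_integral_cmult_indicator fJ fJ')
  also have "\<dots> \<le> ennreal A"
    using m b C(1) J by (simp add: A_def ennreal_mult'[symmetric] ennreal_plus[symmetric] ennreal_leI del: ennreal_plus)
  finally have gA: "(\<integral>\<^sup>+t. g t \<partial>lborel) \<le> ennreal A" .
  show thesis
  proof (rule that[of A])
    have "0 \<le> m * (2 * b)" "0 \<le> C * (J + J)" using m b C(1) J by auto
    then show "0 < A" unfolding A_def by linarith
    fix w :: 'a assume w: "w \<noteq> 0"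
    have "(\<integral>\<^sup>+t. ennreal (cmod (fourier_transform \<rho> (t *\<^sub>R w))) \<partial>lborel) \<le> (\<integral>\<^sup>+t. g (0 + norm w * t) \<partial>lborel)"
      by (intro nn_integral_mono bound) (simp add: abs_mult)
    also have "\<dots> = ennreal (1 / norm w) * (ennreal \<bar>norm w\<bar> * (\<integral>\<^sup>+t. g (0 + norm w * t) \<partial>lborel))"
      using w by (simp add: mult.assoc[symmetric] ennreal_mult'[symmetric])
    also have "ennreal \<bar>norm w\<bar> * (\<integral>\<^sup>+t. g (0 + norm w * t) \<partial>lborel) = (\<integral>\<^sup>+t. g t \<partial>lborel)"
      by (rule nn_integral_real_affine[symmetric]) (use w in auto)
    also have "ennreal (1 / norm w) * (\<integral>\<^sup>+t. g t \<partial>lborel) \<le> ennreal (1 / norm w) * ennreal A"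
      by (intro mult_left_mono gA) simp
    also have "\<dots> = ennreal (A / norm w)" by (simp add: ennreal_mult'[symmetric])
    finally show "(\<integral>\<^sup>+t. ennreal (cmod (fourier_transform \<rho> (t *\<^sub>R w))) \<partial>lborel) \<le> ennreal (A / norm w)" .
  qed
qed

text \<open>The modulus is taken after averaging over x, where the decay of \<open>\<rho>\<close> is
  visible, but before integrating over t, so that Tonelli exchanges the integrals over t and p
  without further integrability.\<close>

lemma (in frostman_real) fourier_energy_decay_AE:
  fixes \<rho> :: "(real ^ 'n) measure"
  assumes fin: "finite_measure \<rho>" and sets [measurable_cong]: "sets \<rho> = sets borel"
    and \<gamma>: "1 < \<gamma>" and dec: "fourier_decay \<rho> \<gamma>"
    and card: "CARD('n) \<ge> 2" and \<kappa>: "1 / 2 < \<kappa>"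
  shows "AE x in \<rho>. fourier_energy \<mu> 1 (\<lambda>i. x $ i) < \<infinity>"
proof -
  interpret \<rho>: finite_measure \<rho> by fact
  obtain i1 i2 :: 'n where i12: "i1 \<noteq> i2"
    using card card_le_Suc0_iff_eq[of "UNIV :: 'n set"] by auto
  let ?P = "Pi\<^sub>M (UNIV :: 'n set) (\<lambda>_. \<mu>)"
  have ps: "prob_space ?P" by (intro prob_space_PiM prob_space_axioms)
  interpret PP: prob_space "?P \<Otimes>\<^sub>M ?P" by (intro prob_space_pair ps)
  interpret RP: pair_sigma_finite \<rho> "?P \<Otimes>\<^sub>M ?P" ..
  interpret RPf: finite_measure "\<rho> \<Otimes>\<^sub>M (?P \<Otimes>\<^sub>M ?P)"
    by (simp add: finite_measure_pair_measure \<rho>.finite_measure_axioms PP.finite_measure_axioms)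
  interpret RL: pair_sigma_finite \<rho> "lborel :: real measure" ..
  interpret PL: pair_sigma_finite "?P \<Otimes>\<^sub>M ?P" "lborel :: real measure" ..
  have comp [measurable]: "(\<lambda>x :: real ^ 'n. x $ i) \<in> borel_measurable borel" for i
    by (intro borel_measurable_continuous_onI continuous_intros)
  obtain L where L: "1 \<le> L" "\<And>z. (\<integral>\<^sup>+y. riesz_half (z - y) \<partial>\<mu>) \<le> ennreal L"
    using riesz_half_bound[OF \<kappa>] by metis
  obtain A where A: "0 < A"
    "\<And>w :: real ^ 'n. w \<noteq> 0 \<Longrightarrow> (\<integral>\<^sup>+t. ennreal (cmod (fourier_transform \<rho> (t *\<^sub>R w))) \<partial>lborel) \<le> ennreal (A / norm w)"
    using fourier_decay_line_integral[OF fin \<gamma> dec] by metis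
  define Q where "Q t p = (CLINT x|\<rho>. iexp (t * (\<Sum>i\<in>UNIV. x $ i * (fst p i - snd p i))))" for t and p :: "('n \<Rightarrow> real) \<times> ('n \<Rightarrow> real)"
  have [measurable]: "(\<lambda>(p, t). Q t p) \<in> borel_measurable ((?P \<Otimes>\<^sub>M ?P) \<Otimes>\<^sub>M lborel)"
    unfolding Q_def by measurable
  have [measurable]: "Q t \<in> borel_measurable (?P \<Otimes>\<^sub>M ?P)" for t
    unfolding Q_def by measurable
  let ?F = "\<lambda>t x. \<Prod>i\<in>UNIV. (cmod (char \<mu> (t * x $ i)))\<^sup>2"
  have F1: "?F t x \<le> 1" for t and x :: "real ^ 'n"
    by (intro prod_le_1) (auto intro!: power_le_one cmod_char_le_1)
  have F0: "0 \<le> ?F t x" for t and x :: "real ^ 'n" by (intro prod_nonneg) auto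
  have step: "(\<integral>\<^sup>+x. ennreal (?F t x) \<partial>\<rho>) \<le> (\<integral>\<^sup>+p. ennreal (cmod (Q t p)) \<partial>(?P \<Otimes>\<^sub>M ?P))" for t
  proof -
    let ?G = "\<lambda>x p. iexp (t * (\<Sum>i\<in>UNIV. x $ i * (fst p i - snd p i)))"
    have i: "integrable (\<rho> \<Otimes>\<^sub>M (?P \<Otimes>\<^sub>M ?P)) (\<lambda>(x, p). ?G x p)"
      using RPf.integrable_iexp'[of "\<lambda>(x, p). t * (\<Sum>i\<in>UNIV. x $ i * (fst p i - snd p i))"]
      by (simp add: case_prod_unfold)
    have intF: "integrable \<rho> (?F t)"
      by (rule \<rho>.integrable_const_bound[where B=1]) (use F0 F1 in auto)
    have F: "complex_of_real (?F t x) = (CLINT p|(?P \<Otimes>\<^sub>M ?P). ?G x p)" for x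
    proof -
      have "complex_of_real (?F t x) = complex_of_real ((cmod (CLINT b|?P. iexp (t * (\<Sum>i\<in>UNIV. x $ i * b i))))\<^sup>2)"
        unfolding cmod_char_proj[symmetric] char_proj_PiM ..
      also have "\<dots> = (CLINT p|(?P \<Otimes>\<^sub>M ?P). iexp (t * (\<Sum>i\<in>UNIV. x $ i * fst p i) - t * (\<Sum>i\<in>UNIV. x $ i * snd p i)))"
        by (rule finite_measure.cmod_integral_iexp_square[OF prob_space.finite_measure[OF ps]]) measurable
      also have "\<dots> = (CLINT p|(?P \<Otimes>\<^sub>M ?P). ?G x p)"
        by (simp only: right_diff_distrib sum_subtractf)
      finally show ?thesis .
    qed
    have "complex_of_real (\<integral>x. ?F t x \<partial>\<rho>) = (CLINT x|\<rho>. CLINT p|(?P \<Otimes>\<^sub>M ?P). ?G x p)"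
      unfolding integral_complex_of_real[symmetric] F ..
    also have "\<dots> = (CLINT p|(?P \<Otimes>\<^sub>M ?P). Q t p)"
      unfolding Q_def by (rule RP.Fubini_integral[OF i, symmetric])
    finally have "cmod (complex_of_real (\<integral>x. ?F t x \<partial>\<rho>)) \<le> (\<integral>p. cmod (Q t p) \<partial>(?P \<Otimes>\<^sub>M ?P))"
      by (simp only: integral_norm_bound)
    then have "(\<integral>x. ?F t x \<partial>\<rho>) \<le> (\<integral>p. cmod (Q t p) \<partial>(?P \<Otimes>\<^sub>M ?P))"
      by simp
    moreover have "(\<integral>\<^sup>+x. ennreal (?F t x) \<partial>\<rho>) = ennreal (\<integral>x. ?F t x \<partial>\<rho>)"
      by (rule nn_integral_eq_integral[OF intF]) (rule AE_I2, rule F0)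
    moreover have "(\<integral>\<^sup>+p. ennreal (cmod (Q t p)) \<partial>(?P \<Otimes>\<^sub>M ?P)) = ennreal (\<integral>p. cmod (Q t p) \<partial>(?P \<Otimes>\<^sub>M ?P))"
    proof (rule nn_integral_eq_integral)
      have "cmod (Q t p) \<le> measure \<rho> (space \<rho>)" for p
      proof -
        have "cmod (Q t p) \<le> (\<integral>x. cmod (?G x p) \<partial>\<rho>)" unfolding Q_def by (rule integral_norm_bound)
        then show ?thesis by simp
      qed
      then show "integrable (?P \<Otimes>\<^sub>M ?P) (\<lambda>p. cmod (Q t p))"
        by (intro PP.integrable_const_bound[where B="measure \<rho> (space \<rho>)"]) auto
    qed auto
    ultimately show ?thesis by (simp add: ennreal_leI)
  qed
  have line: "(\<integral>\<^sup>+t. ennreal (cmod (Q t p)) \<partial>lborel)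
      \<le> ennreal (2 * pi * A) * (riesz_half (fst p i1 - snd p i1) * riesz_half (fst p i2 - snd p i2))" for p
  proof -
    define w :: "real ^ 'n" where "w = (\<chi> i. fst p i - snd p i)"
    \<comment> \<open>The factor - 1 / (2 * pi) reconciles the two normalisations,
      \<open>iexp (t * x)\<close> in \<open>char\<close> and
      \<open>cis (- 2 * pi * (x \<bullet> \<xi>))\<close> in
      \<open>fourier_transform\<close>.\<close>
    have Qw: "Q t p = fourier_transform \<rho> (t *\<^sub>R (- (1 / (2 * pi)) *\<^sub>R w))" for t
    proof -
      have "- 2 * pi * (x \<bullet> (t *\<^sub>R (- (1 / (2 * pi)) *\<^sub>R w))) = t * (x \<bullet> w)" for x
        by simp
      then show ?thesis
        unfolding Q_def fourier_transform_def by (simp add: cis_conv_exp inner_vec_def w_def)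
    qed
    show ?thesis
    proof (cases "w $ i1 = 0 \<or> w $ i2 = 0")
      case True
      then have "riesz_half (fst p i1 - snd p i1) * riesz_half (fst p i2 - snd p i2) = \<infinity>"
        using riesz_half_ge_1[of "w $ i1"] riesz_half_ge_1[of "w $ i2"] riesz_half_0
        by (auto simp: w_def ennreal_mult_eq_top_iff)
      then show ?thesis using A(1) by (simp add: ennreal_mult_top)
    next
      case False
      then have w0: "w \<noteq> 0" by auto
      have "(\<integral>\<^sup>+t. ennreal (cmod (Q t p)) \<partial>lborel) \<le> ennreal (A / norm (- (1 / (2 * pi)) *\<^sub>R w))"
        unfolding Qw using w0 by (intro A(2)) simp
      also have "\<dots> = ennreal (2 * pi * A) * ennreal (1 / norm w)"
        using A(1) by (simp add: ennreal_mult'[symmetric])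
      \<comment> \<open>Both chosen coordinates are at most norm w in absolute value, hence so is
        their geometric mean. This separates the kernel into factors that each depend on one
        coordinate.\<close>
      also have "1 / norm w \<le> 1 / sqrt \<bar>w $ i1\<bar> * (1 / sqrt \<bar>w $ i2\<bar>)"
      proof -
        have 1: "0 < sqrt \<bar>w $ i1\<bar> * sqrt \<bar>w $ i2\<bar>" using False by simp
        have "sqrt \<bar>w $ i1\<bar> * sqrt \<bar>w $ i2\<bar> \<le> sqrt (norm w) * sqrt (norm w)"
          by (intro mult_mono) (auto simp: component_le_norm_cart)
        then have "sqrt \<bar>w $ i1\<bar> * sqrt \<bar>w $ i2\<bar> \<le> norm w" by simp
        from divide_left_mono[OF this, of 1] show ?thesis using 1 w0 by simp
      qed
      then have "ennreal (1 / norm w) \<le> ennreal (1 / sqrt \<bar>w $ i1\<bar>) * ennreal (1 / sqrt \<bar>w $ i2\<bar>)"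
        by (subst ennreal_mult'[symmetric]) (auto intro: ennreal_leI)
      also have "\<dots> \<le> riesz_half (w $ i1) * riesz_half (w $ i2)"
        using False by (intro mult_mono riesz_half_ge) auto
      finally show ?thesis by (simp add: w_def mult_left_mono)
    qed
  qed
  have "(\<integral>\<^sup>+x. fourier_energy \<mu> 1 (\<lambda>i. x $ i) \<partial>\<rho>) = (\<integral>\<^sup>+x. (\<integral>\<^sup>+t. ennreal (?F t x) \<partial>lborel) \<partial>\<rho>)"
  proof (intro nn_integral_cong)
    fix x :: "real ^ 'n"
    have "(1 + \<bar>t\<bar>) powr (1 - 1) = 1" for t :: real by auto
    then show "fourier_energy \<mu> 1 (\<lambda>i. x $ i) = (\<integral>\<^sup>+t. ennreal (?F t x) \<partial>lborel)"
      unfolding fourier_energy_def by simp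
  qed
  also have "\<dots> = (\<integral>\<^sup>+t. (\<integral>\<^sup>+x. ennreal (?F t x) \<partial>\<rho>) \<partial>lborel)"
    by (rule RL.Fubini'[symmetric]) measurable
  also have "\<dots> \<le> (\<integral>\<^sup>+t. (\<integral>\<^sup>+p. ennreal (cmod (Q t p)) \<partial>(?P \<Otimes>\<^sub>M ?P)) \<partial>lborel)"
    by (intro nn_integral_mono step)
  also have "\<dots> = (\<integral>\<^sup>+p. (\<integral>\<^sup>+t. ennreal (cmod (Q t p)) \<partial>lborel) \<partial>(?P \<Otimes>\<^sub>M ?P))"
    by (rule PL.Fubini') measurable
  also have "\<dots> \<le> (\<integral>\<^sup>+p. ennreal (2 * pi * A) * (riesz_half (fst p i1 - snd p i1) * riesz_half (fst p i2 - snd p i2)) \<partial>(?P \<Otimes>\<^sub>M ?P))"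
    by (intro nn_integral_mono line)
  also have "\<dots> = ennreal (2 * pi * A) * (\<integral>\<^sup>+p. riesz_half (fst p i1 - snd p i1) * riesz_half (fst p i2 - snd p i2) \<partial>(?P \<Otimes>\<^sub>M ?P))"
    by (rule nn_integral_cmult) measurable
  also have "(\<integral>\<^sup>+p. riesz_half (fst p i1 - snd p i1) * riesz_half (fst p i2 - snd p i2) \<partial>(?P \<Otimes>\<^sub>M ?P))
      = (\<integral>\<^sup>+u. (\<integral>\<^sup>+v. riesz_half (u i1 - v i1) * riesz_half (u i2 - v i2) \<partial>?P) \<partial>?P)"
    by (subst sigma_finite_measure.nn_integral_fst[OF prob_space_imp_sigma_finite[OF ps], symmetric]) auto
  also have "\<dots> \<le> (\<integral>\<^sup>+u. ennreal (L ^ CARD('n)) \<partial>?P)"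
  proof (rule nn_integral_mono)
    fix u :: "'n \<Rightarrow> real"
    \<comment> \<open>Padding with the constant 1 on the other coordinates gives a product over all
      of them, to which the product formula applies.\<close>
    define h where "h i y = (if i \<in> {i1, i2} then riesz_half (u i - y) else 1)" for i y
    have [measurable]: "h i \<in> borel_measurable borel" for i
      unfolding h_def by (cases "i \<in> {i1, i2}") auto
    have "(\<Prod>i\<in>UNIV. h i (v i)) = (\<Prod>i\<in>{i1, i2}. riesz_half (u i - v i))" for v
      unfolding h_def by (subst prod.If_cases) (auto intro: prod.cong)
    then have "(\<integral>\<^sup>+v. riesz_half (u i1 - v i1) * riesz_half (u i2 - v i2) \<partial>?P) = (\<integral>\<^sup>+v. (\<Prod>i\<in>UNIV. h i (v i)) \<partial>?P)"
      using i12 by simp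
    also have "\<dots> = (\<Prod>i\<in>UNIV. \<integral>\<^sup>+y. h i y \<partial>\<mu>)"
      by (rule prod.product_nn_integral_prod) auto
    also have "\<dots> \<le> (\<Prod>i\<in>(UNIV :: 'n set). ennreal L)"
    proof (rule prod_mono_ennreal)
      fix i
      show "(\<integral>\<^sup>+y. h i y \<partial>\<mu>) \<le> ennreal L"
        using L(2)[of "u i"] ennreal_leI[OF L(1)]
        by (cases "i \<in> {i1, i2}") (auto simp: h_def emeasure_space_1)
    qed
    also have "\<dots> = ennreal (L ^ CARD('n))" using L(1) by (simp add: ennreal_power)
    finally show "(\<integral>\<^sup>+v. riesz_half (u i1 - v i1) * riesz_half (u i2 - v i2) \<partial>?P) \<le> \<dots>" .
  qed
  also have "\<dots> = ennreal (L ^ CARD('n))" by (simp add: prob_space.emeasure_space_1[OF ps])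
  finally have "(\<integral>\<^sup>+x. fourier_energy \<mu> 1 (\<lambda>i. x $ i) \<partial>\<rho>) \<le> ennreal (2 * pi * A) * ennreal (L ^ CARD('n))"
    by (simp add: mult_left_mono)
  also have "\<dots> < \<infinity>" by (simp add: ennreal_mult_less_top)
  finally have "(\<integral>\<^sup>+x. fourier_energy \<mu> 1 (\<lambda>i. x $ i) \<partial>\<rho>) \<noteq> \<infinity>" by simp
  then have "AE x in \<rho>. fourier_energy \<mu> 1 (\<lambda>i. x $ i) \<noteq> \<infinity>"
    by (intro nn_integral_noteq_infinite) (simp_all add: fourier_energy_def)
  then show ?thesis by eventually_elim (simp add: less_top)
qed

section \<open>Sums of dilates\<close>

context frostman_real
begin

lemma fourier_energy_imp_hausdorff_dim:
  fixes x :: "'n::finite \<Rightarrow> real"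
  assumes "fourier_energy \<mu> s x < \<infinity>" "0 \<le> s" "s \<le> 1" "AE y in \<mu>. y \<in> A"
  shows "s \<le> hausdorff_dim (lin_sumset x A)"
proof -
  obtain c where c: "correlation_bound (proj_measure \<mu> x) c s"
    using fourier_energy_imp_correlation[OF assms(1-3)] by blast
  show ?thesis
    by (rule hausdorff_dim_ge[OF prob_space_proj sets_proj AE_proj[OF assms(4)] c])
qed

lemma fourier_energy_imp_outer_measure:
  fixes x :: "'n::finite \<Rightarrow> real"
  assumes "fourier_energy \<mu> 1 x < \<infinity>" "AE y in \<mu>. y \<in> A"
  shows "0 < outer_measure_of lborel (lin_sumset x A)"
proof -
  obtain c where c: "correlation_bound (proj_measure \<mu> x) c 1"
    using fourier_energy_imp_correlation[OF assms(1)] by auto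
  show ?thesis
    by (rule outer_measure_pos[OF prob_space_proj sets_proj AE_proj[OF assms(2)] c])
qed

lemma null_singleton:
  assumes "0 < \<kappa>"
  shows "AE y in \<mu>. y \<noteq> 0"
proof -
  have "measure \<mu> {0} \<le> 0"
  proof (rule tendsto_lowerbound)
    have "((\<lambda>r. C * r powr \<kappa>) \<longlongrightarrow> C * 0) (at_right 0)"
      using assms by (intro tendsto_intros) (auto intro!: tendsto_eq_intros simp: eventually_at_filter)
    then show "((\<lambda>r. C * r powr \<kappa>) \<longlongrightarrow> 0) (at_right 0)" by simp
    show "\<forall>\<^sub>F r in at_right 0. measure \<mu> {0} \<le> C * r powr \<kappa>"
      unfolding eventually_at_filter
    proof (intro always_eventually allI impI)
      fix r :: real assume "r \<noteq> 0" "r \<in> {0<..}"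
      then have "measure \<mu> {0} \<le> measure \<mu> (cball 0 r)"
        by (intro finite_measure_mono) (auto simp: sets_eq_borel)
      also have "\<dots> \<le> C * r powr \<kappa>" using \<open>r \<in> {0<..}\<close> by (intro ball) auto
      finally show "measure \<mu> {0} \<le> C * r powr \<kappa>" .
    qed
  qed simp
  then have "emeasure \<mu> {0} = 0" by (simp add: emeasure_eq_measure measure_le_0_iff)
  then show ?thesis
    by (intro AE_I[of _ _ "{0}"]) (auto simp: sets_eq_borel)
qed

text \<open>The cutoff is removed by exhaustion with b = 1 / (m + 1), as a i0 \<noteq> 0 almost
  surely. The threshold for s is the general one with \<beta> = (d - 1) * \<kappa>.\<close>

lemma fourier_energy_product_AE:
  assumes \<kappa>: "0 < \<kappa>" and s: "s \<le> 1" "s < 1 - real CARD('n) + (2 * real CARD('n) - 1) * \<kappa>"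
  shows "AE a in Pi\<^sub>M (UNIV :: 'n::finite set) (\<lambda>_. \<mu>). fourier_energy \<mu> s a < \<infinity>"
proof -
  let ?P = "Pi\<^sub>M (UNIV :: 'n set) (\<lambda>_. \<mu>)"
  \<comment> \<open>An arbitrary coordinate: all of them have the same law, without an atom at
    0.\<close>
  define i0 :: 'n where "i0 = undefined"
  have ps: "prob_space ?P" by (intro prob_space_PiM prob_space_axioms)
  have sp: "space \<mu> = UNIV" using sets_eq_imp_space_eq[OF sets_eq_borel] by simp
  have bd: "AE a in ?P. \<forall>i. \<bar>a i\<bar> \<le> D"
    by (intro AE_all_countable[THEN iffD2] allI AE_PiM_component[OF prob_space_axioms _ bounded]) simp
  have "AE a in ?P. b \<le> \<bar>a i0\<bar> \<longrightarrow> fourier_energy \<mu> s a < \<infinity>" if b: "0 < b" for b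
  proof -
    let ?B = "{a :: 'n \<Rightarrow> real. b \<le> \<bar>a i0\<bar>}"
    have "{a \<in> space ?P. b \<le> \<bar>a i0\<bar>} \<in> sets ?P" by measurable
    then have B [measurable]: "?B \<in> sets ?P" by (simp add: space_PiM sp)
    let ?\<rho> = "density ?P (indicator ?B)"
    obtain K where K: "0 \<le> K" "bump_bound ?\<rho> (\<lambda>i a. a (i :: 'n)) K ((CARD('n) - 1) * \<kappa>)"
      using bump_bound_product[OF b] by metis
    have "AE a in ?\<rho>. fourier_energy \<mu> s (\<lambda>i. a i) < \<infinity>"
    proof (rule fourier_energy_finite_AE[OF _ _ _ K(2,1) s(1)])
      show "finite_measure ?\<rho>"
        by (rule finite_measureI)
           (simp add: emeasure_density nn_integral_indicator prob_space.emeasure_le_1[OF ps] B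
             order.strict_trans1[OF prob_space.emeasure_le_1[OF ps]] less_top)
      show "AE a in ?\<rho>. \<forall>i. \<bar>a i\<bar> \<le> D"
        by (subst AE_density) (use bd in \<open>auto elim: eventually_mono\<close>)
      have "real (CARD('n) - 1) = real CARD('n) - 1" by (simp add: of_nat_diff Suc_leI)
      then show "s < 1 - CARD('n) * (1 - \<kappa>) + (CARD('n) - 1) * \<kappa>"
        using s(2) by (simp add: algebra_simps)
    qed simp
    then show ?thesis by (subst (asm) AE_density) (auto simp: indicator_def elim: eventually_mono)
  qed
  then have "AE a in ?P. \<forall>m. 1 / real (Suc m) \<le> \<bar>a i0\<bar> \<longrightarrow> fourier_energy \<mu> s a < \<infinity>"
    by (intro AE_all_countable[THEN iffD2] allI) simp
  moreover have "AE a in ?P. a i0 \<noteq> 0"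
    by (intro AE_PiM_component[OF prob_space_axioms _ null_singleton[OF \<kappa>]]) simp
  ultimately show ?thesis
  proof eventually_elim
    case (elim a)
    then obtain m where "1 / real (Suc m) < \<bar>a i0\<bar>" using nat_approx_posE[of "\<bar>a i0\<bar>"] by auto
    then show ?case using elim(1) by (meson less_imp_le)
  qed
qed

text \<open>A given coordinate may vanish on a set of positive measure, so every i0 is used in turn
  and only x \<noteq> 0 is required. The tube bound for v = 0 is a ball bound at the origin and
  excludes an atom there.\<close>

lemma fourier_energy_tube_AE:
  fixes \<rho> :: "(real ^ 'n) measure"
  assumes sets: "sets \<rho> = sets borel" and fin: "finite_measure \<rho>" and bd: "AE x in \<rho>. norm x \<le> D'"
    and \<beta>: "0 < \<beta>" and T: "0 \<le> T"
    and tube: "\<And>v r. 0 < r \<Longrightarrow> emeasure \<rho> {x. infdist x (range (\<lambda>\<tau>. \<tau> *\<^sub>R v)) \<le> r} \<le> ennreal (T * r powr \<beta>)"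
    and s: "s \<le> 1" "s < 1 - CARD('n) * (1 - \<kappa>) + \<beta>"
  shows "AE x in \<rho>. fourier_energy \<mu> s (\<lambda>i. x $ i) < \<infinity>"
proof -
  interpret \<rho>: finite_measure \<rho> by fact
  have [measurable_cong]: "sets \<rho> = sets borel" by fact
  have comp [measurable]: "(\<lambda>x :: real ^ 'n. x $ i) \<in> borel_measurable borel" for i
    by (intro borel_measurable_continuous_onI continuous_intros)
  have "AE x in \<rho>. b \<le> \<bar>x $ i0\<bar> \<longrightarrow> fourier_energy \<mu> s (\<lambda>i. x $ i) < \<infinity>" if b: "0 < b" for b i0
  proof -
    let ?B = "{x :: real ^ 'n. b \<le> \<bar>x $ i0\<bar>}"
    have "closed ?B" by (intro closed_Collect_le continuous_intros)
    then have B [measurable]: "?B \<in> sets \<rho>" by (simp add: sets)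
    let ?\<rho> = "density \<rho> (indicator ?B)"
    obtain K where K: "0 \<le> K" "bump_bound ?\<rho> (\<lambda>i x. x $ i) K \<beta>"
      using bump_bound_tube[OF sets fin b T tube] by metis
    have "AE x in ?\<rho>. fourier_energy \<mu> s (\<lambda>i. x $ i) < \<infinity>"
    proof (rule fourier_energy_finite_AE[OF _ _ _ K(2,1) s])
      show "finite_measure ?\<rho>"
        using B by (intro finite_measureI) (simp add: emeasure_density \<rho>.emeasure_finite)
      show "AE x in ?\<rho>. \<forall>i. \<bar>x $ i\<bar> \<le> D'"
        using bd by (subst AE_density)
          (auto elim!: eventually_mono intro: order_trans[OF component_le_norm_cart])
    qed simp
    then show ?thesis by (subst (asm) AE_density) (auto simp: indicator_def elim: eventually_mono)
  qed
  then have "AE x in \<rho>. \<forall>i m. 1 / real (Suc m) \<le> \<bar>x $ i\<bar> \<longrightarrow> fourier_energy \<mu> s (\<lambda>i. x $ i) < \<infinity>"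
    by (intro AE_all_countable[THEN iffD2] allI) simp
  moreover have "AE x in \<rho>. x \<noteq> 0"
  proof -
    have "emeasure \<rho> {0} \<le> 0"
    proof (rule tendsto_lowerbound)
      have "((\<lambda>r. T * r powr \<beta>) \<longlongrightarrow> T * 0) (at_right 0)"
        using \<beta> by (intro tendsto_intros) (auto intro!: tendsto_eq_intros simp: eventually_at_filter)
      then show "((\<lambda>r. ennreal (T * r powr \<beta>)) \<longlongrightarrow> 0) (at_right 0)"
        using tendsto_ennrealI by fastforce
      show "\<forall>\<^sub>F r in at_right 0. emeasure \<rho> {0} \<le> ennreal (T * r powr \<beta>)"
        unfolding eventually_at_filter
      proof (intro always_eventually allI impI)
        fix r :: real assume "r \<noteq> 0" "r \<in> {0<..}"
        then have r: "0 < r" by simp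
        have "{x :: real ^ 'n. infdist x (range (\<lambda>\<tau>. \<tau> *\<^sub>R 0)) \<le> r} = cball 0 r"
          by (auto simp: dist_commute simp del: dist_0_norm)
        then have "emeasure \<rho> (cball 0 r) \<le> ennreal (T * r powr \<beta>)" using tube[OF r, of 0] by simp
        moreover have "emeasure \<rho> {0} \<le> emeasure \<rho> (cball 0 r)"
          using r by (intro emeasure_mono) (auto simp: sets)
        ultimately show "emeasure \<rho> {0} \<le> ennreal (T * r powr \<beta>)" by (rule order_trans[rotated])
      qed
    qed simp
    then show ?thesis by (intro AE_I[of _ _ "{0}"]) (auto simp: sets)
  qed
  ultimately show ?thesis
  proof eventually_elim
    case (elim x)
    then obtain i where "x $ i \<noteq> 0" by (auto simp: vec_eq_iff)
    then obtain m where "1 / real (Suc m) < \<bar>x $ i\<bar>" using nat_approx_posE[of "\<bar>x $ i\<bar>"] by auto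
    then show ?case using elim(1) by (meson less_imp_le)
  qed
qed

end

section \<open>Choice of exponents and conclusion\<close>

lemma frostman_imp_frostman_real:
  assumes fr: "frostman_measure \<mu> A" and \<kappa>: "0 \<le> \<kappa>" "\<kappa> < hausdorff_dim A"
  obtains D C where "frostman_real \<mu> D C \<kappa>"
proof -
  obtain D where D: "0 < D" "AE y in \<mu>. norm y \<le> D" using frostman_bounded[OF fr] .
  obtain C where C: "0 \<le> C" "\<forall>x r. 0 < r \<longrightarrow> measure \<mu> (cball x r) \<le> C * r powr \<kappa>"
    using frostman_cball[OF fr \<kappa>(2,1)] by blast
  interpret prob_space \<mu> using fr by (rule frostman_measureD)
  have "frostman_real \<mu> D C \<kappa>"
    using D C frostman_measureD(2)[OF fr] by unfold_locales auto
  then show thesis by (rule that)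
qed

theorem corollary1p0p5:
  fixes A :: "real set" and \<mu>A :: "real measure"
  assumes "CARD('n::finite) \<ge> 2"
    and "frostman_measure \<mu>A A"
  shows
    "(\<forall>\<epsilon>::real. 0 < \<epsilon> \<and> \<epsilon> \<le> 1/2 \<and> hausdorff_dim A > 1/2 + \<epsilon> \<longrightarrow>
        (AE a in Pi\<^sub>M (UNIV :: 'n set) (\<lambda>_. \<mu>A).
           hausdorff_dim (lin_sumset a A) \<ge> min 1 (1/2 + \<epsilon> * (2 * real CARD('n) - 1))))
     \<and>
     (hausdorff_dim A > 1/2 + 1 / (2 * (2 * real CARD('n) - 1)) \<longrightarrow>
        (AE a in Pi\<^sub>M (UNIV :: 'n set) (\<lambda>_. \<mu>A).
           outer_measure_of lborel (lin_sumset a A) > 0))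
     \<and>
     (\<forall>(F :: (real ^ 'n) set) \<mu>F. star_like F \<and> frostman_measure \<mu>F F \<longrightarrow>
        (hausdorff_dim A + hausdorff_dim F / real CARD('n) > 1 \<longrightarrow>
           (AE x in \<mu>F. outer_measure_of lborel (lin_sumset (\<lambda>i. x $ i) A) > 0))
        \<and>
        (\<forall>\<epsilon>>0. hausdorff_dim A = 1/2 + \<epsilon> \<and> hausdorff_dim F > real CARD('n) / 2 - \<epsilon> \<longrightarrow>
           (AE x in \<mu>F. outer_measure_of lborel (lin_sumset (\<lambda>i. x $ i) A) > 0)))
     \<and>
     (\<forall>(F :: (real ^ 'n) set) \<mu>F \<gamma>F.
        finite_measure \<mu>F \<and> sets \<mu>F = sets borel \<and> compactly_supported_on \<mu>F F \<and>
        \<gamma>F > 1 \<and> fourier_decay \<mu>F \<gamma>F \<and> hausdorff_dim A > 1/2 \<longrightarrow>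
           (AE x in \<mu>F. outer_measure_of lborel (lin_sumset (\<lambda>i. x $ i) A) > 0))"
proof -
  note card = assms(1) and fr = assms(2)
  define d where "d = real CARD('n)"
  have d: "2 \<le> d" using card by (simp add: d_def)
  have AA: "AE y in \<mu>A. y \<in> A" using fr by (rule frostman_measureD)
  have product: "AE a in Pi\<^sub>M (UNIV :: 'n set) (\<lambda>_. \<mu>A). fourier_energy \<mu>A s a < \<infinity>"
    if s: "0 \<le> s" "s \<le> 1" "s < 1 - d + (2 * d - 1) * hausdorff_dim A" for s
  proof -
    \<comment> \<open>The threshold solved for the exponent; strictness leaves room for some
      \<kappa> below dim A.\<close>
    have "(s + d - 1) / (2 * d - 1) < hausdorff_dim A"
      using s(3) d by (simp add: field_simps)
    then obtain \<kappa> where \<kappa>: "(s + d - 1) / (2 * d - 1) < \<kappa>" "\<kappa> < hausdorff_dim A"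
      using dense[of "(s + d - 1) / (2 * d - 1)" "hausdorff_dim A"] by blast
    have "0 < (s + d - 1) / (2 * d - 1)" using s(1) d by (intro divide_pos_pos) auto
    then have \<kappa>0: "0 < \<kappa>" using \<kappa>(1) by linarith
    have "s + d - 1 < \<kappa> * (2 * d - 1)" using \<kappa>(1) d by (simp add: field_simps)
    then have s': "s < 1 - d + (2 * d - 1) * \<kappa>" by (simp add: algebra_simps)
    obtain D C where "frostman_real \<mu>A D C \<kappa>"
      using frostman_imp_frostman_real[OF fr _ \<kappa>(2)] \<kappa>0 by auto
    then interpret frostman_real \<mu>A D C \<kappa> .
    show ?thesis using fourier_energy_product_AE[OF \<kappa>0 s(2)] s' unfolding d_def by blast
  qed
  have part3: "AE x in \<mu>F. outer_measure_of lborel (lin_sumset (\<lambda>i. x $ i) A) > 0"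
    if star: "star_like F" and frF: "frostman_measure \<mu>F F" and dim: "d < d * hausdorff_dim A + hausdorff_dim F"
    for F :: "(real ^ 'n) set" and \<mu>F
  proof -
    \<comment> \<open>Lowering both dimensions by g costs (d + 1) * g in d * dim A + dim F, which is
      half of the slack.\<close>
    define g where "g = (d * hausdorff_dim A + hausdorff_dim F - d) / (2 * (d + 1))"
    have g: "0 < g" using dim d by (simp add: g_def)
    have dA: "hausdorff_dim A \<le> 1" using frostman_dim_le[OF fr] by simp
    have dF: "hausdorff_dim F \<le> d" using frostman_dim_le[OF frF] by (simp add: d_def)
    define \<kappa> where "\<kappa> = hausdorff_dim A - g"
    define \<beta> where "\<beta> = hausdorff_dim F - g"
    have "2 * (d + 1) * g = d * hausdorff_dim A + hausdorff_dim F - d"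
      using d unfolding g_def by simp
    then have g2: "2 * (d * g + g) = d * hausdorff_dim A + hausdorff_dim F - d"
      by (simp add: algebra_simps)
    have dA': "d * hausdorff_dim A \<le> d" using dA d by simp
    \<comment> \<open>Since dim A <= 1, the slack is at most dim F; since dim F <= d, it is at most
      d * dim A. Hence g is smaller than either dimension.\<close>
    have \<beta>: "0 < \<beta>" "\<beta> < hausdorff_dim F"
    proof -
      have "2 * g \<le> 2 * (d * g + g)" using g d by simp
      then show "0 < \<beta>" using g2 dA' dim unfolding \<beta>_def by linarith
    qed (use g in \<open>simp add: \<beta>_def\<close>)
    have \<kappa>: "0 < \<kappa>" "\<kappa> < hausdorff_dim A"
    proof -
      have "0 < d * hausdorff_dim A" using dF dim by linarith
      moreover have "2 * (d * g) + 2 * g \<le> d * hausdorff_dim A" using g2 dF by (simp add: algebra_simps)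
      ultimately have "d * g < d * hausdorff_dim A" using g by linarith
      then show "0 < \<kappa>" using d by (simp add: \<kappa>_def)
    qed (use g in \<open>simp add: \<kappa>_def\<close>)
    have s: "(1::real) < 1 - CARD('n) * (1 - \<kappa>) + \<beta>"
    proof -
      have "0 < d * g + g" using g d by (simp add: add_nonneg_pos)
      then have "d < d * \<kappa> + \<beta>" using g2 unfolding \<kappa>_def \<beta>_def by (simp add: algebra_simps)
      then show ?thesis by (simp add: d_def algebra_simps)
    qed
    obtain D C where "frostman_real \<mu>A D C \<kappa>"
      using frostman_imp_frostman_real[OF fr _ \<kappa>(2)] \<kappa>(1) by auto
    then interpret frostman_real \<mu>A D C \<kappa> .
    obtain T where T: "0 \<le> T" "\<And>v r. 0 < r \<Longrightarrow> emeasure \<mu>F {x. infdist x (range (\<lambda>\<tau>. \<tau> *\<^sub>R v)) \<le> r} \<le> ennreal (T * r powr \<beta>)"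
      using star_like_tube_bound[OF star frF less_imp_le[OF \<beta>(1)] \<beta>(2)] by metis
    obtain D' where D': "AE x in \<mu>F. norm x \<le> D'" using frostman_bounded[OF frF] by blast
    have "AE x in \<mu>F. fourier_energy \<mu>A 1 (\<lambda>i. x $ i) < \<infinity>"
      by (rule fourier_energy_tube_AE[OF frostman_measureD(2)[OF frF]
            prob_space.finite_measure[OF frostman_measureD(1)[OF frF]] D' \<beta>(1) T _ s]) simp_all
    then show ?thesis
      by eventually_elim (rule fourier_energy_imp_outer_measure[OF _ AA])
  qed
  have 1: "AE a in Pi\<^sub>M (UNIV :: 'n set) (\<lambda>_. \<mu>A).
           hausdorff_dim (lin_sumset a A) \<ge> min 1 (1/2 + \<epsilon> * (2 * real CARD('n) - 1))"
    if \<epsilon>: "0 < \<epsilon>" "hausdorff_dim A > 1/2 + \<epsilon>" for \<epsilon>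
  proof -
    define s where "s = min 1 (1/2 + \<epsilon> * (2 * d - 1))"
    have s: "0 \<le> s" "s \<le> 1" using \<epsilon> d by (auto simp: s_def)
    have "s \<le> 1/2 + \<epsilon> * (2 * d - 1)" by (simp add: s_def)
    \<comment> \<open>At dim A = 1/2 + \<epsilon> the threshold is exactly the exponent claimed, so
      the strict hypothesis yields that exponent itself, without an approximation from
      below.\<close>
    also have "\<dots> = 1 - d + (2 * d - 1) * (1/2 + \<epsilon>)" by (simp add: algebra_simps)
    also have "\<dots> < 1 - d + (2 * d - 1) * hausdorff_dim A"
      using \<epsilon> d by simp
    finally have "AE a in Pi\<^sub>M (UNIV :: 'n set) (\<lambda>_. \<mu>A). fourier_energy \<mu>A s a < \<infinity>"
      by (rule product[OF s])
    \<comment> \<open>Any exponent below dim A serves here: the passage from finite energy to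
      dimension does not involve it.\<close>
    moreover obtain D C where "frostman_real \<mu>A D C (1/2)"
      using frostman_imp_frostman_real[OF fr, of "1/2"] \<epsilon> by auto
    then interpret frostman_real \<mu>A D C "1/2" .
    show ?thesis
      using calculation unfolding d_def[symmetric] s_def[symmetric]
      by eventually_elim (rule fourier_energy_imp_hausdorff_dim[OF _ s AA])
  qed
  have 2: "AE a in Pi\<^sub>M (UNIV :: 'n set) (\<lambda>_. \<mu>A). outer_measure_of lborel (lin_sumset a A) > 0"
    if dim: "hausdorff_dim A > 1/2 + 1 / (2 * (2 * real CARD('n) - 1))"
  proof -
    have "0 < 1 / (2 * (2 * d - 1))" using d by simp
    then have half: "1/2 < hausdorff_dim A" using dim unfolding d_def[symmetric] by linarith
    \<comment> \<open>The hypothesis of (2) is the threshold inequality at s = 1.\<close>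
    have "d = (2 * d - 1) * (1/2 + 1 / (2 * (2 * d - 1)))" using d by (simp add: field_simps)
    also have "\<dots> < (2 * d - 1) * hausdorff_dim A"
      using dim d unfolding d_def[symmetric] by (intro mult_strict_left_mono) auto
    finally have "AE a in Pi\<^sub>M (UNIV :: 'n set) (\<lambda>_. \<mu>A). fourier_energy \<mu>A 1 a < \<infinity>"
      by (intro product) auto
    moreover obtain D C where "frostman_real \<mu>A D C (1/2)"
      using frostman_imp_frostman_real[OF fr, of "1/2"] half by auto
    then interpret frostman_real \<mu>A D C "1/2" .
    show ?thesis
      using calculation by eventually_elim (rule fourier_energy_imp_outer_measure[OF _ AA])
  qed
  have 3: "AE x in \<mu>F. outer_measure_of lborel (lin_sumset (\<lambda>i. x $ i) A) > 0"
    if "star_like F" "frostman_measure \<mu>F F" "hausdorff_dim A + hausdorff_dim F / real CARD('n) > 1"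
    for F :: "(real ^ 'n) set" and \<mu>F
    using that d by (intro part3[of F]) (simp_all add: d_def field_simps)
  have 5: "AE x in \<mu>F. outer_measure_of lborel (lin_sumset (\<lambda>i. x $ i) A) > 0"
    if "star_like F" "frostman_measure \<mu>F F" "0 < \<epsilon>" "hausdorff_dim A = 1/2 + \<epsilon>"
      "hausdorff_dim F > real CARD('n) / 2 - \<epsilon>"
    for F :: "(real ^ 'n) set" and \<mu>F \<epsilon>
  proof (rule part3[OF that(1,2)])
    have "2 * \<epsilon> \<le> d * \<epsilon>" using d that(3) by (intro mult_right_mono) auto
    then have "d < d / 2 + d * \<epsilon> + (d / 2 - \<epsilon>)" using that(3) by simp
    also have "\<dots> < d * hausdorff_dim A + hausdorff_dim F"
      using that(4,5) by (simp add: d_def algebra_simps)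
    finally show "d < d * hausdorff_dim A + hausdorff_dim F" .
  qed
  have 4: "AE x in \<mu>F. outer_measure_of lborel (lin_sumset (\<lambda>i. x $ i) A) > 0"
    if F: "finite_measure \<mu>F" "sets \<mu>F = sets borel" "\<gamma>F > 1" "fourier_decay \<mu>F \<gamma>F" and dim: "hausdorff_dim A > 1/2"
    for \<mu>F :: "(real ^ 'n) measure" and \<gamma>F
  proof -
    obtain \<kappa> where \<kappa>: "1/2 < \<kappa>" "\<kappa> < hausdorff_dim A" using dense[OF dim] by blast
    obtain D C where "frostman_real \<mu>A D C \<kappa>"
      using frostman_imp_frostman_real[OF fr _ \<kappa>(2)] \<kappa>(1) by auto
    then interpret frostman_real \<mu>A D C \<kappa> .
    have "AE x in \<mu>F. fourier_energy \<mu>A 1 (\<lambda>i. x $ i) < \<infinity>"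
      by (rule fourier_energy_decay_AE[OF F card \<kappa>(1)])
    then show ?thesis
      by eventually_elim (rule fourier_energy_imp_outer_measure[OF _ AA])
  qed
  show ?thesis
    using 1 2 3 4 5 by blast
qed

end
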